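(* Let $V\colon\mathbb{R}\to\mathbb{R}$ be smooth and $f=V'$. For every $C>0$ there exist $T=T(C)>0$ and $h_*=h_*(C)>0$ such that for every $h\in(0,h_*]$ and every $U_0\in H^1(S^1)\times H^1_h(S^1)$ with $\lVert U_0\rVert_{H^1\times H^1_h}\le C$ there exists a unique mild solution $U=(u,p)\in C([0,T];H^1(S^1)\times H^1_h(S^1))$ with $U(0)=U_0$ to the modified equation $$\dot u=p,\qquad \dot p=K(u)^{-1}\Bigl(\partial_{xx}u+f(u)+\tfrac{h^2}{12}\,f''(u)\,p^2\Bigr),$$ where $K(u)v=\bigl(1-\tfrac{h^2}{6}f'(u)-\tfrac{h^2}{6}\partial_{xx}\bigr)v$. The bounds on the solution are uniform in $h$: there is a constant $C'=C'(C)$, independent of $h\in(0,h_*]$ and of $U_0\in H^1(S^1)\times H^1_h(S^1)$ with $\lVert U_0\rVert_{H^1\times H^1_h}\le C$, such that $\sup_{t\in[0,T]}\lVert U(t)\rVert_{H^1\times H^1_h}\le C'$.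
   Context: Functions are real-valued on the circle $S^1=\mathbb{R}/2\pi\mathbb{Z}$; $v_k$, $k\in\mathbb{Z}$, denote the Fourier coefficients of $v$. The norms are $\lVert v\rVert_{L^2}^2=\sum_{k}\lvert v_k\rvert^2$, $\lVert v\rVert_{H^s}^2=\sum_{k}(1+\lvert k\rvert^{2s})\lvert v_k\rvert^2$. For $h>0$, $H^1_h(S^1)$ is the space $H^1(S^1)$ endowed with the $h$-dependent norm $\lVert v\rVert_{H^1_h}^2=\sum_{k}(1+\tfrac{h^2}{6}\lvert k\rvert^2)\lvert v_k\rvert^2$. The product norm is $\lVert (u,p)\rVert_{H^1\times H^1_h}^2=\lVert u\rVert_{H^1}^2+\lVert p\rVert_{H^1_h}^2$. Write $K(u)=L+M(u)$ with $Lv=(1-\tfrac{h^2}{6}\partial_{xx})v$ and $M(u)v=-\tfrac{h^2}{6}f'(u)v$, and $K(u)^{-1}\colon L^2(S^1)\to H^2(S^1)$ for the inverse of $K(u)\colon H^2(S^1)\to L^2(S^1)$. Since $K^{-1}-L^{-1}=-K^{-1}ML^{-1}$, the modified equation can be written as the semilinear evolution equation $\dot U=AU+B(U)$ for $U=(u,p)$ with $$A=\begin{pmatrix}0&1\\ L^{-1}\partial_{xx}&0\end{pmatrix},\qquad B(U)=\begin{pmatrix}0\\ K(u)^{-1}\bigl(-M(u)L^{-1}\partial_{xx}u+f(u)+\tfrac{h^2}{12}f''(u)p^2\bigr)\end{pmatrix}.$$ A mild solution on $[0,T]$ with initial value $U_0$ is a function $U\in C([0,T];H^1\times H^1_h)$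 such that $K(u(t))$ is invertible for all $t\in[0,T]$ (so that $B(U(t))$ is defined) and $U(t)=e^{tA}U_0+\int_0^t e^{(t-s)A}B(U(s))\,ds$ for all $t\in[0,T]$. The constants $T$, $h_*$, $C'$ may depend on $V$. *)

theory Defs
  imports "HOL-Analysis.Analysis"
begin

section \<open>Fourier coefficients and Sobolev spaces on the circle\<close>

text \<open>Functions on the circle are \<open>2\<pi>\<close>-periodic functions on the real line. The coefficients are
  normalised so that \<open>v(x) = \<Sum>k. v\<^sub>k e\<^bsup>ikx\<^esup>\<close>.\<close>

definition periodic :: "(real \<Rightarrow> real) \<Rightarrow> bool" where
  "periodic v \<longleftrightarrow> (\<forall>x. v (x + 2 * pi) = v x)"

definition fcoeff :: "(real \<Rightarrow> real) \<Rightarrow> int \<Rightarrow> complex" where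
  "fcoeff v k = (LINT x:{0..2*pi}|lebesgue. complex_of_real (v x) * cis (- (of_int k * x))) / (2 * pi)"

text \<open>Representatives of the elements of \<open>L\<^sup>2(S\<^sup>1)\<close>; equality in \<open>L\<^sup>2(S\<^sup>1)\<close> is equality almost everywhere.\<close>

definition L2_circle :: "(real \<Rightarrow> real) set" where
  "L2_circle = {g. periodic g \<and> g \<in> borel_measurable lebesgue
     \<and> set_integrable lebesgue {0..2*pi} (\<lambda>x. (g x)\<^sup>2)}"

lemma fcoeff_continuous:
  assumes "continuous_on UNIV v"
  shows "fcoeff v k = integral {0..2*pi} (\<lambda>x. complex_of_real (v x) * cis (- (of_int k * x))) / (2 * pi)"
proof -
  have "continuous_on {0..2*pi} (\<lambda>x. complex_of_real (v x) * cis (- (of_int k * x)))"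
    by (intro continuous_intros continuous_on_subset[OF assms]) auto
  then have "set_integrable lebesgue {0..2*pi} (\<lambda>x. complex_of_real (v x) * cis (- (of_int k * x)))"
    by (rule absolutely_integrable_continuous_real)
  then show ?thesis
    unfolding fcoeff_def by (simp add: set_lebesgue_integral_eq_integral(2))
qed

lemma fcoeff_integrable:
  assumes "continuous_on UNIV v"
  shows "(\<lambda>x. complex_of_real (v x) * cis (- (of_int k * x))) integrable_on {0..2*pi}"
  by (intro integrable_continuous_real continuous_intros continuous_on_subset[OF assms]) auto

lemma fcoeff_zero [simp]: "fcoeff (\<lambda>x. 0) k = 0"
  by (simp add: fcoeff_def)

lemma fcoeff_add:
  assumes "continuous_on UNIV v" "continuous_on UNIV w"
  shows "fcoeff (\<lambda>x. v x + w x) k = fcoeff v k + fcoeff w k"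
proof -
  have "continuous_on UNIV (\<lambda>x. v x + w x)"
    using assms by (intro continuous_intros)
  then show ?thesis
    using fcoeff_integrable[OF assms(1), of k] fcoeff_integrable[OF assms(2), of k] assms
    by (simp add: fcoeff_continuous ring_distribs integral_add add_divide_distrib)
qed

lemma fcoeff_scale:
  assumes "continuous_on UNIV v"
  shows "fcoeff (\<lambda>x. c * v x) k = of_real c * fcoeff v k"
proof -
  have "continuous_on UNIV (\<lambda>x. c * v x)"
    using assms by (intro continuous_intros)
  then show ?thesis
    using assms by (simp add: fcoeff_continuous mult.assoc)
qed

inductive trig_poly :: "(real \<Rightarrow> complex) \<Rightarrow> bool" where
  monom: "trig_poly (\<lambda>x. c * cis (of_int k * x))"
| add: "trig_poly a \<Longrightarrow> trig_poly b \<Longrightarrow> trig_poly (\<lambda>x. a x + b x)"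

lemma trig_poly_mult_monom:
  assumes "trig_poly a"
  shows "trig_poly (\<lambda>x. (c * cis (of_int k * x)) * a x)"
  using assms
proof induction
  case (monom d l)
  have "(\<lambda>x. (c * cis (of_int k * x)) * (d * cis (of_int l * x))) = (\<lambda>x. (c * d) * cis (of_int (k + l) * x))"
    by (auto simp: cis_mult algebra_simps)
  then show ?case by (simp only: trig_poly.monom)
next
  case (add a b)
  then show ?case using trig_poly.add[OF add.IH] by (simp add: ring_distribs)
qed

lemma trig_poly_mult:
  assumes "trig_poly a" "trig_poly b"
  shows "trig_poly (\<lambda>x. a x * b x)"
  using assms(1)
proof induction
  case (monom c k)
  then show ?case using trig_poly_mult_monom[OF assms(2)] .
next
  case (add a a')
  then show ?case using trig_poly.add[OF add.IH] by (simp add: ring_distribs)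
qed

lemma trig_poly_continuous: "trig_poly a \<Longrightarrow> continuous_on S a"
  by (induction rule: trig_poly.induct) (auto intro!: continuous_intros)

lemma trig_poly_real_polynomial:
  assumes "real_polynomial_function g"
  shows "trig_poly (\<lambda>x. complex_of_real (g (cis x)))"
  using assms
proof induction
  case (linear g)
  interpret bounded_linear g by fact
  have g: "g z = Re z * g 1 + Im z * g \<i>" for z
  proof -
    have "z = Re z *\<^sub>R 1 + Im z *\<^sub>R \<i>" by (simp add: complex_eq_iff)
    then have "g z = g (Re z *\<^sub>R 1 + Im z *\<^sub>R \<i>)" by simp
    then show ?thesis by (simp only: add scaleR real_scaleR_def)
  qed
  have "(\<lambda>x. complex_of_real (g (cis x)))
     = (\<lambda>x. (g 1 - \<i> * g \<i>) / 2 * cis (of_int 1 * x) + (g 1 + \<i> * g \<i>) / 2 * cis (of_int (-1) * x))"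
    by (rule ext, subst g) (auto simp: complex_eq_iff field_simps)
  moreover have "trig_poly \<dots>" by (intro trig_poly.intros)
  ultimately show ?case by simp
next
  case (const c)
  then show ?case using trig_poly.monom[of "of_real c" 0] by simp
next
  case (add f g)
  then show ?case using trig_poly.add by simp
next
  case (mult f g)
  then show ?case using trig_poly_mult by simp
qed

lemma periodic_of_int:
  assumes "periodic v"
  shows "v (x + 2 * pi * of_int n) = v x"
proof -
  have nat: "v (y + 2 * pi * real m) = v y" for y m
  proof (induction m)
    case (Suc m)
    have "v (y + 2 * pi * real (Suc m)) = v ((y + 2 * pi * real m) + 2 * pi)"
      by (simp add: algebra_simps)
    then show ?case using assms Suc by (simp add: periodic_def)
  qed simp
  show ?thesis
  proof (cases "n \<ge> 0")
    case True
    then show ?thesis using nat[of x "nat n"] by simp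
  next
    case False
    then show ?thesis using nat[of "x + 2 * pi * of_int n" "nat (- n)"] by simp
  qed
qed

lemma periodic_cis_eq:
  assumes "periodic v" "cis x = cis y"
  shows "v x = v y"
proof -
  have "sin x = sin y \<and> cos x = cos y" using assms(2) by (simp add: complex_eq_iff)
  then obtain n where "x = y + 2 * pi * of_int n"
    using sin_cos_eq_iff by blast
  then show ?thesis using periodic_of_int[OF assms(1)] by simp
qed

lemma continuous_on_circle_factor:
  assumes v: "continuous_on UNIV v" "periodic v"
  obtains g where "continuous_on (sphere (0::complex) 1) g" "\<And>x. g (cis x) = v x"
proof
  have cis: "cis (Arg z) = z" "cis (Arg2pi z) = z" if "norm z = 1" for z
    using that cis_Arg[of z] complex_norm_eq_1_exp[of z] by (force simp: sgn_eq cis_conv_exp)+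
  show "v (Arg (cis x)) = v x" for x
    by (rule periodic_cis_eq[OF v(2)]) (simp add: cis)
  have *: "v (Arg z) = v (Arg2pi z)" if "norm z = 1" for z
    by (rule periodic_cis_eq[OF v(2)]) (simp add: cis that)
  have vc: "isCont v x" for x
    using v(1) by (simp add: continuous_on_eq_continuous_at)
  show "continuous_on (sphere 0 1) (\<lambda>z. v (Arg z))"
    unfolding continuous_on_eq_continuous_within
  proof
    fix z :: complex assume z: "z \<in> sphere 0 1"
    show "continuous (at z within sphere 0 1) (\<lambda>z. v (Arg z))"
    proof (cases "z \<in> \<real>\<^sub>\<le>\<^sub>0")
      case False
      then have "isCont (\<lambda>z. v (Arg z)) z"
        by (intro isCont_o2[OF continuous_at_Arg vc])
      then show ?thesis by (rule continuous_at_imp_continuous_at_within)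
    next
      case True
      then have "z \<notin> \<real>\<^sub>\<ge>\<^sub>0" using z
        by (auto simp: complex_nonpos_Reals_iff complex_nonneg_Reals_iff cmod_def)
      then have "isCont (\<lambda>z. v (Arg2pi z)) z"
        by (intro isCont_o2[OF continuous_at_Arg2pi vc])
      then have "continuous (at z within sphere 0 1) (\<lambda>z. v (Arg2pi z))"
        by (rule continuous_at_imp_continuous_at_within)
      then show ?thesis
        by (rule continuous_transform_within[of _ _ _ 1]) (use z in \<open>auto simp: *\<close>)
    qed
  qed
qed

lemma fcoeff_eq_0_imp_0:
  assumes v: "continuous_on UNIV v" "periodic v" and 0: "\<And>k. fcoeff v k = 0"
  shows "v x = 0"
proof -
  let ?I = "{0..2*pi}"
  have vI: "continuous_on ?I v" using v(1) continuous_on_subset by blast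
  have trig: "integral ?I (\<lambda>x. complex_of_real (v x) * q x) = 0" if "trig_poly q" for q
    using that
  proof induction
    case (monom c k)
    have "integral ?I (\<lambda>x. complex_of_real (v x) * cis (of_int k * x)) = 0"
      using 0[of "-k"] by (simp add: fcoeff_continuous[OF v(1)])
    moreover have "(\<lambda>x. complex_of_real (v x) * (c * cis (of_int k * x)))
        = (\<lambda>x. c * (complex_of_real (v x) * cis (of_int k * x)))" by auto
    ultimately show ?case by simp
  next
    case (add a b)
    have "(\<lambda>x. complex_of_real (v x) * q x) integrable_on ?I" if "trig_poly q" for q
      by (intro integrable_continuous_real continuous_intros vI trig_poly_continuous that)
    with add show ?case by (simp add: ring_distribs integral_add)
  qed
  obtain g where g: "continuous_on (sphere (0::complex) 1) g" "\<And>x. g (cis x) = v x"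
    using continuous_on_circle_factor[OF v] by blast
  have sq: "continuous_on ?I (\<lambda>x. v x * v x)" by (intro continuous_intros vI)
  have av: "continuous_on ?I (\<lambda>x. \<bar>v x\<bar>)" by (intro continuous_intros vI)
  define J where "J = integral ?I (\<lambda>x. \<bar>v x\<bar>)"
  have J: "J \<ge> 0" unfolding J_def by (rule integral_nonneg[OF integrable_continuous_real[OF av]]) auto
  have le: "integral ?I (\<lambda>x. v x * v x) \<le> e * J" if "e > 0" for e
  proof -
    obtain p where p: "real_polynomial_function p" "\<And>z. z \<in> sphere 0 1 \<Longrightarrow> \<bar>g z - p z\<bar> < e"
      using Stone_Weierstrass_real_polynomial_function[OF compact_sphere g(1) \<open>e > 0\<close>] by metis
    have "continuous_on ?I (\<lambda>x. complex_of_real (p (cis x)))"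
      using trig_poly_continuous[OF trig_poly_real_polynomial[OF p(1)]] .
    then have "continuous_on ?I (\<lambda>x. Re (complex_of_real (p (cis x))))" by (rule continuous_on_Re)
    then have pc: "continuous_on ?I (\<lambda>x. p (cis x))" by simp
    have vp: "continuous_on ?I (\<lambda>x. v x * p (cis x))" by (intro continuous_intros vI pc)
    have "((\<lambda>x. complex_of_real (v x * p (cis x))) has_integral complex_of_real (integral ?I (\<lambda>x. v x * p (cis x)))) ?I"
      by (intro has_integral_of_real integrable_integral integrable_continuous_real[OF vp])
    then have "integral ?I (\<lambda>x. v x * p (cis x)) = 0"
      using trig[OF trig_poly_real_polynomial[OF p(1)]] by (simp add: integral_unique)
    then have "integral ?I (\<lambda>x. v x * v x) = integral ?I (\<lambda>x. v x * v x - v x * p (cis x))"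
      by (simp add: integral_diff integrable_continuous_real sq vp)
    also have "\<dots> \<le> integral ?I (\<lambda>x. e * \<bar>v x\<bar>)"
    proof (rule integral_le)
      show "(\<lambda>x. v x * v x - v x * p (cis x)) integrable_on ?I"
        by (intro integrable_continuous_real continuous_on_diff sq vp)
      show "(\<lambda>x. e * \<bar>v x\<bar>) integrable_on ?I"
        by (intro integrable_continuous_real continuous_intros av)
      fix x
      have "v x * v x - v x * p (cis x) = v x * (v x - p (cis x))" by (simp add: algebra_simps)
      also have "\<dots> \<le> \<bar>v x\<bar> * \<bar>v x - p (cis x)\<bar>" by (metis abs_ge_self abs_mult)
      also have "\<dots> \<le> \<bar>v x\<bar> * e"
        using p(2)[of "cis x"] g(2)[of x] by (intro mult_left_mono) auto
      finally show "v x * v x - v x * p (cis x) \<le> e * \<bar>v x\<bar>" by (simp add: mult.commute)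
    qed
    finally show ?thesis by (simp add: J_def)
  qed
  have "integral ?I (\<lambda>x. v x * v x) \<le> 0"
  proof (rule field_le_epsilon)
    fix e :: real assume "e > 0"
    have "integral ?I (\<lambda>x. v x * v x) \<le> e / (J + 1) * J"
      using \<open>e > 0\<close> J by (intro le) auto
    also have "\<dots> \<le> e" using \<open>e > 0\<close> J by (simp add: field_simps)
    finally show "integral ?I (\<lambda>x. v x * v x) \<le> 0 + e" by simp
  qed
  moreover have "integral ?I (\<lambda>x. v x * v x) \<ge> 0"
    by (intro integral_nonneg integrable_continuous_real sq) auto
  ultimately have "integral (cbox 0 (2*pi)) (\<lambda>x. v x * v x) = 0" by simp
  then have I0: "\<forall>x\<in>cbox 0 (2*pi). v x * v x = 0"
    using sq by (subst (asm) integral_cbox_eq_0_iff) (auto simp: not_le)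
  have "v x = v (Arg2pi (cis x))"
    using complex_norm_eq_1_exp[of "cis x"] by (intro periodic_cis_eq[OF v(2)]) (simp add: cis_conv_exp)
  moreover have "Arg2pi (cis x) \<in> cbox 0 (2*pi)"
    using Arg2pi_ge_0[of "cis x"] Arg2pi_lt_2pi[of "cis x"] by simp
  ultimately show ?thesis using I0 by auto
qed

text \<open>Every element of \<open>H\<^sup>1(S\<^sup>1)\<close> has exactly one continuous representative; the type consists of
  these representatives.\<close>

typedef h1 = "{v. continuous_on UNIV v \<and> periodic v
    \<and> (\<lambda>k. (1 + \<bar>real_of_int k\<bar>\<^sup>2) * (cmod (fcoeff v k))\<^sup>2) summable_on UNIV}"
  morphisms h1_fun Abs_h1
  by (rule exI[of _ "\<lambda>x. 0"]) (simp add: periodic_def)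

setup_lifting type_definition_h1

abbreviation coeff :: "h1 \<Rightarrow> int \<Rightarrow> complex" where
  "coeff v \<equiv> fcoeff (h1_fun v)"

lemma h1_continuous: "continuous_on UNIV (h1_fun v)"
  and h1_periodic: "periodic (h1_fun v)"
  and h1_summable: "(\<lambda>k. (1 + \<bar>real_of_int k\<bar>\<^sup>2) * (cmod (coeff v k))\<^sup>2) summable_on UNIV"
  using h1_fun[of v] by simp_all

lemma h1_eqI: "(\<And>x. h1_fun v x = h1_fun w x) \<Longrightarrow> v = w"
  by (metis ext h1_fun_inject)

lemma weighted_summable_add:
  fixes a b :: "int \<Rightarrow> complex" and m :: "int \<Rightarrow> real"
  assumes "(\<lambda>k. m k * (cmod (a k))\<^sup>2) summable_on UNIV" "(\<lambda>k. m k * (cmod (b k))\<^sup>2) summable_on UNIV"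
    and m: "\<And>k. m k \<ge> 0"
  shows "(\<lambda>k. m k * (cmod (a k + b k))\<^sup>2) summable_on UNIV"
proof (rule summable_on_comparison_test)
  show "(\<lambda>k. 2 * (m k * (cmod (a k))\<^sup>2) + 2 * (m k * (cmod (b k))\<^sup>2)) summable_on UNIV"
    by (intro summable_on_add summable_on_cmult_right assms)
  fix k
  have "(cmod (a k + b k))\<^sup>2 \<le> (cmod (a k) + cmod (b k))\<^sup>2"
    by (intro power_mono norm_triangle_ineq) auto
  also have "\<dots> \<le> 2 * (cmod (a k))\<^sup>2 + 2 * (cmod (b k))\<^sup>2"
    using sum_squares_bound[of "cmod (a k)" "cmod (b k)"] by (simp add: power2_sum)
  finally have "m k * (cmod (a k + b k))\<^sup>2 \<le> m k * (2 * (cmod (a k))\<^sup>2 + 2 * (cmod (b k))\<^sup>2)"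
    using m by (rule mult_left_mono)
  then show "m k * (cmod (a k + b k))\<^sup>2 \<le> 2 * (m k * (cmod (a k))\<^sup>2) + 2 * (m k * (cmod (b k))\<^sup>2)"
    by (simp add: algebra_simps)
qed (use m in auto)

lemma weighted_summable_scale:
  fixes a :: "int \<Rightarrow> complex" and m :: "int \<Rightarrow> real" and c :: real
  assumes "(\<lambda>k. m k * (cmod (a k))\<^sup>2) summable_on UNIV"
  shows "(\<lambda>k. m k * (cmod (of_real c * a k))\<^sup>2) summable_on UNIV"
  using summable_on_cmult_right[OF assms, of "c\<^sup>2"]
  by (simp add: norm_mult power_mult_distrib mult_ac)

instantiation h1 :: real_vector
begin

lift_definition zero_h1 :: h1 is "\<lambda>x. 0"
  by (simp add: periodic_def)

lift_definition plus_h1 :: "h1 \<Rightarrow> h1 \<Rightarrow> h1" is "\<lambda>v w x. v x + w x"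
  by (auto intro!: continuous_intros weighted_summable_add simp: fcoeff_add periodic_def)

lift_definition scaleR_h1 :: "real \<Rightarrow> h1 \<Rightarrow> h1" is "\<lambda>c v x. c * v x"
  by (auto intro!: continuous_intros weighted_summable_scale simp: fcoeff_scale periodic_def)

definition uminus_h1 :: "h1 \<Rightarrow> h1" where "- v = (-1) *\<^sub>R (v :: h1)"

definition minus_h1 :: "h1 \<Rightarrow> h1 \<Rightarrow> h1" where "v - w = v + (-1) *\<^sub>R (w :: h1)"

instance
  by standard
    (auto simp: uminus_h1_def minus_h1_def plus_h1.rep_eq zero_h1.rep_eq scaleR_h1.rep_eq
      algebra_simps intro!: h1_eqI)

end

lemma coeff_zero [simp]: "coeff 0 k = 0"
  by (simp add: zero_h1.rep_eq)

lemma coeff_add: "coeff (v + w) k = coeff v k + coeff w k"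
  by (simp add: plus_h1.rep_eq fcoeff_add h1_continuous)

lemma coeff_scaleR: "coeff (c *\<^sub>R v) k = of_real c * coeff v k"
  by (simp add: scaleR_h1.rep_eq fcoeff_scale h1_continuous)

lemma weighted_l2_triangle:
  fixes a b :: "int \<Rightarrow> complex" and m :: "int \<Rightarrow> real"
  assumes a: "(\<lambda>k. m k * (cmod (a k))\<^sup>2) summable_on UNIV"
    and b: "(\<lambda>k. m k * (cmod (b k))\<^sup>2) summable_on UNIV" and m: "\<And>k. m k \<ge> 0"
  shows "sqrt (\<Sum>\<^sub>\<infinity>k. m k * (cmod (a k + b k))\<^sup>2)
    \<le> sqrt (\<Sum>\<^sub>\<infinity>k. m k * (cmod (a k))\<^sup>2) + sqrt (\<Sum>\<^sub>\<infinity>k. m k * (cmod (b k))\<^sup>2)" (is "_ \<le> ?A + ?B")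
proof -
  have L2: "L2_set (\<lambda>k. sqrt (m k) * cmod (c k)) F = sqrt (\<Sum>k\<in>F. m k * (cmod (c k))\<^sup>2)"
    for c :: "int \<Rightarrow> complex" and F
    using m by (simp add: L2_set_def power_mult_distrib)
  have fin: "(\<Sum>k\<in>F. m k * (cmod (a k + b k))\<^sup>2) \<le> (?A + ?B)\<^sup>2" if "finite F" for F
  proof -
    have "sqrt (\<Sum>k\<in>F. m k * (cmod (a k + b k))\<^sup>2) \<le> L2_set (\<lambda>k. sqrt (m k) * cmod (a k) + sqrt (m k) * cmod (b k)) F"
      unfolding L2[symmetric]
      by (intro L2_set_mono) (auto simp: m simp flip: ring_distribs intro!: mult_left_mono norm_triangle_ineq)
    also have "\<dots> \<le> sqrt (\<Sum>k\<in>F. m k * (cmod (a k))\<^sup>2) + sqrt (\<Sum>k\<in>F. m k * (cmod (b k))\<^sup>2)"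
      unfolding L2[symmetric] by (rule L2_set_triangle_ineq)
    also have "\<dots> \<le> ?A + ?B"
      using a b m that by (intro add_mono real_sqrt_le_mono finite_sum_le_infsum) auto
    finally show ?thesis by (rule sqrt_le_D)
  qed
  have "(\<Sum>\<^sub>\<infinity>k. m k * (cmod (a k + b k))\<^sup>2) \<le> (?A + ?B)\<^sup>2"
    by (rule infsum_le_finite_sums[OF weighted_summable_add[OF a b m]]) (use fin in auto)
  moreover have "0 \<le> ?A + ?B"
    using m by (intro add_nonneg_nonneg real_sqrt_ge_zero infsum_nonneg) auto
  ultimately show ?thesis
    by (simp add: real_le_lsqrt)
qed

instantiation h1 :: real_normed_vector
begin

definition norm_h1 :: "h1 \<Rightarrow> real" where
  "norm v = sqrt (\<Sum>\<^sub>\<infinity>k. (1 + \<bar>real_of_int k\<bar>\<^sup>2) * (cmod (coeff v k))\<^sup>2)"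

definition dist_h1 :: "h1 \<Rightarrow> h1 \<Rightarrow> real" where
  "dist v w = norm (v - w :: h1)"

definition sgn_h1 :: "h1 \<Rightarrow> h1" where
  "sgn v = v /\<^sub>R norm (v :: h1)"

definition uniformity_h1 :: "(h1 \<times> h1) filter" where
  "uniformity_h1 = (INF e\<in>{0 <..}. principal {(x, y). dist x y < e})"

definition open_h1 :: "h1 set \<Rightarrow> bool" where
  "open_h1 U \<longleftrightarrow> (\<forall>x\<in>U. eventually (\<lambda>(x', y). x' = x \<longrightarrow> y \<in> U) uniformity)"

instance
proof
  fix v w :: h1 and c :: real
  show "norm v = 0 \<longleftrightarrow> v = 0"
  proof
    assume "norm v = 0"
    then have s: "(\<Sum>\<^sub>\<infinity>k. (1 + \<bar>real_of_int k\<bar>\<^sup>2) * (cmod (coeff v k))\<^sup>2) = 0"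
      by (simp add: norm_h1_def)
    have "coeff v k = 0" for k
    proof -
      have "(1 + \<bar>real_of_int k\<bar>\<^sup>2) * (cmod (coeff v k))\<^sup>2 = 0"
        by (rule nonneg_infsum_le_0D[where A = UNIV]) (use s h1_summable in auto)
      moreover have "1 + \<bar>real_of_int k\<bar>\<^sup>2 > 0" by (simp add: add_pos_nonneg)
      ultimately show ?thesis by simp
    qed
    then show "v = 0"
      using fcoeff_eq_0_imp_0[OF h1_continuous h1_periodic, of v]
      by (intro h1_eqI) (simp add: zero_h1.rep_eq)
  qed (simp add: norm_h1_def)
  show "norm (v + w) \<le> norm v + norm w"
    unfolding norm_h1_def coeff_add by (intro weighted_l2_triangle h1_summable) auto
  have "(\<Sum>\<^sub>\<infinity>k. (1 + \<bar>real_of_int k\<bar>\<^sup>2) * (cmod (coeff (c *\<^sub>R v) k))\<^sup>2)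
    = (\<Sum>\<^sub>\<infinity>k. c\<^sup>2 * ((1 + \<bar>real_of_int k\<bar>\<^sup>2) * (cmod (coeff v k))\<^sup>2))"
    by (intro infsum_cong) (simp add: coeff_scaleR norm_mult power_mult_distrib)
  also have "\<dots> = c\<^sup>2 * (\<Sum>\<^sub>\<infinity>k. (1 + \<bar>real_of_int k\<bar>\<^sup>2) * (cmod (coeff v k))\<^sup>2)"
    by (rule infsum_cmult_right) (rule h1_summable)
  finally show "norm (c *\<^sub>R v) = \<bar>c\<bar> * norm v"
    by (simp add: norm_h1_def real_sqrt_mult)
qed (simp_all add: dist_h1_def sgn_h1_def uniformity_h1_def open_h1_def)

end

text \<open>The \<open>h\<close>-dependent norm of \<open>H\<^sup>1\<^sub>h(S\<^sup>1)\<close> and of \<open>H\<^sup>1(S\<^sup>1) \<times> H\<^sup>1\<^sub>h(S\<^sup>1)\<close>. For each fixed \<open>h > 0\<close> the latter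
  is equivalent to the norm of the product type \<^typ>\<open>h1 \<times> h1\<close>, hence induces the same continuous
  functions, series and integrals; see \<open>norm_H1h_equiv\<close> and \<open>norm_H1_H1h_equiv\<close>.\<close>

definition norm_H1h :: "real \<Rightarrow> h1 \<Rightarrow> real" where
  "norm_H1h h v = sqrt (\<Sum>\<^sub>\<infinity>k. (1 + h\<^sup>2 / 6 * \<bar>real_of_int k\<bar>\<^sup>2) * (cmod (coeff v k))\<^sup>2)"

definition norm_H1_H1h :: "real \<Rightarrow> h1 \<times> h1 \<Rightarrow> real" where
  "norm_H1_H1h h U = sqrt ((norm (fst U))\<^sup>2 + (norm_H1h h (snd U))\<^sup>2)"

lemma norm_H1h_equiv:
  assumes "h > 0"
  shows "norm_H1h h v \<le> sqrt (1 + h\<^sup>2 / 6) * norm v" "norm v \<le> sqrt (1 + 6 / h\<^sup>2) * norm_H1h h v"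
proof -
  let ?a = "\<lambda>k. (1 + \<bar>real_of_int k\<bar>\<^sup>2) * (cmod (coeff v k))\<^sup>2"
  let ?b = "\<lambda>k. (1 + h\<^sup>2 / 6 * \<bar>real_of_int k\<bar>\<^sup>2) * (cmod (coeff v k))\<^sup>2"
  have ba: "?b k \<le> (1 + h\<^sup>2 / 6) * ?a k" for k
  proof -
    have "1 + h\<^sup>2 / 6 * \<bar>real_of_int k\<bar>\<^sup>2 \<le> (1 + h\<^sup>2 / 6) * (1 + \<bar>real_of_int k\<bar>\<^sup>2)"
      by (simp add: field_simps)
    then show ?thesis by (metis mult.assoc mult_right_mono zero_le_power2)
  qed
  have ab: "?a k \<le> (1 + 6 / h\<^sup>2) * ?b k" for k
  proof -
    have "1 + \<bar>real_of_int k\<bar>\<^sup>2 \<le> (1 + 6 / h\<^sup>2) * (1 + h\<^sup>2 / 6 * \<bar>real_of_int k\<bar>\<^sup>2)"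
      using assms by (simp add: ring_distribs add_divide_distrib)
    then show ?thesis by (metis mult.assoc mult_right_mono zero_le_power2)
  qed
  have a: "?a summable_on UNIV" by (rule h1_summable)
  have b: "?b summable_on UNIV"
    by (rule summable_on_comparison_test[OF summable_on_cmult_right[OF a, of "1 + h\<^sup>2 / 6"]])
      (use ba in auto)
  have "infsum ?b UNIV \<le> infsum (\<lambda>k. (1 + h\<^sup>2 / 6) * ?a k) UNIV"
    by (rule infsum_mono) (use a b ba in \<open>auto intro: summable_on_cmult_right\<close>)
  then have "infsum ?b UNIV \<le> (1 + h\<^sup>2 / 6) * infsum ?a UNIV"
    using infsum_cmult_right[of "1 + h\<^sup>2 / 6" ?a UNIV] a by simp
  then show "norm_H1h h v \<le> sqrt (1 + h\<^sup>2 / 6) * norm v"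
    by (simp add: norm_H1h_def norm_h1_def flip: real_sqrt_mult)
  have "infsum ?a UNIV \<le> infsum (\<lambda>k. (1 + 6 / h\<^sup>2) * ?b k) UNIV"
    by (rule infsum_mono) (use a b ab in \<open>auto intro: summable_on_cmult_right\<close>)
  then have "infsum ?a UNIV \<le> (1 + 6 / h\<^sup>2) * infsum ?b UNIV"
    using infsum_cmult_right[of "1 + 6 / h\<^sup>2" ?b UNIV] b by simp
  then show "norm v \<le> sqrt (1 + 6 / h\<^sup>2) * norm_H1h h v"
    by (simp add: norm_H1h_def norm_h1_def flip: real_sqrt_mult)
qed

lemma norm_H1_H1h_equiv:
  assumes "h > 0"
  shows "norm_H1_H1h h U \<le> sqrt (1 + h\<^sup>2 / 6) * norm U" "norm U \<le> sqrt (1 + 6 / h\<^sup>2) * norm_H1_H1h h U"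
proof -
  have sq: "sqrt (a\<^sup>2 + p\<^sup>2) \<le> sqrt (1 + c) * sqrt (a\<^sup>2 + q\<^sup>2)"
    if "p \<le> sqrt (1 + c) * q" "c \<ge> 0" "p \<ge> 0" for a p q c :: real
  proof -
    have "p\<^sup>2 \<le> (sqrt (1 + c) * q)\<^sup>2" using that by (intro power_mono) auto
    also have "\<dots> = q\<^sup>2 + c * q\<^sup>2" using that(2) by (simp add: power_mult_distrib ring_distribs)
    finally have "p\<^sup>2 \<le> q\<^sup>2 + c * q\<^sup>2" .
    moreover have "0 \<le> c * a\<^sup>2" using that(2) by (rule mult_nonneg_nonneg) simp
    ultimately have "a\<^sup>2 + p\<^sup>2 \<le> (1 + c) * (a\<^sup>2 + q\<^sup>2)"
      unfolding ring_distribs by linarith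
    then show ?thesis by (simp flip: real_sqrt_mult)
  qed
  have nn: "norm_H1h h (snd U) \<ge> 0"
    unfolding norm_H1h_def by (intro real_sqrt_ge_zero infsum_nonneg) auto
  show "norm_H1_H1h h U \<le> sqrt (1 + h\<^sup>2 / 6) * norm U"
    unfolding norm_H1_H1h_def norm_prod_def
    by (rule sq) (use norm_H1h_equiv(1)[OF assms] nn in auto)
  show "norm U \<le> sqrt (1 + 6 / h\<^sup>2) * norm_H1_H1h h U"
    unfolding norm_H1_H1h_def norm_prod_def
    by (rule sq) (use norm_H1h_equiv(2)[OF assms] in auto)
qed


section \<open>The modified equation\<close>

definition smooth :: "(real \<Rightarrow> real) \<Rightarrow> bool" where
  "smooth V \<longleftrightarrow> (\<forall>n x. (deriv ^^ n) V field_differentiable at x)"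

definition H2 :: "h1 set" where
  "H2 = {v. (\<lambda>k. (1 + \<bar>real_of_int k\<bar>^4) * (cmod (coeff v k))\<^sup>2) summable_on UNIV}"

definition M_op :: "real \<Rightarrow> (real \<Rightarrow> real) \<Rightarrow> h1 \<Rightarrow> h1 \<Rightarrow> real \<Rightarrow> real" where
  "M_op h f u v x = - (h\<^sup>2 / 6) * deriv f (h1_fun u x) * h1_fun v x"

text \<open>\<open>has_dxx v w\<close> says that \<open>w\<close> represents \<open>\<partial>\<^sub>x\<^sub>x v \<in> L\<^sup>2(S\<^sup>1)\<close> for \<open>v \<in> H\<^sup>2(S\<^sup>1)\<close>, and \<open>K_graph h f u v g\<close> that
  \<open>v \<in> H\<^sup>2(S\<^sup>1)\<close> and \<open>K(u) v = g\<close> in \<open>L\<^sup>2(S\<^sup>1)\<close>, where \<open>K(u) = L + M(u)\<close>. For every \<open>v \<in> H\<^sup>2(S\<^sup>1)\<close> such a \<open>w\<close> exists and is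
  unique up to null sets. Invertibility of \<open>K(u)\<close> is bijectivity from \<open>H\<^sup>2(S\<^sup>1)\<close> onto \<open>L\<^sup>2(S\<^sup>1)\<close>.\<close>

definition has_dxx :: "h1 \<Rightarrow> (real \<Rightarrow> real) \<Rightarrow> bool" where
  "has_dxx v w \<longleftrightarrow> w \<in> L2_circle \<and> (\<forall>k. fcoeff w k = - ((of_int k)\<^sup>2) * coeff v k)"

definition K_graph :: "real \<Rightarrow> (real \<Rightarrow> real) \<Rightarrow> h1 \<Rightarrow> h1 \<Rightarrow> (real \<Rightarrow> real) \<Rightarrow> bool" where
  "K_graph h f u v g \<longleftrightarrow> v \<in> H2 \<and> (\<exists>w. has_dxx v w \<and>
     (AE x in lebesgue. (h1_fun v x - h\<^sup>2 / 6 * w x) + M_op h f u v x = g x))"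

definition K_invertible :: "real \<Rightarrow> (real \<Rightarrow> real) \<Rightarrow> h1 \<Rightarrow> bool" where
  "K_invertible h f u \<longleftrightarrow> (\<forall>g \<in> L2_circle. \<exists>!v. K_graph h f u v g)"

definition K_inv :: "real \<Rightarrow> (real \<Rightarrow> real) \<Rightarrow> h1 \<Rightarrow> (real \<Rightarrow> real) \<Rightarrow> h1" where
  "K_inv h f u g = (THE v. K_graph h f u v g)"

text \<open>\<open>L\<^sup>-\<^sup>1 \<partial>\<^sub>x\<^sub>x\<close> is the Fourier multiplier whose symbol is the quotient of the symbols of \<open>\<partial>\<^sub>x\<^sub>x\<close> and \<open>L\<close>;
  this symbol is even and bounded, so it maps \<open>H\<^sup>1(S\<^sup>1)\<close> to itself.\<close>

definition Linv_dxx :: "real \<Rightarrow> h1 \<Rightarrow> h1" where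
  "Linv_dxx h v = (THE w. \<forall>k. coeff w k =
     of_real (- ((of_int k)\<^sup>2) / (1 + h\<^sup>2 / 6 * (of_int k)\<^sup>2)) * coeff v k)"

definition A_op :: "real \<Rightarrow> h1 \<times> h1 \<Rightarrow> h1 \<times> h1" where
  "A_op h U = (snd U, Linv_dxx h (fst U))"

text \<open>For \<open>h > 0\<close> the operator \<open>A\<close> is bounded on \<open>H\<^sup>1(S\<^sup>1) \<times> H\<^sup>1\<^sub>h(S\<^sup>1)\<close> (the symbol of \<open>L\<^sup>-\<^sup>1 \<partial>\<^sub>x\<^sub>x\<close> is bounded by
  \<open>6/h\<^sup>2\<close>), so the group \<open>e\<^bsup>tA\<^esup>\<close> it generates is given by the exponential series.\<close>

definition exp_A :: "real \<Rightarrow> real \<Rightarrow> h1 \<times> h1 \<Rightarrow> h1 \<times> h1" where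
  "exp_A h t U = (\<Sum>n. (t ^ n / fact n) *\<^sub>R (A_op h ^^ n) U)"

definition B_op :: "real \<Rightarrow> (real \<Rightarrow> real) \<Rightarrow> h1 \<times> h1 \<Rightarrow> h1 \<times> h1" where
  "B_op h f U = (let u = fst U; p = snd U in
     (0, K_inv h f u (\<lambda>x. - M_op h f u (Linv_dxx h u) x + f (h1_fun u x) + h\<^sup>2 / 12 * deriv (deriv f) (h1_fun u x) * (h1_fun p x)\<^sup>2)))"

definition mild_solution ::
    "real \<Rightarrow> (real \<Rightarrow> real) \<Rightarrow> real \<Rightarrow> h1 \<times> h1 \<Rightarrow> (real \<Rightarrow> h1 \<times> h1) \<Rightarrow> bool" where
  "mild_solution h f T U0 U \<longleftrightarrow>
     continuous_on {0..T} U \<and>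
     (\<forall>t\<in>{0..T}. K_invertible h f (fst (U t))) \<and>
     (\<forall>t\<in>{0..T}. ((\<lambda>s. exp_A h (t - s) (B_op h f (U s))) has_integral (U t - exp_A h t U0)) {0..t})"

end

theory Submission
  imports Defs
begin

text \<open>
  The theorem is a Picard iteration for the Duhamel formula in which no constant may depend on \<open>h\<close>.
  Everything is measured in the norm of \<open>H\<^sup>1 \<times> H\<^sup>1\<^sub>h\<close>; three facts make the estimates uniform.

  The linear flow \<open>e\<^bsup>tA\<^esup>\<close> grows at most like \<open>e\<^bsup>t/2\<^esup>\<close> (\<open>norm_exp_A_le\<close>). On each Fourier mode it is a harmonic
  oscillator whose energy \<open>k\<^sup>2 \<bar>u\<^sub>k\<bar>\<^sup>2 + (1 + h\<^sup>2 k\<^sup>2 / 6) \<bar>p\<^sub>k\<bar>\<^sup>2\<close> is conserved, and this energy is the squared norm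
  of the mode up to the term \<open>\<bar>u\<^sub>k\<bar>\<^sup>2\<close>.

  The operator \<open>L\<^sup>-\<^sup>1\<close> is a contraction from \<open>L\<^sup>2\<close> to \<open>H\<^sup>1\<^sub>h\<close>, because its symbol is the inverse of the weight of
  \<open>H\<^sup>1\<^sub>h\<close>; in particular it sends functions bounded by \<open>s\<close> into the ball of radius \<open>s\<close> (\<open>norm_H1h_L_inv\<close>). For small \<open>h\<close> the multiplication operator \<open>M(u)\<close> is a perturbation of relative size
  \<open>1/2\<close>, so \<open>K(u)\<close> is invertible by a contraction argument, and \<open>K(u)\<^sup>-\<^sup>1\<close> obeys the same bound up to a factor \<open>2\<close>
  (\<open>ex1_K_graph\<close>, \<open>norm_K_inv\<close>, \<open>K_inv_lipschitz\<close>).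

  The functions to which \<open>K(u)\<^sup>-\<^sup>1\<close> is applied are bounded pointwise. For \<open>u\<close> this is the Sobolev embedding; for
  \<open>p\<close> only \<open>h \<parallel>p\<parallel>\<^sub>\<infinity>\<close> is controlled by the norm of \<open>H\<^sup>1\<^sub>h\<close> (\<open>H1h_sup_bound\<close>), but \<open>p\<close> enters as \<open>h\<^sup>2 p\<^sup>2\<close>, and
  \<open>h\<^sup>2 L\<^sup>-\<^sup>1 \<partial>\<^sub>x\<^sub>x\<close> is bounded on \<open>H\<^sup>1\<close>. Hence \<open>B\<close> is bounded and Lipschitz on balls, uniformly in \<open>h\<close>
  (\<open>norm_B_op\<close>, \<open>B_op_lipschitz\<close>).

  For a short time, the Duhamel map then sends the paths in the ball of radius \<open>2 C + 2\<close> to paths in the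
  smaller ball of radius \<open>2 C + 1\<close> and halves distances (\<open>Duhamel_bound\<close>, \<open>Duhamel_contraction\<close>), which gives a
  solution with the uniform bound. Uniqueness among all mild solutions needs that none of them leaves the
  larger ball; this follows from the gap between the two radii (\<open>mild_solution_bound\<close>).

  Elements of \<open>H\<^sup>1\<close> are constructed from their Fourier coefficients (\<open>h1_synthesis\<close>), which also yields
  completeness.
\<close>

section \<open>Fourier coefficients of square integrable functions\<close>

lemma L2_circleD:
  assumes "g \<in> L2_circle"
  shows "periodic g" "g \<in> borel_measurable lebesgue" "set_integrable lebesgue {0..2*pi} (\<lambda>x. (g x)\<^sup>2)"
  using assms by (auto simp: L2_circle_def)

lemma continuous_borel_lebesgue:
  fixes g :: "real \<Rightarrow> 'a::{second_countable_topology,topological_space}"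
  assumes "continuous_on UNIV g"
  shows "g \<in> borel_measurable lebesgue"
  using borel_measurable_continuous_onI[OF assms] by (simp add: measurable_completion)

lemma set_borel_measurable_interval:
  fixes f :: "real \<Rightarrow> 'a::{second_countable_topology,real_normed_vector}"
  assumes "f \<in> borel_measurable lebesgue"
  shows "set_borel_measurable lebesgue {a..b} f"
  unfolding set_borel_measurable_def by (intro borel_measurable_scaleR borel_measurable_indicator assms) auto

lemma of_real_mult_continuous_measurable:
  fixes e :: "real \<Rightarrow> complex"
  assumes "g \<in> borel_measurable lebesgue" "continuous_on UNIV e"
  shows "(\<lambda>x. complex_of_real (g x) * e x) \<in> borel_measurable lebesgue"
  by (intro borel_measurable_times measurable_compose[OF assms(1) borel_measurable_of_real]
    continuous_borel_lebesgue assms(2))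

lemma cnj_set_integral: "cnj (LINT x:A|M. f x) = (LINT x:A|M. cnj (f x))"
  by (simp add: set_lebesgue_integral_def flip: Bochner_Integration.integral_cnj)

lemma continuous_L2_circle:
  assumes "continuous_on UNIV g" "periodic g"
  shows "g \<in> L2_circle"
proof -
  have "continuous_on {0..2*pi} (\<lambda>x. (g x)\<^sup>2)"
    by (intro continuous_intros continuous_on_subset[OF assms(1)]) auto
  then have "set_integrable lebesgue {0..2*pi} (\<lambda>x. (g x)\<^sup>2)"
    by (rule absolutely_integrable_continuous_real)
  then show ?thesis
    using assms continuous_borel_lebesgue[OF assms(1)] by (simp add: L2_circle_def)
qed

text \<open>The inequality \<open>2 \<bar>a\<bar> \<bar>b\<bar> \<le> a\<^sup>2 + b\<^sup>2\<close> dominates the product by an integrable function. With \<open>e = e\<^bsup>-ikx\<^esup>\<close>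
  this makes the Fourier coefficients of an \<open>L\<^sup>2\<close> function genuine integrals.\<close>

lemma L2_circle_mult_integrable:
  fixes e :: "real \<Rightarrow> complex"
  assumes g: "g \<in> L2_circle" and e: "continuous_on UNIV e"
  shows "set_integrable lebesgue {0..2*pi} (\<lambda>x. complex_of_real (g x) * e x)"
proof (rule set_integrable_bound)
  have "continuous_on {0..2*pi} (\<lambda>x. (cmod (e x))\<^sup>2)"
    by (intro continuous_intros continuous_on_subset[OF e]) auto
  then have "set_integrable lebesgue {0..2*pi} (\<lambda>x. (cmod (e x))\<^sup>2)"
    by (rule absolutely_integrable_continuous_real)
  then show "set_integrable lebesgue {0..2*pi} (\<lambda>x. (g x)\<^sup>2 + (cmod (e x))\<^sup>2)"
    using L2_circleD(3)[OF g] by (intro set_integral_add)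
  show "set_borel_measurable lebesgue {0..2*pi} (\<lambda>x. complex_of_real (g x) * e x)"
    by (intro set_borel_measurable_interval of_real_mult_continuous_measurable L2_circleD(2)[OF g] e)
  have "cmod (complex_of_real (g x) * e x) \<le> norm ((g x)\<^sup>2 + (cmod (e x))\<^sup>2)" for x
  proof -
    have "2 * (\<bar>g x\<bar> * cmod (e x)) \<le> (g x)\<^sup>2 + (cmod (e x))\<^sup>2"
      using sum_squares_bound[of "\<bar>g x\<bar>" "cmod (e x)"] by (simp add: mult.assoc)
    moreover have "0 \<le> \<bar>g x\<bar> * cmod (e x)" by simp
    ultimately have "\<bar>g x\<bar> * cmod (e x) \<le> (g x)\<^sup>2 + (cmod (e x))\<^sup>2" by linarith
    then show ?thesis by (simp add: norm_mult)
  qed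
  then show "AE x in lebesgue. x \<in> {0..2*pi} \<longrightarrow>
      cmod (complex_of_real (g x) * e x) \<le> norm ((g x)\<^sup>2 + (cmod (e x))\<^sup>2)" by simp
qed

lemma L2_circle_add:
  assumes "g \<in> L2_circle" "g' \<in> L2_circle"
  shows "(\<lambda>x. g x + g' x) \<in> L2_circle"
proof -
  have "set_integrable lebesgue {0..2*pi} (\<lambda>x. (g x + g' x)\<^sup>2)"
  proof (rule set_integrable_bound)
    show "set_integrable lebesgue {0..2*pi} (\<lambda>x. 2 * (g x)\<^sup>2 + 2 * (g' x)\<^sup>2)"
      using assms[THEN L2_circleD(3)] by (intro set_integral_add set_integrable_mult_right) auto
    show "set_borel_measurable lebesgue {0..2*pi} (\<lambda>x. (g x + g' x)\<^sup>2)"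
      by (intro set_borel_measurable_interval borel_measurable_power borel_measurable_add
        assms[THEN L2_circleD(2)])
    have "(g x + g' x)\<^sup>2 \<le> 2 * (g x)\<^sup>2 + 2 * (g' x)\<^sup>2" for x
      using sum_squares_bound[of "g x" "g' x"] by (simp add: power2_sum)
    then show "AE x in lebesgue. x \<in> {0..2*pi} \<longrightarrow>
        norm ((g x + g' x)\<^sup>2) \<le> norm (2 * (g x)\<^sup>2 + 2 * (g' x)\<^sup>2)" by simp
  qed
  then show ?thesis
    using assms[THEN L2_circleD(1)] assms[THEN L2_circleD(2)] by (auto simp: L2_circle_def periodic_def)
qed

lemma L2_circle_scale:
  assumes "g \<in> L2_circle"
  shows "(\<lambda>x. c * g x) \<in> L2_circle"
  using L2_circleD[OF assms]
  by (auto simp: L2_circle_def periodic_def power_mult_distrib intro!: set_integrable_mult_right)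

lemma L2_circle_diff:
  assumes "g \<in> L2_circle" "g' \<in> L2_circle"
  shows "(\<lambda>x. g x - g' x) \<in> L2_circle"
  using L2_circle_add[OF assms(1) L2_circle_scale[OF assms(2), of "-1"]] by simp

lemma fcoeff_L2_integrable:
  "g \<in> L2_circle \<Longrightarrow> set_integrable lebesgue {0..2*pi} (\<lambda>x. complex_of_real (g x) * cis (- (of_int k * x)))"
  by (intro L2_circle_mult_integrable continuous_intros)

lemma fcoeff_L2_add:
  assumes "g \<in> L2_circle" "g' \<in> L2_circle"
  shows "fcoeff (\<lambda>x. g x + g' x) k = fcoeff g k + fcoeff g' k"
  using assms[THEN fcoeff_L2_integrable, of k] 
  by (simp add: fcoeff_def ring_distribs set_integral_add add_divide_distrib)

lemma fcoeff_L2_scale: "fcoeff (\<lambda>x. c * g x) k = of_real c * fcoeff g k"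
  by (simp add: fcoeff_def mult.assoc)

lemma fcoeff_L2_diff:
  assumes "g \<in> L2_circle" "g' \<in> L2_circle"
  shows "fcoeff (\<lambda>x. g x - g' x) k = fcoeff g k - fcoeff g' k"
  using fcoeff_L2_add[OF assms(1) L2_circle_scale[OF assms(2), of "-1"], of k] fcoeff_L2_scale[of "-1" g' k]
  by simp

lemma fcoeff_cong_AE:
  assumes "g \<in> L2_circle" "g' \<in> L2_circle" "AE x in lebesgue. g x = g' x"
  shows "fcoeff g k = fcoeff g' k"
proof -
  have m: "(\<lambda>x. indicator {0..2*pi} x *\<^sub>R (complex_of_real (w x) * cis (- (of_int k * x)))) \<in> borel_measurable lebesgue"
    if "w \<in> L2_circle" for w
    unfolding set_borel_measurable_def[symmetric]
    by (intro set_borel_measurable_interval of_real_mult_continuous_measurable L2_circleD(2)[OF that]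
      continuous_intros)
  show ?thesis
    unfolding fcoeff_def set_lebesgue_integral_def
    by (intro arg_cong2[where f = "(/)"] integral_cong_AE refl m assms(1,2)) (use assms(3) in auto)
qed

lemma fcoeff_minus: "fcoeff g (- k) = cnj (fcoeff g k)"
  by (simp add: fcoeff_def cis_cnj cnj_set_integral)

lemma fcoeff_cis_orthogonal:
  "integral {0..2*pi} (\<lambda>x. cis (of_int k * x) * cis (- (of_int l * x))) = (if k = l then 2 * pi else 0)"
proof (cases "k = l")
  case True
  then show ?thesis by (simp add: cis_mult scaleR_conv_of_real)
next
  case False
  define m where "m = k - l"
  have m: "m \<noteq> 0" using False by (simp add: m_def)
  have eq: "(\<lambda>x. cis (of_int k * x) * cis (- (of_int l * x))) = (\<lambda>x. cis (of_int m * x))"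
    by (auto simp: cis_mult m_def algebra_simps)
  have d: "((\<lambda>x. cis (of_int m * x) / (\<i> * of_int m)) has_vector_derivative cis (of_int m * x)) (at x within {0..2*pi})" for x
  proof -
    have "((\<lambda>x. exp (of_real x * (\<i> * of_int m)) / (\<i> * of_int m)) has_vector_derivative exp (of_real x * (\<i> * of_int m))) (at x within {0..2*pi})"
      by (rule has_vector_derivative_real_field) (use m in \<open>auto intro!: derivative_eq_intros\<close>)
    then show ?thesis by (simp add: cis_conv_exp mult_ac)
  qed
  have "((\<lambda>x. cis (of_int m * x)) has_integral
      (cis (of_int m * (2*pi)) / (\<i> * of_int m) - cis (of_int m * 0) / (\<i> * of_int m))) {0..2*pi}"
    by (rule fundamental_theorem_of_calculus) (use d in auto)
  moreover have "cis (of_int m * (2*pi)) = 1"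
    using cis_multiple_2pi[of "of_int m"] by (simp add: mult_ac)
  ultimately show ?thesis using False eq by (simp add: integral_unique)
qed

text \<open>Bessel's inequality comes from \<open>0 \<le> \<parallel>g - S\<parallel>\<^sup>2\<close> for the partial Fourier sum \<open>S\<close>, since
  \<open>\<langle>g, S\<rangle> = \<parallel>S\<parallel>\<^sup>2\<close>.\<close>

lemma Bessel_finite:
  assumes g: "g \<in> L2_circle" and F: "finite F"
  shows "(\<Sum>k\<in>F. (cmod (fcoeff g k))\<^sup>2) \<le> (LINT x:{0..2*pi}|lebesgue. (g x)\<^sup>2) / (2*pi)"
proof -
  let ?I = "{0..2*pi}"
  define c where "c = fcoeff g"
  define S where "S x = (\<Sum>k\<in>F. c k * cis (of_int k * x))" for x
  have Sc: "continuous_on A S" for A unfolding S_def by (intro continuous_intros)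
  have cS: "cnj (S x) = (\<Sum>k\<in>F. cnj (c k) * cis (- (of_int k * x)))" for x
    by (simp add: S_def cis_cnj)
  have g2: "set_integrable lebesgue ?I (\<lambda>x. complex_of_real ((g x)\<^sup>2))"
    using L2_circleD(3)[OF g] by (simp only: set_integrable_def) 
      (use integrable_of_real[of lebesgue "\<lambda>x. indicator ?I x *\<^sub>R (g x)\<^sup>2"] in \<open>simp add: scaleR_conv_of_real\<close>)
  have gS: "set_integrable lebesgue ?I (\<lambda>x. complex_of_real (g x) * cnj (S x))"
    by (intro L2_circle_mult_integrable[OF g] continuous_intros Sc)
  have gS': "set_integrable lebesgue ?I (\<lambda>x. complex_of_real (g x) * S x)"
    by (intro L2_circle_mult_integrable[OF g] continuous_intros Sc)
  have SS: "set_integrable lebesgue ?I (\<lambda>x. S x * cnj (S x))"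
    by (intro absolutely_integrable_continuous_real continuous_intros Sc)
  define Q where "Q = (\<Sum>k\<in>F. (cmod (c k))\<^sup>2)"
  have cc: "(LINT x:?I|lebesgue. complex_of_real (g x) * cis (- (of_int k * x))) = 2 * pi * c k" for k
    by (simp add: c_def fcoeff_def)
  have 1: "(LINT x:?I|lebesgue. complex_of_real (g x) * cnj (S x)) = 2 * pi * Q"
  proof -
    have "(LINT x:?I|lebesgue. complex_of_real (g x) * cnj (S x))
        = (LINT x:?I|lebesgue. (\<Sum>k\<in>F. cnj (c k) * (complex_of_real (g x) * cis (- (of_int k * x)))))"
      by (simp add: cS sum_distrib_left mult_ac)
    also have "\<dots> = (\<Sum>k\<in>F. LINT x:?I|lebesgue. cnj (c k) * (complex_of_real (g x) * cis (- (of_int k * x))))"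
      unfolding set_lebesgue_integral_def scaleR_sum_right
      by (rule Bochner_Integration.integral_sum, unfold set_integrable_def[symmetric])
        (intro set_integrable_mult_right fcoeff_L2_integrable[OF g])
    also have "\<dots> = (\<Sum>k\<in>F. cnj (c k) * (2 * pi * c k))"
      by (simp only: set_integral_mult_right cc)
    also have "\<dots> = 2 * pi * Q"
      by (simp add: Q_def sum_distrib_left complex_norm_square mult_ac del: of_real_power)
    finally show ?thesis .
  qed
  have 2: "(LINT x:?I|lebesgue. complex_of_real (g x) * S x) = 2 * pi * Q"
  proof -
    have "(LINT x:?I|lebesgue. complex_of_real (g x) * S x)
        = (LINT x:?I|lebesgue. cnj (complex_of_real (g x) * cnj (S x)))" by simp
    also have "\<dots> = cnj (LINT x:?I|lebesgue. complex_of_real (g x) * cnj (S x))"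
      by (rule cnj_set_integral[symmetric])
    finally show ?thesis using 1 by simp
  qed
  have 3: "(LINT x:?I|lebesgue. S x * cnj (S x)) = 2 * pi * Q"
  proof -
    have "(LINT x:?I|lebesgue. S x * cnj (S x)) = integral ?I (\<lambda>x. S x * cnj (S x))"
      by (rule set_lebesgue_integral_eq_integral(2)[OF SS])
    also have "\<dots> = integral ?I (\<lambda>x. \<Sum>k\<in>F. \<Sum>l\<in>F. (c k * cnj (c l)) * (cis (of_int k * x) * cis (- (of_int l * x))))"
      unfolding cS by (simp add: S_def sum_product mult_ac)
    also have "\<dots> = (\<Sum>k\<in>F. \<Sum>l\<in>F. (c k * cnj (c l)) * integral ?I (\<lambda>x. cis (of_int k * x) * cis (- (of_int l * x))))"
      by (subst integral_sum[OF F], intro integrable_continuous_real continuous_intros,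
        subst integral_sum[OF F], intro integrable_continuous_real continuous_intros) simp
    also have "\<dots> = 2 * pi * Q"
      unfolding fcoeff_cis_orthogonal using F
      by (simp add: Q_def if_distrib sum.delta sum_distrib_left complex_norm_square mult_ac del: of_real_power cong: if_cong)
    finally show ?thesis .
  qed
  have expand: "complex_of_real ((cmod (complex_of_real (g x) - S x))\<^sup>2)
      = (complex_of_real ((g x)\<^sup>2) - complex_of_real (g x) * cnj (S x)) - (complex_of_real (g x) * S x - S x * cnj (S x))" for x
    unfolding complex_norm_square by (simp add: algebra_simps power2_eq_square)
  have "complex_of_real (LINT x:?I|lebesgue. (cmod (complex_of_real (g x) - S x))\<^sup>2)
     = (LINT x:?I|lebesgue. complex_of_real ((cmod (complex_of_real (g x) - S x))\<^sup>2))"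
    by (rule set_integral_complex_of_real[symmetric])
  also have "\<dots> = (LINT x:?I|lebesgue. complex_of_real ((g x)\<^sup>2)) - 2 * pi * Q - (2 * pi * Q - 2 * pi * Q)"
    unfolding expand
    by (subst set_integral_diff(2) set_integral_diff(2)[OF g2 gS] set_integral_diff(2)[OF gS' SS] | intro set_integral_diff(1) g2 gS gS' SS)+
      (simp only: 1 2 3 of_real_diff)
  also have "(LINT x:?I|lebesgue. complex_of_real ((g x)\<^sup>2)) = complex_of_real (LINT x:?I|lebesgue. (g x)\<^sup>2)"
    by (rule set_integral_complex_of_real)
  finally have "complex_of_real (LINT x:?I|lebesgue. (cmod (complex_of_real (g x) - S x))\<^sup>2)
     = complex_of_real ((LINT x:?I|lebesgue. (g x)\<^sup>2) - 2 * pi * Q)" by simp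
  then have "(LINT x:?I|lebesgue. (cmod (complex_of_real (g x) - S x))\<^sup>2) = (LINT x:?I|lebesgue. (g x)\<^sup>2) - 2 * pi * Q"
    by (simp only: of_real_eq_iff)
  moreover have "0 \<le> (LINT x:?I|lebesgue. (cmod (complex_of_real (g x) - S x))\<^sup>2)"
    unfolding set_lebesgue_integral_def by (intro integral_nonneg_AE) auto
  ultimately show ?thesis by (simp add: Q_def c_def field_simps)
qed

lemma Bessel_summable:
  assumes "g \<in> L2_circle"
  shows "(\<lambda>k. (cmod (fcoeff g k))\<^sup>2) summable_on UNIV"
  using Bessel_finite[OF assms]
  by (intro nonneg_bounded_partial_sums_imp_summable_on[where C = "(LINT x:{0..2*pi}|lebesgue. (g x)\<^sup>2) / (2*pi)"])
    (auto intro!: eventually_finite_subsets_at_top_weakI)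

text \<open>Below, Bessel's inequality is only applied to continuous functions with a known bound, so that all
  nonlinear estimates can be made pointwise.\<close>

lemma Bessel_sup:
  assumes g: "continuous_on UNIV g" "periodic g" and s: "\<And>x. \<bar>g x\<bar> \<le> s"
  shows "(\<Sum>\<^sub>\<infinity>k. (cmod (fcoeff g k))\<^sup>2) \<le> s\<^sup>2"
proof (rule infsum_le_finite_sums[OF Bessel_summable[OF continuous_L2_circle[OF g]]])
  fix F :: "int set" assume "finite F"
  have "(LINT x:{0..2*pi}|lebesgue. (g x)\<^sup>2) = integral {0..2*pi} (\<lambda>x. (g x)\<^sup>2)"
    by (rule set_lebesgue_integral_eq_integral(2)[OF L2_circleD(3)[OF continuous_L2_circle[OF g]]])
  also have "\<dots> \<le> integral {0..2*pi} (\<lambda>x. s\<^sup>2)"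
  proof (intro integral_le integrable_continuous_real continuous_intros)
    show "continuous_on {0..2*pi} g" using g(1) continuous_on_subset by blast
    show "(g x)\<^sup>2 \<le> s\<^sup>2" for x using s[of x] power_mono[of "\<bar>g x\<bar>" s 2] by simp
  qed
  finally have "(LINT x:{0..2*pi}|lebesgue. (g x)\<^sup>2) / (2*pi) \<le> s\<^sup>2"
    by (simp add: field_simps)
  with Bessel_finite[OF continuous_L2_circle[OF g] \<open>finite F\<close>]
  show "(\<Sum>k\<in>F. (cmod (fcoeff g k))\<^sup>2) \<le> s\<^sup>2" by linarith
qed

section \<open>Fourier series and completeness of the Sobolev space\<close>

lemma summable_inverse_one_plus_int_square: "(\<lambda>k::int. 1 / (1 + (real_of_int k)\<^sup>2)) summable_on UNIV"
proof -
  have nat: "(\<lambda>n::nat. 1 / (1 + (real n)\<^sup>2)) summable_on A" for A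
  proof -
    have "summable (\<lambda>n::nat. 1 / (1 + (real n)\<^sup>2))"
    proof (rule summable_comparison_test[OF exI[of _ 1]])
      show "summable (\<lambda>n. inverse ((real n)\<^sup>2))" by (rule inverse_power_summable) simp
      show "\<forall>n\<ge>1. norm (1 / (1 + (real n)\<^sup>2)) \<le> inverse ((real n)\<^sup>2)"
        by (auto simp: field_simps add_pos_nonneg)
    qed
    then have "(\<lambda>n::nat. 1 / (1 + (real n)\<^sup>2)) summable_on UNIV"
      by (intro norm_summable_imp_summable_on) simp
    then show ?thesis by (rule summable_on_subset_banach) simp
  qed
  have "(\<lambda>k::int. 1 / (1 + (real_of_int k)\<^sup>2)) summable_on (range int \<union> (\<lambda>n. - int n) ` {1..})"
  proof (rule summable_on_Un_disjoint)
    show "(\<lambda>k::int. 1 / (1 + (real_of_int k)\<^sup>2)) summable_on range int"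
      by (subst summable_on_reindex) (auto simp: o_def intro: nat)
    show "(\<lambda>k::int. 1 / (1 + (real_of_int k)\<^sup>2)) summable_on (\<lambda>n. - int n) ` {1..}"
      by (subst summable_on_reindex) (auto simp: o_def inj_on_def intro: nat)
  qed auto
  moreover have "range int \<union> (\<lambda>n. - int n) ` {1..} = (UNIV :: int set)"
  proof -
    have "k \<in> range int \<union> (\<lambda>n. - int n) ` {1..}" for k :: int
    proof (cases "k \<ge> 0")
      case True
      then show ?thesis by (metis UnI1 nonneg_int_cases rangeI)
    next
      case False
      then have "k = - int (nat (- k))" "nat (- k) \<in> {1..}" by auto
      then show ?thesis by blast
    qed
    then show ?thesis by blast
  qed
  ultimately show ?thesis by simp
qed

definition sobolev_const :: real where
  "sobolev_const = sqrt (\<Sum>\<^sub>\<infinity>k::int. 1 / (1 + (real_of_int k)\<^sup>2))"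

lemma sobolev_const_nonneg: "sobolev_const \<ge> 0"
  unfolding sobolev_const_def by (intro real_sqrt_ge_zero infsum_nonneg) (simp add: add_nonneg_nonneg)

text \<open>The weight \<open>1 + k\<^sup>2\<close> has a summable inverse, so by Cauchy--Schwarz the Fourier series of an
  \<open>H\<^sup>1\<close> function converges absolutely.\<close>

lemma weighted_l2_imp_l1:
  fixes c :: "int \<Rightarrow> complex"
  assumes c: "(\<lambda>k. (1 + \<bar>real_of_int k\<bar>\<^sup>2) * (cmod (c k))\<^sup>2) summable_on UNIV"
  shows "(\<lambda>k. cmod (c k)) summable_on UNIV"
    and "(\<Sum>\<^sub>\<infinity>k. cmod (c k)) \<le> sobolev_const * sqrt (\<Sum>\<^sub>\<infinity>k. (1 + \<bar>real_of_int k\<bar>\<^sup>2) * (cmod (c k))\<^sup>2)"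
proof -
  let ?w = "\<lambda>k::int. sqrt (1 + (real_of_int k)\<^sup>2)"
  have w: "?w k > 0" for k by (simp add: add_pos_nonneg)
  have fin: "(\<Sum>k\<in>F. cmod (c k)) \<le> sobolev_const * sqrt (\<Sum>\<^sub>\<infinity>k. (1 + \<bar>real_of_int k\<bar>\<^sup>2) * (cmod (c k))\<^sup>2)"
    if F: "finite F" for F
  proof -
    have "(\<Sum>k\<in>F. cmod (c k)) = (\<Sum>k\<in>F. \<bar>1 / ?w k\<bar> * \<bar>?w k * cmod (c k)\<bar>)"
    proof (intro sum.cong refl)
      fix k
      have "?w k \<noteq> 0" using w[of k] by linarith
      then show "cmod (c k) = \<bar>1 / ?w k\<bar> * \<bar>?w k * cmod (c k)\<bar>" by (simp only: abs_mult) simp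
    qed
    also have "\<dots> \<le> L2_set (\<lambda>k. 1 / ?w k) F * L2_set (\<lambda>k. ?w k * cmod (c k)) F"
      by (rule L2_set_mult_ineq)
    also have "L2_set (\<lambda>k. 1 / ?w k) F = sqrt (\<Sum>k\<in>F. 1 / (1 + (real_of_int k)\<^sup>2))"
      by (simp add: L2_set_def power_divide add_nonneg_nonneg)
    also have "L2_set (\<lambda>k. ?w k * cmod (c k)) F = sqrt (\<Sum>k\<in>F. (1 + \<bar>real_of_int k\<bar>\<^sup>2) * (cmod (c k))\<^sup>2)"
      by (simp add: L2_set_def power_mult_distrib add_nonneg_nonneg)
    also have "sqrt (\<Sum>k\<in>F. 1 / (1 + (real_of_int k)\<^sup>2)) * \<dots>
        \<le> sobolev_const * sqrt (\<Sum>\<^sub>\<infinity>k. (1 + \<bar>real_of_int k\<bar>\<^sup>2) * (cmod (c k))\<^sup>2)"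
      unfolding sobolev_const_def
      by (intro mult_mono real_sqrt_le_mono finite_sum_le_infsum F c
          summable_inverse_one_plus_int_square real_sqrt_ge_zero infsum_nonneg sum_nonneg)
        (auto simp: add_nonneg_nonneg)
    finally show ?thesis .
  qed
  show l1: "(\<lambda>k. cmod (c k)) summable_on UNIV"
    by (rule nonneg_bounded_partial_sums_imp_summable_on[OF _ eventually_finite_subsets_at_top_weakI])
      (simp, rule fin)
  show "(\<Sum>\<^sub>\<infinity>k. cmod (c k)) \<le> sobolev_const * sqrt (\<Sum>\<^sub>\<infinity>k. (1 + \<bar>real_of_int k\<bar>\<^sup>2) * (cmod (c k))\<^sup>2)"
    by (rule infsum_le_finite_sums[OF l1]) (rule fin)
qed

lemma coeff_diff: "coeff (v - w) k = coeff v k - coeff w k"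
  unfolding minus_h1_def coeff_add coeff_scaleR by simp

lemma h1_fun_diff: "h1_fun (v - w) x = h1_fun v x - h1_fun w x"
  unfolding minus_h1_def plus_h1.rep_eq scaleR_h1.rep_eq by simp

lemma h1_coeff_eqI:
  assumes "\<And>k. coeff v k = coeff w k"
  shows "v = w"
proof -
  have "h1_fun (v - w) x = 0" for x
    by (rule fcoeff_eq_0_imp_0[OF h1_continuous h1_periodic]) (simp add: coeff_diff assms)
  then show ?thesis by (intro h1_eqI) (simp add: h1_fun_diff)
qed

text \<open>Synthesis: a Hermitian symmetric sequence that is square summable with weight \<open>1 + k\<^sup>2\<close> is the
  sequence of Fourier coefficients of a unique element of \<open>H\<^sup>1\<close>, the sum of its Fourier series. All
  elements of \<open>H\<^sup>1\<close> constructed below arise in this way.\<close>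

lemma h1_synthesis:
  fixes c :: "int \<Rightarrow> complex"
  assumes sym: "\<And>k. c (- k) = cnj (c k)"
    and c: "(\<lambda>k. (1 + \<bar>real_of_int k\<bar>\<^sup>2) * (cmod (c k))\<^sup>2) summable_on UNIV"
  obtains v where "\<And>k. coeff v k = c k" "\<And>x. complex_of_real (h1_fun v x) = (\<Sum>\<^sub>\<infinity>k. c k * cis (of_int k * x))"
proof -
  define s where "s x = (\<Sum>\<^sub>\<infinity>k. c k * cis (of_int k * x))" for x :: real
  define v where "v x = Re (s x)" for x
  note l1 = weighted_l2_imp_l1(1)[OF c]
  let ?at = "finite_subsets_at_top (UNIV :: int set)"
  have "uniform_limit UNIV (\<lambda>F x. \<Sum>k\<in>F. c k * cis (of_int k * x)) s ?at"
    unfolding s_def by (rule Weierstrass_m_test_general[OF _ l1]) (simp add: norm_mult)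
  then have sc: "continuous_on UNIV s"
    by (rule uniform_limit_theorem[rotated]) (auto intro!: always_eventually continuous_intros)
  have real: "complex_of_real (v x) = s x" for x
  proof -
    have "cnj (s x) = (\<Sum>\<^sub>\<infinity>k. c (- k) * cis (of_int (- k) * x))"
      unfolding s_def infsum_cnj[symmetric] by (intro infsum_cong) (simp add: sym cis_cnj)
    also have "\<dots> = s x"
      unfolding s_def by (rule infsum_reindex_bij_betw[of uminus]) (auto simp: bij_betw_def inj_on_def surj_def intro: exI[of _ "- _"])
    finally show ?thesis unfolding v_def by (simp add: complex_eq_iff)
  qed
  have vc: "continuous_on UNIV v" unfolding v_def by (intro continuous_intros sc)
  have vp: "periodic v"
  proof -
    have "cis (of_int k * (x + 2 * pi)) = cis (of_int k * x)" for k :: int and x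
      using cis_multiple_2pi[of "of_int k"] by (simp add: ring_distribs mult_ac flip: cis_mult)
    then show ?thesis by (simp add: periodic_def v_def s_def)
  qed
  have coeff: "fcoeff v l = c l" for l
  proof -
    have "uniform_limit {0..2*pi} (\<lambda>F x. \<Sum>k\<in>F. c k * cis (of_int k * x) * cis (- (of_int l * x)))
        (\<lambda>x. (\<Sum>\<^sub>\<infinity>k. c k * cis (of_int k * x) * cis (- (of_int l * x)))) ?at"
      by (rule Weierstrass_m_test_general[OF _ l1]) (simp add: norm_mult)
    also have "(\<lambda>x. (\<Sum>\<^sub>\<infinity>k. c k * cis (of_int k * x) * cis (- (of_int l * x))))
        = (\<lambda>x. complex_of_real (v x) * cis (- (of_int l * x)))"
      by (simp add: infsum_cmult_left' real s_def)
    finally obtain I J where I: "\<And>F. ((\<lambda>x. \<Sum>k\<in>F. c k * cis (of_int k * x) * cis (- (of_int l * x))) has_integral I F) {0..2*pi}"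
      and J: "((\<lambda>x. complex_of_real (v x) * cis (- (of_int l * x))) has_integral J) {0..2*pi}"
      and IJ: "(I \<longlongrightarrow> J) ?at"
      by (rule uniform_limit_integral) (auto intro!: continuous_intros)
    have "I F = 2 * pi * c l" if "finite F" "l \<in> F" for F
    proof -
      have "I F = integral {0..2*pi} (\<lambda>x. \<Sum>k\<in>F. c k * (cis (of_int k * x) * cis (- (of_int l * x))))"
        using I[of F] by (simp add: integral_unique mult.assoc)
      also have "\<dots> = (\<Sum>k\<in>F. c k * integral {0..2*pi} (\<lambda>x. cis (of_int k * x) * cis (- (of_int l * x))))"
        by (subst integral_sum[OF that(1)], intro integrable_continuous_real continuous_intros) simp
      also have "\<dots> = 2 * pi * c l"
        unfolding fcoeff_cis_orthogonal using that by (simp add: if_distrib sum.delta cong: if_cong)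
      finally show ?thesis .
    qed
    then have "\<forall>\<^sub>F F in ?at. I F = 2 * pi * c l"
      by (auto simp: eventually_finite_subsets_at_top intro!: exI[of _ "{l}"])
    then have "(I \<longlongrightarrow> 2 * pi * c l) ?at" by (rule tendsto_eventually)
    then have "J = 2 * pi * c l" using IJ by (intro tendsto_unique[OF _ IJ]) auto
    then show ?thesis using J by (simp add: fcoeff_continuous[OF vc] integral_unique)
  qed
  have "v \<in> {v. continuous_on UNIV v \<and> periodic v
    \<and> (\<lambda>k. (1 + \<bar>real_of_int k\<bar>\<^sup>2) * (cmod (fcoeff v k))\<^sup>2) summable_on UNIV}"
    using vc vp c by (simp add: coeff)
  then have "h1_fun (Abs_h1 v) = v" by (rule Abs_h1_inverse)
  then show ?thesis using that[of "Abs_h1 v"] coeff real by (simp add: s_def)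
qed

corollary ex_h1_coeff:
  fixes c :: "int \<Rightarrow> complex"
  assumes "\<And>k. c (- k) = cnj (c k)"
    and "(\<lambda>k. (1 + \<bar>real_of_int k\<bar>\<^sup>2) * (cmod (c k))\<^sup>2) summable_on UNIV"
  shows "\<exists>v. \<forall>k. coeff v k = c k"
proof (rule h1_synthesis[OF assms])
  fix v
  assume "\<And>k. coeff v k = c k"
  then show "\<exists>v. \<forall>k. coeff v k = c k" by (intro exI[of _ v] allI)
qed

lemma norm_h1_square: "(norm v)\<^sup>2 = (\<Sum>\<^sub>\<infinity>k. (1 + \<bar>real_of_int k\<bar>\<^sup>2) * (cmod (coeff v k))\<^sup>2)"
  unfolding norm_h1_def by (intro real_sqrt_pow2 infsum_nonneg) simp

text \<open>The Sobolev embedding of \<open>H\<^sup>1\<close> into the bounded functions: a function is the sum of its absolutely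
  convergent Fourier series.\<close>

lemma h1_sup_bound: "\<bar>h1_fun v x\<bar> \<le> sobolev_const * norm v"
proof -
  obtain w where w: "\<And>k. coeff w k = coeff v k"
    "\<And>x. complex_of_real (h1_fun w x) = (\<Sum>\<^sub>\<infinity>k. coeff v k * cis (of_int k * x))"
    using h1_synthesis[OF fcoeff_minus h1_summable] by metis
  have "w = v" by (rule h1_coeff_eqI) (rule w)
  then have "\<bar>h1_fun v x\<bar> = cmod (\<Sum>\<^sub>\<infinity>k. coeff v k * cis (of_int k * x))"
    using w(2)[of x] by (metis norm_of_real)
  also have "\<dots> \<le> (\<Sum>\<^sub>\<infinity>k. cmod (coeff v k * cis (of_int k * x)))"
    by (rule norm_infsum_bound) (simp add: norm_mult weighted_l2_imp_l1(1)[OF h1_summable])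
  also have "\<dots> \<le> sobolev_const * norm v"
    using weighted_l2_imp_l1(2)[OF h1_summable[of v]] by (simp add: norm_mult norm_h1_def)
  finally show ?thesis .
qed

lemma h1_finite_sum_le: 
  "finite F \<Longrightarrow> (\<Sum>k\<in>F. (1 + \<bar>real_of_int k\<bar>\<^sup>2) * (cmod (coeff v k))\<^sup>2) \<le> (norm v)\<^sup>2"
  unfolding norm_h1_square by (rule finite_sum_le_infsum[OF h1_summable]) auto

lemma coeff_le_norm: "cmod (coeff v k) \<le> norm v"
proof (rule power2_le_imp_le)
  have "(cmod (coeff v k))\<^sup>2 \<le> (1 + \<bar>real_of_int k\<bar>\<^sup>2) * (cmod (coeff v k))\<^sup>2"
    by (simp add: mult_le_cancel_right1)
  also have "\<dots> \<le> (norm v)\<^sup>2" using h1_finite_sum_le[of "{k}" v] by simp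
  finally show "(cmod (coeff v k))\<^sup>2 \<le> (norm v)\<^sup>2" .
qed simp

lemma bounded_linear_coeff: "bounded_linear (\<lambda>v. coeff v k)"
  by (rule bounded_linear_intro[where K = 1])
    (simp_all only: coeff_add coeff_scaleR scaleR_conv_of_real coeff_le_norm mult_1_right)

text \<open>Completeness is that of a weighted \<open>\<ell>\<^sup>2\<close> space: the Fourier coefficients of a Cauchy sequence converge
  one by one, the limits are again square summable with the weight, and synthesis turns them into an
  element of \<open>H\<^sup>1\<close>.\<close>

instance h1 :: banach
proof
  fix X :: "nat \<Rightarrow> h1" assume X: "Cauchy X"
  have "\<exists>l. (\<lambda>n. coeff (X n) k) \<longlonglongrightarrow> l" for k
    using bounded_linear.Cauchy[OF bounded_linear_coeff X]
    unfolding Cauchy_convergent_iff convergent_def .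
  then obtain c where c: "\<And>k. (\<lambda>n. coeff (X n) k) \<longlonglongrightarrow> c k" by metis
  let ?w = "\<lambda>k::int. 1 + \<bar>real_of_int k\<bar>\<^sup>2"
  have close: "\<exists>M. \<forall>n\<ge>M. \<forall>F. finite F \<longrightarrow> (\<Sum>k\<in>F. ?w k * (cmod (coeff (X n) k - c k))\<^sup>2) \<le> e\<^sup>2"
    if e: "e > 0" for e
  proof -
    obtain M where M: "\<And>m n. m \<ge> M \<Longrightarrow> n \<ge> M \<Longrightarrow> norm (X m - X n) < e"
      using X e unfolding Cauchy_iff by blast
    have "(\<Sum>k\<in>F. ?w k * (cmod (coeff (X n) k - c k))\<^sup>2) \<le> e\<^sup>2" if "n \<ge> M" "finite F" for n F
    proof (rule tendsto_upperbound)
      show "((\<lambda>m. \<Sum>k\<in>F. ?w k * (cmod (coeff (X n) k - coeff (X m) k))\<^sup>2)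
          \<longlongrightarrow> (\<Sum>k\<in>F. ?w k * (cmod (coeff (X n) k - c k))\<^sup>2)) sequentially"
        by (intro tendsto_intros c)
      show "\<forall>\<^sub>F m in sequentially. (\<Sum>k\<in>F. ?w k * (cmod (coeff (X n) k - coeff (X m) k))\<^sup>2) \<le> e\<^sup>2"
        using eventually_ge_at_top[of M]
      proof eventually_elim
        case (elim m)
        have "(\<Sum>k\<in>F. ?w k * (cmod (coeff (X n) k - coeff (X m) k))\<^sup>2) \<le> (norm (X n - X m))\<^sup>2"
          using h1_finite_sum_le[OF that(2), of "X n - X m"] by (simp add: coeff_diff)
        also have "\<dots> \<le> e\<^sup>2" using M[OF that(1) elim] by (intro power_mono) auto
        finally show ?case .
      qed
    qed simp
    then show ?thesis by blast
  qed
  have diff_summable: "\<exists>M. \<forall>n\<ge>M. (\<lambda>k. ?w k * (cmod (coeff (X n) k - c k))\<^sup>2) summable_on UNIV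
      \<and> (\<Sum>\<^sub>\<infinity>k. ?w k * (cmod (coeff (X n) k - c k))\<^sup>2) \<le> e\<^sup>2" if e: "e > 0" for e
  proof -
    obtain M where M: "\<And>n F. n \<ge> M \<Longrightarrow> finite F \<Longrightarrow> (\<Sum>k\<in>F. ?w k * (cmod (coeff (X n) k - c k))\<^sup>2) \<le> e\<^sup>2"
      using close[OF e] by blast
    have s: "(\<lambda>k. ?w k * (cmod (coeff (X n) k - c k))\<^sup>2) summable_on UNIV" if "n \<ge> M" for n
      by (rule nonneg_bounded_partial_sums_imp_summable_on[OF _ eventually_finite_subsets_at_top_weakI])
        (simp, rule M[OF that])
    have "(\<Sum>\<^sub>\<infinity>k. ?w k * (cmod (coeff (X n) k - c k))\<^sup>2) \<le> e\<^sup>2" if "n \<ge> M" for n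
      by (rule infsum_le_finite_sums[OF s[OF that] M[OF that]])
    with s show ?thesis by blast
  qed
  obtain n where n: "(\<lambda>k. ?w k * (cmod (coeff (X n) k - c k))\<^sup>2) summable_on UNIV"
    using diff_summable[of 1] by auto
  have sum: "(\<lambda>k. ?w k * (cmod (c k))\<^sup>2) summable_on UNIV"
  proof -
    have "(\<lambda>k. ?w k * (cmod (c k - coeff (X n) k))\<^sup>2) summable_on UNIV"
      using n by (simp add: norm_minus_commute)
    from weighted_summable_add[OF this h1_summable[of "X n"]] show ?thesis by simp
  qed
  have sym: "c (- k) = cnj (c k)" for k
  proof (rule LIMSEQ_unique[OF c])
    show "(\<lambda>n. coeff (X n) (- k)) \<longlonglongrightarrow> cnj (c k)"
      unfolding fcoeff_minus by (intro tendsto_intros c)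
  qed
  obtain v where v: "\<And>k. coeff v k = c k" using ex_h1_coeff[OF sym sum] by (elim exE) iprover
  have "X \<longlonglongrightarrow> v"
  proof (rule LIMSEQ_I)
    fix r :: real assume r: "r > 0"
    then obtain M where M: "\<And>n. n \<ge> M \<Longrightarrow> (\<Sum>\<^sub>\<infinity>k. ?w k * (cmod (coeff (X n) k - c k))\<^sup>2) \<le> (r/2)\<^sup>2"
      using diff_summable[of "r/2"] by auto
    have "norm (X n - v) < r" if "n \<ge> M" for n
    proof -
      have "norm (X n - v) \<le> r / 2"
      proof (rule power2_le_imp_le)
        show "(norm (X n - v))\<^sup>2 \<le> (r / 2)\<^sup>2"
          using M[OF that] by (simp only: norm_h1_square coeff_diff v)
      qed (use r in simp)
      with r show ?thesis by simp
    qed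
    then show "\<exists>no. \<forall>n\<ge>no. norm (X n - v) < r" by blast
  qed
  then show "convergent X" by (auto simp: convergent_def)
qed

section \<open>The \<open>h\<close>-dependent norms\<close>

text \<open>The norm of \<open>H\<^sup>1 \<times> H\<^sup>1\<^sub>h\<close> is equivalent to the norm of the product type, but one of the two constants blows
  up as \<open>h \<rightarrow> 0\<close>. Limits, continuity and integrals may therefore be taken in the type, while all
  quantitative estimates have to be made in the \<open>h\<close>-dependent norm \<open>N\<close>. The constants \<open>c\<close> and \<open>c'\<close> only
  serve to move qualitative statements between the two norms.\<close>

locale equivalent_norm =
  fixes N :: "'a::real_normed_vector \<Rightarrow> real" and c c' :: real
  assumes triangle: "N (x + y) \<le> N x + N y"
    and scaleR: "N (r *\<^sub>R x) = \<bar>r\<bar> * N x"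
    and upper: "N x \<le> c * norm x" and lower: "norm x \<le> c' * N x"
    and c_nonneg: "c \<ge> 0" and c'_nonneg: "c' \<ge> 0"
begin

lemma zero [simp]: "N 0 = 0"
  using scaleR[of 0 0] by simp

lemma minus: "N (- x) = N x"
  using scaleR[of "-1" x] by simp

lemma nonneg: "N x \<ge> 0"
  using triangle[of x "- x"] by (simp add: minus)

lemma triangle_diff: "N (x - y) \<le> N x + N y"
  using triangle[of x "- y"] by (simp add: minus)

lemma minus_commute: "N (x - y) = N (y - x)"
  using minus[of "x - y"] by simp

lemma abs_diff_le: "\<bar>N x - N y\<bar> \<le> N (x - y)"
  using triangle[of "x - y" y] triangle[of "y - x" x] minus_commute[of x y] by auto

lemma sum_le: "N (\<Sum>i\<in>I. g i) \<le> (\<Sum>i\<in>I. N (g i))"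
proof (induction I rule: infinite_finite_induct)
  case (insert i I)
  then show ?case using triangle[of "g i" "\<Sum>i\<in>I. g i"] by simp
qed auto

lemma continuous_on: "continuous_on S g \<Longrightarrow> continuous_on S (\<lambda>x. N (g x))"
proof -
  have "c-lipschitz_on UNIV N"
  proof (rule lipschitz_onI)
    fix x y
    have "dist (N x) (N y) \<le> N (x - y)" using abs_diff_le[of x y] by (simp add: dist_real_def)
    also have "\<dots> \<le> c * dist x y" using upper by (simp add: dist_norm)
    finally show "dist (N x) (N y) \<le> c * dist x y" .
  qed (rule c_nonneg)
  then show "continuous_on S g \<Longrightarrow> continuous_on S (\<lambda>x. N (g x))"
    using continuous_on_compose2[OF lipschitz_on_continuous_on] by blast
qed

end

lemma H1h_summable: "(\<lambda>k. (1 + h\<^sup>2 / 6 * \<bar>real_of_int k\<bar>\<^sup>2) * (cmod (coeff v k))\<^sup>2) summable_on UNIV"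
proof (rule summable_on_comparison_test[OF summable_on_cmult_right[OF h1_summable, of "1 + h\<^sup>2 / 6" v]])
  fix k
  have "1 + h\<^sup>2 / 6 * \<bar>real_of_int k\<bar>\<^sup>2 \<le> (1 + h\<^sup>2 / 6) * (1 + \<bar>real_of_int k\<bar>\<^sup>2)"
    by (simp add: field_simps)
  then show "(1 + h\<^sup>2 / 6 * \<bar>real_of_int k\<bar>\<^sup>2) * (cmod (coeff v k))\<^sup>2
      \<le> (1 + h\<^sup>2 / 6) * ((1 + \<bar>real_of_int k\<bar>\<^sup>2) * (cmod (coeff v k))\<^sup>2)"
    by (metis mult.assoc mult_right_mono zero_le_power2)
qed simp

lemma norm_H1h_nonneg: "norm_H1h h v \<ge> 0"
  unfolding norm_H1h_def by (intro real_sqrt_ge_zero infsum_nonneg) simp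

lemma norm_H1h_square: "(norm_H1h h v)\<^sup>2 = (\<Sum>\<^sub>\<infinity>k. (1 + h\<^sup>2 / 6 * \<bar>real_of_int k\<bar>\<^sup>2) * (cmod (coeff v k))\<^sup>2)"
  unfolding norm_H1h_def by (intro real_sqrt_pow2 infsum_nonneg) simp

lemma norm_H1h_triangle: "norm_H1h h (v + w) \<le> norm_H1h h v + norm_H1h h w"
  unfolding norm_H1h_def coeff_add by (intro weighted_l2_triangle H1h_summable) auto

lemma norm_H1h_scaleR: "norm_H1h h (r *\<^sub>R v) = \<bar>r\<bar> * norm_H1h h v"
proof -
  have "(\<Sum>\<^sub>\<infinity>k. (1 + h\<^sup>2 / 6 * \<bar>real_of_int k\<bar>\<^sup>2) * (cmod (coeff (r *\<^sub>R v) k))\<^sup>2)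
    = (\<Sum>\<^sub>\<infinity>k. r\<^sup>2 * ((1 + h\<^sup>2 / 6 * \<bar>real_of_int k\<bar>\<^sup>2) * (cmod (coeff v k))\<^sup>2))"
    by (intro infsum_cong) (simp add: coeff_scaleR norm_mult power_mult_distrib)
  also have "\<dots> = r\<^sup>2 * (\<Sum>\<^sub>\<infinity>k. (1 + h\<^sup>2 / 6 * \<bar>real_of_int k\<bar>\<^sup>2) * (cmod (coeff v k))\<^sup>2)"
    by (rule infsum_cmult_right) (rule H1h_summable)
  finally show ?thesis by (simp add: norm_H1h_def real_sqrt_mult)
qed

lemma equivalent_norm_H1_H1h:
  assumes "h > 0"
  shows "equivalent_norm (norm_H1_H1h h) (sqrt (1 + h\<^sup>2 / 6)) (sqrt (1 + 6 / h\<^sup>2))"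
proof
  fix U W :: "h1 \<times> h1" and r :: real
  have "norm_H1_H1h h (U + W) \<le> sqrt ((norm (fst U) + norm (fst W))\<^sup>2 + (norm_H1h h (snd U) + norm_H1h h (snd W))\<^sup>2)"
    unfolding norm_H1_H1h_def
    by (intro real_sqrt_le_mono add_mono power_mono)
      (auto simp: norm_triangle_ineq norm_H1h_triangle norm_H1h_nonneg)
  also have "\<dots> \<le> norm_H1_H1h h U + norm_H1_H1h h W"
    unfolding norm_H1_H1h_def by (rule real_sqrt_sum_squares_triangle_ineq)
  finally show "norm_H1_H1h h (U + W) \<le> norm_H1_H1h h U + norm_H1_H1h h W" .
  show "norm_H1_H1h h (r *\<^sub>R U) = \<bar>r\<bar> * norm_H1_H1h h U"
    by (simp add: norm_H1_H1h_def norm_H1h_scaleR power_mult_distrib real_sqrt_mult flip: distrib_left)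
qed (use assms in \<open>auto simp: norm_H1_H1h_equiv intro!: add_nonneg_nonneg\<close>)

lemma norm_H1_H1h_components:
  "norm (fst U) \<le> norm_H1_H1h h U" "norm_H1h h (snd U) \<le> norm_H1_H1h h U"
  unfolding norm_H1_H1h_def by (auto intro!: real_le_rsqrt)

lemma norm_H1_H1h_snd: "norm_H1_H1h h (0, p) = norm_H1h h p"
  by (simp add: norm_H1_H1h_def norm_H1h_nonneg)

text \<open>The norm of \<open>H\<^sup>1\<^sub>h\<close> controls \<open>h\<close> times the norm of \<open>H\<^sup>1\<close>, uniformly in \<open>h \<le> 1\<close>. The equation
  multiplies every quadratic occurrence of \<open>p\<close> by \<open>h\<^sup>2\<close>, which is exactly the loss in this bound.\<close>

lemma norm_le_norm_H1h:
  assumes "0 < h" "h \<le> 1"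
  shows "h * norm p \<le> 3 * norm_H1h h p"
proof -
  have "h * sqrt (1 + 6 / h\<^sup>2) = sqrt (h\<^sup>2 * (1 + 6 / h\<^sup>2))"
    using assms by (simp add: real_sqrt_mult)
  also have "h\<^sup>2 * (1 + 6 / h\<^sup>2) = h\<^sup>2 + 6" using assms by (simp add: field_simps)
  also have "sqrt (h\<^sup>2 + 6) \<le> sqrt (3\<^sup>2)"
    using power_mono[OF assms(2), of 2] assms(1) by (intro real_sqrt_le_mono) simp
  finally have "h * sqrt (1 + 6 / h\<^sup>2) \<le> 3" by simp
  then have "h * sqrt (1 + 6 / h\<^sup>2) * norm_H1h h p \<le> 3 * norm_H1h h p"
    by (rule mult_right_mono) (rule norm_H1h_nonneg)
  moreover have "h * norm p \<le> h * (sqrt (1 + 6 / h\<^sup>2) * norm_H1h h p)"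
    using assms by (intro mult_left_mono norm_H1h_equiv) auto
  ultimately show ?thesis by (simp add: mult.assoc)
qed

lemma H1h_sup_bound:
  assumes "0 < h" "h \<le> 1"
  shows "h * \<bar>h1_fun p x\<bar> \<le> 3 * sobolev_const * norm_H1h h p"
proof -
  have "h * \<bar>h1_fun p x\<bar> \<le> h * (sobolev_const * norm p)"
    using assms by (intro mult_left_mono h1_sup_bound) auto
  also have "\<dots> = sobolev_const * (h * norm p)" by simp
  also have "\<dots> \<le> sobolev_const * (3 * norm_H1h h p)"
    by (intro mult_left_mono norm_le_norm_H1h assms sobolev_const_nonneg)
  finally show ?thesis by (simp add: mult_ac)
qed

section \<open>Fourier multipliers\<close>

lemma norm_h1_mono:
  assumes "\<And>k. cmod (coeff w k) \<le> \<beta> * cmod (coeff v k)" "\<beta> \<ge> 0"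
  shows "norm w \<le> \<beta> * norm v"
proof (rule power2_le_imp_le)
  have "(norm w)\<^sup>2 \<le> (\<Sum>\<^sub>\<infinity>k. \<beta>\<^sup>2 * ((1 + \<bar>real_of_int k\<bar>\<^sup>2) * (cmod (coeff v k))\<^sup>2))"
    unfolding norm_h1_square
  proof (rule infsum_mono)
    show "(\<lambda>k. \<beta>\<^sup>2 * ((1 + \<bar>real_of_int k\<bar>\<^sup>2) * (cmod (coeff v k))\<^sup>2)) summable_on UNIV"
      by (intro summable_on_cmult_right h1_summable)
    fix k
    have "(cmod (coeff w k))\<^sup>2 \<le> (\<beta> * cmod (coeff v k))\<^sup>2" by (intro power_mono assms) simp
    then have "(1 + \<bar>real_of_int k\<bar>\<^sup>2) * (cmod (coeff w k))\<^sup>2 \<le> (1 + \<bar>real_of_int k\<bar>\<^sup>2) * (\<beta> * cmod (coeff v k))\<^sup>2"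
      by (rule mult_left_mono) simp
    then show "(1 + \<bar>real_of_int k\<bar>\<^sup>2) * (cmod (coeff w k))\<^sup>2 \<le> \<beta>\<^sup>2 * ((1 + \<bar>real_of_int k\<bar>\<^sup>2) * (cmod (coeff v k))\<^sup>2)"
      by (simp add: power_mult_distrib mult_ac)
  qed (rule h1_summable)
  also have "\<dots> = (\<beta> * norm v)\<^sup>2"
    by (simp only: infsum_cmult_right[OF h1_summable] power_mult_distrib norm_h1_square)
  finally show "(norm w)\<^sup>2 \<le> (\<beta> * norm v)\<^sup>2" .
qed (use assms(2) in simp)

lemma ex1_h1_coeff:
  fixes c :: "int \<Rightarrow> complex"
  assumes "\<And>k. c (- k) = cnj (c k)"
    and "(\<lambda>k. (1 + \<bar>real_of_int k\<bar>\<^sup>2) * (cmod (c k))\<^sup>2) summable_on UNIV"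
  shows "\<exists>!v. \<forall>k. coeff v k = c k"
proof (rule ex_ex1I)
  show "\<exists>v. \<forall>k. coeff v k = c k" by (rule ex_h1_coeff[OF assms])
qed (auto intro: h1_coeff_eqI)

lemma symbol_Linv_dxx_bound:
  assumes "h \<noteq> 0"
  shows "\<bar>- ((of_int k)\<^sup>2) / (1 + h\<^sup>2 / 6 * (of_int k)\<^sup>2) :: real\<bar> \<le> 6 / h\<^sup>2"
proof -
  have pos: "1 + h\<^sup>2 / 6 * (real_of_int k)\<^sup>2 > 0" by (simp add: add_pos_nonneg)
  have "(real_of_int k)\<^sup>2 \<le> 6 / h\<^sup>2 * (1 + h\<^sup>2 / 6 * (real_of_int k)\<^sup>2)"
    using assms by (simp add: ring_distribs)
  then have "(real_of_int k)\<^sup>2 / (1 + h\<^sup>2 / 6 * (real_of_int k)\<^sup>2) \<le> 6 / h\<^sup>2"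
    using pos by (subst pos_divide_le_eq) auto
  then show ?thesis using pos by (simp add: abs_divide)
qed

lemma coeff_Linv_dxx:
  assumes "h \<noteq> 0"
  shows "coeff (Linv_dxx h v) k = of_real (- ((of_int k)\<^sup>2) / (1 + h\<^sup>2 / 6 * (of_int k)\<^sup>2)) * coeff v k"
proof -
  let ?m = "\<lambda>k::int. - ((of_int k)\<^sup>2) / (1 + h\<^sup>2 / 6 * (of_int k)\<^sup>2) :: real"
  have m: "\<bar>?m k\<bar> \<le> 6 / h\<^sup>2" for k
    by (rule symbol_Linv_dxx_bound[OF assms])
  have "\<exists>!w. \<forall>k. coeff w k = of_real (?m k) * coeff v k"
  proof (rule ex1_h1_coeff)
    show "(\<lambda>k. (1 + \<bar>real_of_int k\<bar>\<^sup>2) * (cmod (of_real (?m k) * coeff v k))\<^sup>2) summable_on UNIV"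
    proof (rule summable_on_comparison_test[OF summable_on_cmult_right[OF h1_summable, of "(6 / h\<^sup>2)\<^sup>2" v]])
      fix k
      have "(\<bar>?m k\<bar>)\<^sup>2 \<le> (6 / h\<^sup>2)\<^sup>2" by (intro power_mono m) simp
      then have "(\<bar>?m k\<bar>)\<^sup>2 * ((1 + \<bar>real_of_int k\<bar>\<^sup>2) * (cmod (coeff v k))\<^sup>2)
          \<le> (6 / h\<^sup>2)\<^sup>2 * ((1 + \<bar>real_of_int k\<bar>\<^sup>2) * (cmod (coeff v k))\<^sup>2)"
        by (rule mult_right_mono) simp
      then show "(1 + \<bar>real_of_int k\<bar>\<^sup>2) * (cmod (of_real (?m k) * coeff v k))\<^sup>2
          \<le> (6 / h\<^sup>2)\<^sup>2 * ((1 + \<bar>real_of_int k\<bar>\<^sup>2) * (cmod (coeff v k))\<^sup>2)"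
        by (simp only: norm_mult norm_of_real power_mult_distrib mult_ac)
    qed simp
  qed (simp add: fcoeff_minus)
  from theI'[OF this] show ?thesis unfolding Linv_dxx_def by blast
qed

lemma norm_Linv_dxx:
  assumes "h \<noteq> 0"
  shows "norm (Linv_dxx h v) \<le> 6 / h\<^sup>2 * norm v"
proof (rule norm_h1_mono)
  fix k
  have "\<bar>- ((of_int k)\<^sup>2) / (1 + h\<^sup>2 / 6 * (of_int k)\<^sup>2) :: real\<bar> \<le> 6 / h\<^sup>2"
    by (rule symbol_Linv_dxx_bound[OF assms])
  then show "cmod (coeff (Linv_dxx h v) k) \<le> 6 / h\<^sup>2 * cmod (coeff v k)"
    unfolding coeff_Linv_dxx[OF assms] norm_mult norm_of_real by (rule mult_right_mono) simp
qed simp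

lemma bounded_linear_Linv_dxx:
  assumes "h \<noteq> 0"
  shows "bounded_linear (Linv_dxx h)"
proof (rule bounded_linear_intro[where K = "6 / h\<^sup>2"])
  show "Linv_dxx h (v + w) = Linv_dxx h v + Linv_dxx h w" for v w
    by (rule h1_coeff_eqI) (simp only: coeff_add coeff_Linv_dxx[OF assms] distrib_left)
  show "Linv_dxx h (r *\<^sub>R v) = r *\<^sub>R Linv_dxx h v" for r v
    by (rule h1_coeff_eqI) (simp only: coeff_scaleR coeff_Linv_dxx[OF assms] mult_ac)
  show "norm (Linv_dxx h v) \<le> norm v * (6 / h\<^sup>2)" for v
    using norm_Linv_dxx[OF assms] by (simp only: mult.commute)
qed

lemma bounded_linear_A_op:
  assumes "h \<noteq> 0"
  shows "bounded_linear (A_op h)"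
  unfolding A_op_def
  by (intro bounded_linear_Pair bounded_linear_snd
      bounded_linear_compose[OF bounded_linear_Linv_dxx[OF assms] bounded_linear_fst])

text \<open>The inverse of \<open>L\<close> on \<open>L\<^sup>2\<close>. Its symbol is \<open>1 / (1 + h\<^sup>2 k\<^sup>2 / 6)\<close>, the inverse of the weight of
  \<open>H\<^sup>1\<^sub>h\<close>, so \<open>L\<^sup>-\<^sup>1\<close> is a contraction from \<open>L\<^sup>2\<close> to \<open>H\<^sup>1\<^sub>h\<close> for every \<open>h\<close>.\<close>

definition L_inv :: "real \<Rightarrow> (real \<Rightarrow> real) \<Rightarrow> h1" where
  "L_inv h g = (THE v. \<forall>k. coeff v k = fcoeff g k / of_real (1 + h\<^sup>2 / 6 * (of_int k)\<^sup>2))"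

lemma coeff_L_inv:
  assumes "h \<noteq> 0" and g: "g \<in> L2_circle"
  shows "coeff (L_inv h g) k = fcoeff g k / of_real (1 + h\<^sup>2 / 6 * (of_int k)\<^sup>2)"
proof -
  let ?m = "\<lambda>k::int. 1 + h\<^sup>2 / 6 * (real_of_int k)\<^sup>2"
  have m1: "?m k \<ge> 1" for k by simp
  have "\<exists>!v. \<forall>k. coeff v k = fcoeff g k / of_real (?m k)"
  proof (rule ex1_h1_coeff)
    show "(\<lambda>k. (1 + \<bar>real_of_int k\<bar>\<^sup>2) * (cmod (fcoeff g k / of_real (?m k)))\<^sup>2) summable_on UNIV"
    proof (rule summable_on_comparison_test[OF summable_on_cmult_right[OF Bessel_summable[OF g], of "1 + 6 / h\<^sup>2"]])
      fix k
      have "1 + \<bar>real_of_int k\<bar>\<^sup>2 \<le> (1 + 6 / h\<^sup>2) * ?m k"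
        using assms by (simp add: ring_distribs add_divide_distrib)
      also have "\<dots> \<le> (1 + 6 / h\<^sup>2) * (?m k)\<^sup>2"
        using self_le_power[OF m1[of k], of 2] by (intro mult_left_mono) auto
      finally have "(1 + \<bar>real_of_int k\<bar>\<^sup>2) / (?m k)\<^sup>2 \<le> 1 + 6 / h\<^sup>2"
        using zero_less_power[OF less_le_trans[OF zero_less_one m1[of k]], of 2] by (subst pos_divide_le_eq)
      then have "(1 + \<bar>real_of_int k\<bar>\<^sup>2) / (?m k)\<^sup>2 * (cmod (fcoeff g k))\<^sup>2 \<le> (1 + 6 / h\<^sup>2) * (cmod (fcoeff g k))\<^sup>2"
        by (rule mult_right_mono) simp
      then show "(1 + \<bar>real_of_int k\<bar>\<^sup>2) * (cmod (fcoeff g k / of_real (?m k)))\<^sup>2 \<le> (1 + 6 / h\<^sup>2) * (cmod (fcoeff g k))\<^sup>2"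
        by (simp only: norm_divide norm_of_real power_divide power2_abs times_divide_eq_right times_divide_eq_left)
    qed simp
  qed (simp add: fcoeff_minus)
  from theI'[OF this] show ?thesis unfolding L_inv_def by blast
qed

lemma norm_H1h_L_inv:
  assumes "h \<noteq> 0" and g: "continuous_on UNIV g" "periodic g" and s: "\<And>x. \<bar>g x\<bar> \<le> s"
  shows "norm_H1h h (L_inv h g) \<le> s"
proof (rule power2_le_imp_le)
  note L2 = continuous_L2_circle[OF g]
  have "(norm_H1h h (L_inv h g))\<^sup>2 \<le> (\<Sum>\<^sub>\<infinity>k. (cmod (fcoeff g k))\<^sup>2)"
    unfolding norm_H1h_square
  proof (rule infsum_mono[OF H1h_summable Bessel_summable[OF L2]])
    fix k
    let ?m = "1 + h\<^sup>2 / 6 * (real_of_int k)\<^sup>2"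
    have m1: "?m \<ge> 1" by simp
    have "?m / ?m\<^sup>2 \<le> 1"
      using self_le_power[OF m1, of 2] zero_less_power[OF less_le_trans[OF zero_less_one m1], of 2]
      by (subst pos_divide_le_eq) auto
    then have "?m / ?m\<^sup>2 * (cmod (fcoeff g k))\<^sup>2 \<le> 1 * (cmod (fcoeff g k))\<^sup>2"
      by (rule mult_right_mono) simp
    then show "(1 + h\<^sup>2 / 6 * \<bar>real_of_int k\<bar>\<^sup>2) * (cmod (coeff (L_inv h g) k))\<^sup>2 \<le> (cmod (fcoeff g k))\<^sup>2"
      by (simp only: coeff_L_inv[OF assms(1) L2] norm_divide norm_of_real power_divide power2_abs
          times_divide_eq_right times_divide_eq_left mult_1)
  qed
  also have "\<dots> \<le> s\<^sup>2" by (rule Bessel_sup[OF g s])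
  finally show "(norm_H1h h (L_inv h g))\<^sup>2 \<le> s\<^sup>2" .
  show "0 \<le> s" using s[of 0] by simp
qed

lemma L_inv_diff:
  assumes "h \<noteq> 0" "g \<in> L2_circle" "g' \<in> L2_circle"
  shows "L_inv h g - L_inv h g' = L_inv h (\<lambda>x. g x - g' x)"
  by (rule h1_coeff_eqI)
    (simp only: coeff_diff coeff_L_inv[OF assms(1)] assms(2,3) L2_circle_diff fcoeff_L2_diff[OF assms(2,3)]
      diff_divide_distrib)

section \<open>The linear evolution\<close>

lemma norm_funpow_le:
  fixes T :: "'a::real_normed_vector \<Rightarrow> 'a"
  assumes "bounded_linear T"
  shows "norm ((T ^^ n) x) \<le> onorm T ^ n * norm x"
proof (induction n)
  case (Suc n)
  have "norm ((T ^^ Suc n) x) \<le> onorm T * norm ((T ^^ n) x)"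
    using onorm[OF assms] by simp
  also have "\<dots> \<le> onorm T * (onorm T ^ n * norm x)"
    by (intro mult_left_mono Suc onorm_pos_le assms)
  finally show ?case by (simp add: mult_ac)
qed simp

lemma summable_exp_series:
  fixes a :: "nat \<Rightarrow> 'a::banach"
  assumes "\<And>n. norm (a n) \<le> K ^ n * D"
  shows "summable (\<lambda>n. (t ^ n / fact n) *\<^sub>R a n)"
proof (rule summable_comparison_test[OF exI[of _ 0]])
  show "summable (\<lambda>n. inverse (fact n) * (\<bar>t\<bar> * K) ^ n * D)"
    by (intro summable_mult2 summable_exp)
  show "\<forall>n\<ge>0. norm ((t ^ n / fact n) *\<^sub>R a n) \<le> inverse (fact n) * (\<bar>t\<bar> * K) ^ n * D"
  proof (intro allI impI)
    fix n
    have "norm ((t ^ n / fact n) *\<^sub>R a n) = \<bar>t\<bar> ^ n / fact n * norm (a n)"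
      by (simp add: power_abs)
    also have "\<dots> \<le> \<bar>t\<bar> ^ n / fact n * (K ^ n * D)"
      by (intro mult_left_mono assms) simp
    finally show "norm ((t ^ n / fact n) *\<^sub>R a n) \<le> inverse (fact n) * (\<bar>t\<bar> * K) ^ n * D"
      by (simp add: field_simps power_mult_distrib)
  qed
qed

lemma exp_A_sums:
  assumes "h \<noteq> 0"
  shows "(\<lambda>n. (t ^ n / fact n) *\<^sub>R (A_op h ^^ n) U) sums exp_A h t U"
  unfolding exp_A_def
  by (rule summable_sums, rule summable_exp_series, rule norm_funpow_le[OF bounded_linear_A_op[OF assms]])

lemma exp_A_0 [simp]: "exp_A h 0 U = U"
proof -
  have "(\<lambda>n. (0 ^ n / fact n) *\<^sub>R (A_op h ^^ n) U) = (\<lambda>n. if n = 0 then U else 0)"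
    by (auto simp: power_0_left)
  then show ?thesis using sums_single[of 0 "\<lambda>_. U"] by (simp add: exp_A_def sums_iff)
qed

lemma exp_A_diff:
  assumes "h \<noteq> 0"
  shows "exp_A h t (U - W) = exp_A h t U - exp_A h t W"
proof -
  have "(A_op h ^^ n) (U - W) = (A_op h ^^ n) U - (A_op h ^^ n) W" for n
    by (induction n) (simp_all add: linear_diff[OF bounded_linear.linear[OF bounded_linear_A_op[OF assms]]])
  then have "(\<lambda>n. (t ^ n / fact n) *\<^sub>R (A_op h ^^ n) (U - W)) sums (exp_A h t U - exp_A h t W)"
    using sums_diff[OF exp_A_sums[OF assms, of t U] exp_A_sums[OF assms, of t W]]
    by (simp add: scaleR_diff_right)
  then show ?thesis using exp_A_sums[OF assms, of t "U - W"] sums_unique2 by blast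
qed

text \<open>Joint continuity of \<open>(t, U) \<mapsto> e\<^bsup>tA\<^esup> U\<close>, along a compact set of parameters, where the
  exponential series converges uniformly.\<close>

lemma continuous_on_exp_A:
  fixes S :: "'b::metric_space set"
  assumes "h \<noteq> 0" "compact S" "continuous_on S \<tau>" "continuous_on S g"
  shows "continuous_on S (\<lambda>s. exp_A h (\<tau> s) (g s))"
proof -
  obtain a where a: "\<And>s. s \<in> S \<Longrightarrow> norm (\<tau> s) \<le> a"
    using compact_imp_bounded[OF compact_continuous_image[OF assms(3,2)]] by (auto simp: bounded_iff)
  obtain b where b: "\<And>s. s \<in> S \<Longrightarrow> norm (g s) \<le> b"
    using compact_imp_bounded[OF compact_continuous_image[OF assms(4,2)]] by (auto simp: bounded_iff)
  note bl = bounded_linear_A_op[OF assms(1)]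
  have "uniform_limit S (\<lambda>n s. \<Sum>i<n. (\<tau> s ^ i / fact i) *\<^sub>R (A_op h ^^ i) (g s)) (\<lambda>s. exp_A h (\<tau> s) (g s)) sequentially"
    unfolding exp_A_def
  proof (rule Weierstrass_m_test)
    show "summable (\<lambda>i. inverse (fact i) * (a * onorm (A_op h)) ^ i * b)"
      by (intro summable_mult2 summable_exp)
    fix i s assume s: "s \<in> S"
    have "norm ((\<tau> s ^ i / fact i) *\<^sub>R (A_op h ^^ i) (g s)) = \<bar>\<tau> s\<bar> ^ i / fact i * norm ((A_op h ^^ i) (g s))"
      by (simp add: power_abs)
    also have "\<dots> \<le> a ^ i / fact i * (onorm (A_op h) ^ i * b)"
    proof (intro mult_mono)
      show "\<bar>\<tau> s\<bar> ^ i / fact i \<le> a ^ i / fact i"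
        using a[OF s] by (intro divide_right_mono power_mono) auto
      show "norm ((A_op h ^^ i) (g s)) \<le> onorm (A_op h) ^ i * b"
        using norm_funpow_le[OF bl, of i "g s"] mult_left_mono[OF b[OF s], of "onorm (A_op h) ^ i"]
          zero_le_power[OF onorm_pos_le[OF bl], of i] by linarith
      show "0 \<le> a ^ i / fact i" using a[OF s] by (intro divide_nonneg_pos zero_le_power) auto
    qed simp
    finally show "norm ((\<tau> s ^ i / fact i) *\<^sub>R (A_op h ^^ i) (g s)) \<le> inverse (fact i) * (a * onorm (A_op h)) ^ i * b"
      by (simp add: field_simps power_mult_distrib)
  qed
  moreover have "continuous_on S (\<lambda>s. (A_op h ^^ i) (g s))" for i
    by (induction i) (simp_all add: assms(4) bounded_linear.continuous_on[OF bl])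
  then have "\<forall>n. continuous_on S (\<lambda>s. \<Sum>i<n. (\<tau> s ^ i / fact i) *\<^sub>R (A_op h ^^ i) (g s))"
    by (intro allI continuous_intros assms(3)) auto
  ultimately show ?thesis
    by (intro uniform_limit_theorem[OF always_eventually]) auto
qed

lemma has_vector_derivative_exp_series:
  fixes a :: "nat \<Rightarrow> complex"
  assumes a: "\<And>n. norm (a n) \<le> K ^ n * D"
  shows "((\<lambda>t::real. \<Sum>n. (t ^ n / fact n) *\<^sub>R a n) has_vector_derivative (\<Sum>n. (t ^ n / fact n) *\<^sub>R a (Suc n))) (at t)"
proof -
  define c where "c n = a n / fact n" for n
  have "summable (\<lambda>n. c n * z ^ n)" for z
  proof -
    have "summable (\<lambda>n. (1 ^ n / fact n) *\<^sub>R (a n * z ^ n))"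
    proof (rule summable_exp_series)
      fix n
      have "norm (a n * z ^ n) \<le> (K ^ n * D) * norm z ^ n"
        using mult_right_mono[OF a[of n], of "norm z ^ n"] by (simp add: norm_mult norm_power)
      then show "norm (a n * z ^ n) \<le> (K * norm z) ^ n * D" by (simp add: power_mult_distrib mult_ac)
    qed
    then show ?thesis by (simp add: c_def scaleR_conv_of_real)
  qed
  then have "((\<lambda>z. \<Sum>n. c n * z ^ n) has_field_derivative (\<Sum>n. diffs c n * complex_of_real t ^ n)) (at (complex_of_real t))"
    by (rule termdiffs_strong_converges_everywhere)
  then have "((\<lambda>t. \<Sum>n. c n * complex_of_real t ^ n) has_vector_derivative (\<Sum>n. diffs c n * complex_of_real t ^ n)) (at t)"
    by (rule has_vector_derivative_real_field)
  moreover have "diffs c n = a (Suc n) / fact n" for n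
    by (simp add: diffs_def c_def field_simps del: of_nat_Suc)
  ultimately show ?thesis by (simp add: c_def scaleR_conv_of_real mult_ac)
qed

text \<open>On the \<open>k\<close>-th Fourier mode the linear flow is a harmonic oscillator.\<close>

lemma exp_A_mode_derivative:
  fixes U :: "h1 \<times> h1" and k :: int
  assumes h: "h \<noteq> 0"
  defines "u \<equiv> \<lambda>t. coeff (fst (exp_A h t U)) k" and "p \<equiv> \<lambda>t. coeff (snd (exp_A h t U)) k"
  shows "(u has_vector_derivative p t) (at t)"
    and "(p has_vector_derivative of_real (- ((of_int k)\<^sup>2) / (1 + h\<^sup>2 / 6 * (of_int k)\<^sup>2)) * u t) (at t)"
proof -
  note bl = bounded_linear_A_op[OF h]
  let ?m = "- ((of_int k)\<^sup>2) / (1 + h\<^sup>2 / 6 * (of_int k)\<^sup>2) :: real"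
  define a where "a n = coeff (fst ((A_op h ^^ n) U)) k" for n
  define b where "b n = coeff (snd ((A_op h ^^ n) U)) k" for n
  have a_Suc: "a (Suc n) = b n" and b_Suc: "b (Suc n) = of_real ?m * a n" for n
    by (simp_all add: a_def b_def A_op_def coeff_Linv_dxx[OF h])
  have blf: "bounded_linear (\<lambda>W. coeff (fst W) k)" and bls: "bounded_linear (\<lambda>W. coeff (snd W) k)"
    using bounded_linear_compose[OF bounded_linear_coeff bounded_linear_fst]
      bounded_linear_compose[OF bounded_linear_coeff bounded_linear_snd] by this
  have su: "(\<lambda>n. (t ^ n / fact n) *\<^sub>R a n) sums u t" for t
    using bounded_linear.sums[OF blf exp_A_sums[OF h, of t U]]
    by (simp add: a_def u_def coeff_scaleR scaleR_conv_of_real)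
  have sp: "(\<lambda>n. (t ^ n / fact n) *\<^sub>R b n) sums p t" for t
    using bounded_linear.sums[OF bls exp_A_sums[OF h, of t U]]
    by (simp add: b_def p_def coeff_scaleR scaleR_conv_of_real)
  have nf: "norm (fst W) \<le> norm W" and ns: "norm (snd W) \<le> norm W" for W :: "h1 \<times> h1"
    using norm_fst_le[of "fst W" "snd W"] norm_snd_le[of "snd W" "fst W"] by simp_all
  have na: "norm (a n) \<le> onorm (A_op h) ^ n * norm U" for n
    unfolding a_def by (rule order_trans[OF coeff_le_norm order_trans[OF nf norm_funpow_le[OF bl]]])
  have nb: "norm (b n) \<le> onorm (A_op h) ^ n * norm U" for n
    unfolding b_def by (rule order_trans[OF coeff_le_norm order_trans[OF ns norm_funpow_le[OF bl]]])
  have u: "u = (\<lambda>t. \<Sum>n. (t ^ n / fact n) *\<^sub>R a n)" and p: "p = (\<lambda>t. \<Sum>n. (t ^ n / fact n) *\<^sub>R b n)"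
    using su sp by (auto simp: sums_iff)
  show "(u has_vector_derivative p t) (at t)"
    using has_vector_derivative_exp_series[OF na, of t] sp[of t] unfolding u a_Suc by (simp add: sums_iff)
  have "(\<lambda>n. (t ^ n / fact n) *\<^sub>R b (Suc n)) sums (of_real ?m * u t)"
    unfolding b_Suc using sums_mult[OF su[of t], of "of_real ?m"] by (simp only: mult_scaleR_right)
  then show "(p has_vector_derivative of_real ?m * u t) (at t)"
    using has_vector_derivative_exp_series[OF nb, of t] unfolding p by (simp only: sums_iff)
qed

text \<open>The energy \<open>k\<^sup>2 \<bar>u\<^sub>k\<bar>\<^sup>2 + (1 + h\<^sup>2 k\<^sup>2 / 6) \<bar>p\<^sub>k\<bar>\<^sup>2\<close> of a mode is conserved, for every \<open>h\<close>: this is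
  what the weight of \<open>H\<^sup>1\<^sub>h\<close> is made for. Only the remaining term \<open>\<bar>u\<^sub>k\<bar>\<^sup>2\<close> of the norm can grow, and its
  derivative \<open>2 u\<^sub>k \<bullet> p\<^sub>k\<close> is at most the squared norm.\<close>

lemma exp_A_mode_growth:
  fixes U :: "h1 \<times> h1" and k :: int
  assumes h: "h \<noteq> 0" and t: "t \<ge> 0"
  defines "E \<equiv> \<lambda>U. (1 + \<bar>real_of_int k\<bar>\<^sup>2) * (cmod (coeff (fst U) k))\<^sup>2
    + (1 + h\<^sup>2 / 6 * \<bar>real_of_int k\<bar>\<^sup>2) * (cmod (coeff (snd U) k))\<^sup>2"
  shows "E (exp_A h t U) \<le> exp t * E U"
proof -
  define u where "u = (\<lambda>t. coeff (fst (exp_A h t U)) k)"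
  define p where "p = (\<lambda>t. coeff (snd (exp_A h t U)) k)"
  define w where "w = 1 + h\<^sup>2 / 6 * (real_of_int k)\<^sup>2"
  define m where "m = - ((real_of_int k)\<^sup>2) / w"
  have w: "w \<ge> 1" by (simp add: w_def)
  then have wm: "w * m = - (real_of_int k)\<^sup>2" by (simp add: m_def)
  have du: "(u has_vector_derivative p t) (at t)" and dp: "(p has_vector_derivative m *\<^sub>R u t) (at t)" for t
    using exp_A_mode_derivative[OF h, of U k t]
    by (simp_all only: u_def p_def m_def w_def scaleR_conv_of_real)
  define e where "e t = (1 + (real_of_int k)\<^sup>2) * (u t \<bullet> u t) + w * (p t \<bullet> p t)" for t
  have e: "e t = E (exp_A h t U)" for t
    by (simp add: e_def E_def u_def p_def w_def power2_norm_eq_inner)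
  have de: "(e has_real_derivative 2 * (u t \<bullet> p t)) (at t)" for t
  proof -
    have "(e has_vector_derivative ((1 + (real_of_int k)\<^sup>2) * (u t \<bullet> p t + p t \<bullet> u t)
        + w * (p t \<bullet> (m *\<^sub>R u t) + (m *\<^sub>R u t) \<bullet> p t))) (at t)"
      unfolding e_def
      by (intro has_vector_derivative_add has_vector_derivative_mult_right
          bounded_bilinear.has_vector_derivative[OF bounded_bilinear_inner] du dp)
    moreover have "(1 + (real_of_int k)\<^sup>2) * (u t \<bullet> p t + p t \<bullet> u t)
        + w * (p t \<bullet> (m *\<^sub>R u t) + (m *\<^sub>R u t) \<bullet> p t) = 2 * (1 + (real_of_int k)\<^sup>2 + w * m) * (u t \<bullet> p t)"
      by (simp add: inner_commute algebra_simps)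
    ultimately show ?thesis
      by (simp add: wm has_real_derivative_iff_has_vector_derivative)
  qed
  have ub: "2 * (u t \<bullet> p t) \<le> e t" for t
  proof -
    have "0 \<le> (u t - p t) \<bullet> (u t - p t)" by simp
    also have "\<dots> = u t \<bullet> u t + p t \<bullet> p t - 2 * (u t \<bullet> p t)"
      by (simp add: inner_diff_left inner_diff_right inner_commute)
    finally have "2 * (u t \<bullet> p t) \<le> u t \<bullet> u t + p t \<bullet> p t" by simp
    also have "\<dots> \<le> e t"
      unfolding e_def using w
        mult_right_mono[of 1 "1 + (real_of_int k)\<^sup>2" "u t \<bullet> u t"] mult_right_mono[OF w, of "p t \<bullet> p t"]
      by simp
    finally show ?thesis .
  qed
  have "exp (- t) * e t \<le> exp (- 0) * e 0"
  proof (rule DERIV_nonpos_imp_nonincreasing[OF t])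
    fix s :: real
    have "((\<lambda>s. exp (- s) * e s) has_real_derivative (exp (- s) * (2 * (u s \<bullet> p s) - e s))) (at s)"
      by (auto intro!: derivative_eq_intros de simp: algebra_simps)
    moreover have "exp (- s) * (2 * (u s \<bullet> p s) - e s) \<le> 0"
      using ub[of s] by (simp add: mult_nonneg_nonpos)
    ultimately show "\<exists>y. ((\<lambda>s. exp (- s) * e s) has_real_derivative y) (at s) \<and> y \<le> 0" by blast
  qed
  then have "e t \<le> exp t * e 0" by (simp add: exp_minus field_simps)
  then show ?thesis by (simp add: e)
qed

lemma norm_H1_H1h_square:
  "(norm_H1_H1h h U)\<^sup>2 = (\<Sum>\<^sub>\<infinity>k. (1 + \<bar>real_of_int k\<bar>\<^sup>2) * (cmod (coeff (fst U) k))\<^sup>2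
    + (1 + h\<^sup>2 / 6 * \<bar>real_of_int k\<bar>\<^sup>2) * (cmod (coeff (snd U) k))\<^sup>2)"
  by (simp only: infsum_add[OF h1_summable H1h_summable])
    (simp add: norm_H1_H1h_def norm_h1_square norm_H1h_square infsum_nonneg)

lemma norm_exp_A_le:
  assumes h: "h > 0" and t: "t \<ge> 0"
  shows "norm_H1_H1h h (exp_A h t U) \<le> exp (t / 2) * norm_H1_H1h h U"
proof (rule power2_le_imp_le)
  have h0: "h \<noteq> 0" using h by simp
  note sum = summable_on_add[OF h1_summable H1h_summable]
  have "(norm_H1_H1h h (exp_A h t U))\<^sup>2 \<le> (\<Sum>\<^sub>\<infinity>k. exp t * ((1 + \<bar>real_of_int k\<bar>\<^sup>2) * (cmod (coeff (fst U) k))\<^sup>2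
    + (1 + h\<^sup>2 / 6 * \<bar>real_of_int k\<bar>\<^sup>2) * (cmod (coeff (snd U) k))\<^sup>2))"
    unfolding norm_H1_H1h_square
    by (intro infsum_mono summable_on_cmult_right sum exp_A_mode_growth[OF h0 t])
  also have "\<dots> = exp t * (norm_H1_H1h h U)\<^sup>2"
    unfolding norm_H1_H1h_square by (rule infsum_cmult_right[OF sum])
  also have "\<dots> = (exp (t / 2) * norm_H1_H1h h U)\<^sup>2"
    by (simp add: power_mult_distrib flip: exp_double)
  finally show "(norm_H1_H1h h (exp_A h t U))\<^sup>2 \<le> (exp (t / 2) * norm_H1_H1h h U)\<^sup>2" .
  show "0 \<le> exp (t / 2) * norm_H1_H1h h U"
    using equivalent_norm.nonneg[OF equivalent_norm_H1_H1h[OF h]] by simp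
qed

section \<open>Inverting \<open>K(u)\<close>\<close>

lemma h1_L2_circle: "h1_fun v \<in> L2_circle"
  by (rule continuous_L2_circle[OF h1_continuous h1_periodic])

lemma continuous_compose_h1: "continuous_on UNIV \<phi> \<Longrightarrow> continuous_on UNIV (\<lambda>x. \<phi> (h1_fun u x))"
  for \<phi> :: "real \<Rightarrow> real"
  by (rule continuous_on_compose2[of UNIV \<phi>]) (auto simp: h1_continuous)

lemma h1_fun_periodic: "h1_fun v (x + 2 * pi) = h1_fun v x"
  using h1_periodic by (simp add: periodic_def)

lemma M_op_continuous:
  assumes "continuous_on UNIV (deriv f)"
  shows "continuous_on UNIV (M_op h f u v)"
proof -
  have "continuous_on UNIV (\<lambda>x. - (h\<^sup>2 / 6) * deriv f (h1_fun u x) * h1_fun v x)"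
    by (intro continuous_intros continuous_compose_h1 assms h1_continuous)
  then show ?thesis by (simp add: M_op_def[abs_def])
qed

lemma M_op_periodic: "periodic (M_op h f u v)"
  by (simp add: periodic_def M_op_def h1_fun_periodic)

lemma M_op_L2: "continuous_on UNIV (deriv f) \<Longrightarrow> M_op h f u v \<in> L2_circle"
  by (rule continuous_L2_circle[OF M_op_continuous M_op_periodic])

lemma M_op_diff: "M_op h f u v x - M_op h f u w x = M_op h f u (v - w) x"
  by (simp add: M_op_def h1_fun_diff right_diff_distrib)

text \<open>Comparing Fourier coefficients turns \<open>K(u) v = g\<close> into a fixed point equation in \<open>H\<^sup>1\<close>. Conversely,
  a fixed point gains two derivatives because \<open>\<partial>\<^sub>x\<^sub>x v\<close> can be read off the equation.\<close>

lemma K_graph_iff: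
  assumes h: "h > 0" and f: "continuous_on UNIV (deriv f)" and g: "g \<in> L2_circle"
  shows "K_graph h f u v g \<longleftrightarrow> v = L_inv h (\<lambda>x. g x - M_op h f u v x)"
proof -
  let ?M = "M_op h f u v"
  have h0: "h \<noteq> 0" using h by simp
  note M = M_op_L2[OF f, of h u v]
  note gM = L2_circle_diff[OF g M]
  have pos: "1 + h\<^sup>2 / 6 * (real_of_int k)\<^sup>2 \<noteq> 0" for k
  proof -
    have "1 + h\<^sup>2 / 6 * (real_of_int k)\<^sup>2 \<ge> 1" by simp
    then show ?thesis by linarith
  qed
  show ?thesis
  proof
    assume "K_graph h f u v g"
    then obtain w where w: "w \<in> L2_circle" "\<And>k. fcoeff w k = - ((of_int k)\<^sup>2) * coeff v k"
      and ae: "AE x in lebesgue. (h1_fun v x - h\<^sup>2 / 6 * w x) + ?M x = g x"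
      unfolding K_graph_def has_dxx_def by blast
    note Lv = L2_circle_diff[OF h1_L2_circle[of v] L2_circle_scale[OF w(1), of "h\<^sup>2 / 6"]]
    show "v = L_inv h (\<lambda>x. g x - ?M x)"
    proof (rule h1_coeff_eqI)
      fix k
      have "fcoeff g k = fcoeff (\<lambda>x. (h1_fun v x - h\<^sup>2 / 6 * w x) + ?M x) k"
        using fcoeff_cong_AE[OF L2_circle_add[OF Lv M] g ae] by simp
      also have "\<dots> = coeff v k - of_real (h\<^sup>2 / 6) * fcoeff w k + fcoeff ?M k"
        by (simp only: fcoeff_L2_add[OF Lv M] fcoeff_L2_scale
            fcoeff_L2_diff[OF h1_L2_circle[of v] L2_circle_scale[OF w(1), of "h\<^sup>2 / 6"]])
      also have "\<dots> = of_real (1 + h\<^sup>2 / 6 * (of_int k)\<^sup>2) * coeff v k + fcoeff ?M k"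
        by (simp add: w(2) algebra_simps)
      finally have "fcoeff (\<lambda>x. g x - ?M x) k = of_real (1 + h\<^sup>2 / 6 * (of_int k)\<^sup>2) * coeff v k"
        by (simp only: fcoeff_L2_diff[OF g M]) simp
      moreover have "complex_of_real (1 + h\<^sup>2 / 6 * (of_int k)\<^sup>2) \<noteq> 0"
        using pos[of k] by (simp only: of_real_eq_0_iff not_False_eq_True)
      ultimately show "coeff v k = coeff (L_inv h (\<lambda>x. g x - ?M x)) k"
        by (simp only: coeff_L_inv[OF h0 gM] nonzero_mult_div_cancel_left not_False_eq_True)
    qed
  next
    assume v: "v = L_inv h (\<lambda>x. g x - ?M x)"
    define w where "w x = 6 / h\<^sup>2 * (h1_fun v x - (g x - ?M x))" for x
    have wL2: "w \<in> L2_circle"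
      unfolding w_def[abs_def] by (intro L2_circle_scale L2_circle_diff h1_L2_circle gM)
    have fw: "fcoeff w k = - ((of_int k)\<^sup>2) * coeff v k" for k
    proof -
      have "coeff v k = fcoeff (\<lambda>x. g x - ?M x) k / of_real (1 + h\<^sup>2 / 6 * (of_int k)\<^sup>2)"
        using coeff_L_inv[OF h0 gM, of k] v by simp
      moreover have "complex_of_real (1 + h\<^sup>2 / 6 * (of_int k)\<^sup>2) \<noteq> 0"
        using pos[of k] by (simp only: of_real_eq_0_iff not_False_eq_True)
      ultimately have "fcoeff (\<lambda>x. g x - ?M x) k = of_real (1 + h\<^sup>2 / 6 * (of_int k)\<^sup>2) * coeff v k"
        by (simp only: nonzero_mult_div_cancel_left not_False_eq_True times_divide_eq_right)
      then have "fcoeff w k = of_real (6 / h\<^sup>2) * (coeff v k - of_real (1 + h\<^sup>2 / 6 * (of_int k)\<^sup>2) * coeff v k)"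
        unfolding w_def[abs_def] by (simp only: fcoeff_L2_scale fcoeff_L2_diff[OF h1_L2_circle gM])
      also have "\<dots> = - ((of_int k)\<^sup>2) * coeff v k"
        using h0 by (simp add: algebra_simps)
      finally show ?thesis .
    qed
    have "(\<lambda>k. (cmod (coeff v k))\<^sup>2 + (cmod (fcoeff w k))\<^sup>2) summable_on UNIV"
      by (intro summable_on_add Bessel_summable h1_L2_circle wL2)
    moreover have "(cmod (coeff v k))\<^sup>2 + (cmod (fcoeff w k))\<^sup>2 = (1 + \<bar>real_of_int k\<bar>^4) * (cmod (coeff v k))\<^sup>2" for k
      by (simp add: fw norm_mult norm_power power_mult_distrib distrib_right flip: power_mult)
    ultimately have "v \<in> H2" by (simp add: H2_def)
    moreover have "(h1_fun v x - h\<^sup>2 / 6 * w x) + ?M x = g x" for x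
    proof -
      have "h\<^sup>2 / 6 * (6 / h\<^sup>2 * y) = y" for y using h0 by simp
      then show ?thesis by (simp only: w_def)
    qed
    ultimately show "K_graph h f u v g"
      unfolding K_graph_def has_dxx_def using wL2 fw by blast
  qed
qed

lemma mult_diff_le:
  fixes a b a' b' :: real
  assumes "\<bar>a - a'\<bar> \<le> da" "\<bar>b\<bar> \<le> B" "\<bar>a'\<bar> \<le> A" "\<bar>b - b'\<bar> \<le> db"
  shows "\<bar>a * b - a' * b'\<bar> \<le> da * B + A * db"
proof -
  have "a * b - a' * b' = (a - a') * b + a' * (b - b')" by (simp add: algebra_simps)
  also have "\<bar>\<dots>\<bar> \<le> \<bar>a - a'\<bar> * \<bar>b\<bar> + \<bar>a'\<bar> * \<bar>b - b'\<bar>"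
    by (metis abs_mult abs_triangle_ineq)
  also have "\<dots> \<le> da * B + A * db"
    by (intro add_mono mult_mono assms) (use assms in linarith)+
  finally show ?thesis .
qed

text \<open>From here on \<open>h\<close> is small compared with a bound \<open>F\<close> for \<open>f\<close>, its first two derivatives and their
  Lipschitz constants on the range of the functions in the ball of radius \<open>R\<close> of \<open>H\<^sup>1\<close>. The smallness
  makes \<open>M(u)\<close> a perturbation of \<open>L\<close> of relative size \<open>1/2\<close>. Every constant derived below is independent
  of \<open>h\<close>.\<close>

locale small_step =
  fixes h F R :: real and f :: "real \<Rightarrow> real"
  assumes h_pos: "0 < h" and h_le_1: "h \<le> 1" and h_small: "h * F * sobolev_const \<le> 1"
    and F_nonneg: "F \<ge> 0" and R_nonneg: "R \<ge> 0"
    and cont: "continuous_on UNIV f" "continuous_on UNIV (deriv f)" "continuous_on UNIV (deriv (deriv f))"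
    and bound: "\<And>x. \<bar>x\<bar> \<le> sobolev_const * R \<Longrightarrow> \<bar>f x\<bar> \<le> F"
      "\<And>x. \<bar>x\<bar> \<le> sobolev_const * R \<Longrightarrow> \<bar>deriv f x\<bar> \<le> F"
      "\<And>x. \<bar>x\<bar> \<le> sobolev_const * R \<Longrightarrow> \<bar>deriv (deriv f) x\<bar> \<le> F"
    and lip: "\<And>x y. \<bar>x\<bar> \<le> sobolev_const * R \<Longrightarrow> \<bar>y\<bar> \<le> sobolev_const * R \<Longrightarrow> \<bar>f x - f y\<bar> \<le> F * \<bar>x - y\<bar>"
      "\<And>x y. \<bar>x\<bar> \<le> sobolev_const * R \<Longrightarrow> \<bar>y\<bar> \<le> sobolev_const * R \<Longrightarrow> \<bar>deriv f x - deriv f y\<bar> \<le> F * \<bar>x - y\<bar>"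
      "\<And>x y. \<bar>x\<bar> \<le> sobolev_const * R \<Longrightarrow> \<bar>y\<bar> \<le> sobolev_const * R \<Longrightarrow>
        \<bar>deriv (deriv f) x - deriv (deriv f) y\<bar> \<le> F * \<bar>x - y\<bar>"
begin

abbreviation "S \<equiv> sobolev_const"

lemma h_nonzero: "h \<noteq> 0" using h_pos by simp

lemma sup_le: "norm u \<le> R \<Longrightarrow> \<bar>h1_fun u x\<bar> \<le> S * R"
  using h1_sup_bound[of u x] mult_left_mono[of "norm u" R S] sobolev_const_nonneg by linarith

lemma h1_fun_diff_le: "\<bar>h1_fun u x - h1_fun w x\<bar> \<le> S * norm (u - w)"
  using h1_sup_bound[of "u - w" x] by (simp add: h1_fun_diff)

lemma lip_compose:
  assumes "norm u \<le> R" "norm w \<le> R" and \<phi>: "\<phi> \<in> {f, deriv f, deriv (deriv f)}"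
  shows "\<bar>\<phi> (h1_fun u x) - \<phi> (h1_fun w x)\<bar> \<le> F * (S * norm (u - w))"
proof -
  have "\<bar>\<phi> (h1_fun u x) - \<phi> (h1_fun w x)\<bar> \<le> F * \<bar>h1_fun u x - h1_fun w x\<bar>"
    using \<phi> lip sup_le[OF assms(1), of x] sup_le[OF assms(2), of x] by auto
  also have "\<dots> \<le> F * (S * norm (u - w))"
    by (intro mult_left_mono h1_fun_diff_le F_nonneg)
  finally show ?thesis .
qed

lemma M_op_le:
  assumes "norm u \<le> R"
  shows "\<bar>M_op h f u v x\<bar> \<le> h\<^sup>2 / 6 * F * \<bar>h1_fun v x\<bar>"
proof -
  have "\<bar>M_op h f u v x\<bar> = h\<^sup>2 / 6 * \<bar>deriv f (h1_fun u x)\<bar> * \<bar>h1_fun v x\<bar>"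
    by (simp add: M_op_def abs_mult)
  also have "\<dots> \<le> h\<^sup>2 / 6 * F * \<bar>h1_fun v x\<bar>"
    by (intro mult_right_mono mult_left_mono bound(2) sup_le[OF assms]) auto
  finally show ?thesis .
qed

text \<open>Of the factor \<open>h\<^sup>2\<close> in \<open>M(u)\<close>, one \<open>h\<close> pays for the pointwise bound of a function in \<open>H\<^sup>1\<^sub>h\<close>, and the other
  one makes the constant small.\<close>

lemma half_bound:
  assumes "h * y \<le> 3 * S * n" "n \<ge> 0"
  shows "h\<^sup>2 / 6 * F * y \<le> n / 2"
proof -
  have "h\<^sup>2 / 6 * F * y = h * F / 6 * (h * y)" by (simp add: power2_eq_square)
  also have "\<dots> \<le> h * F / 6 * (3 * S * n)"
    using h_pos F_nonneg by (intro mult_left_mono assms(1)) auto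
  also have "\<dots> = (h * F * S) * (n / 2)" by simp
  also have "\<dots> \<le> 1 * (n / 2)" by (intro mult_right_mono h_small) (use assms(2) in simp)
  finally show ?thesis by simp
qed

lemma M_op_le_half:
  assumes "norm u \<le> R"
  shows "\<bar>M_op h f u v x\<bar> \<le> norm_H1h h v / 2"
  using M_op_le[OF assms, of v x]
    half_bound[OF H1h_sup_bound[OF h_pos h_le_1, of v x] norm_H1h_nonneg] by linarith

text \<open>The fixed point map is a contraction in the norm of \<open>H\<^sup>1\<close> itself, in which the space is complete:
  \<open>L\<^sup>-\<^sup>1\<close> loses a factor \<open>1/h\<close> there, which the factor \<open>h\<^sup>2\<close> in \<open>M(u)\<close> more than compensates.\<close>

lemma ex1_K_graph:
  assumes u: "norm u \<le> R" and g: "g \<in> L2_circle"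
  shows "\<exists>!v. K_graph h f u v g"
proof -
  let ?\<Phi> = "\<lambda>v. L_inv h (\<lambda>x. g x - M_op h f u v x)"
  note L2 = L2_circle_diff[OF g M_op_L2[OF cont(2)]]
  have "\<exists>!v. ?\<Phi> v = v"
  proof (rule banach_fix_type[where c = "1/2"])
    show "\<forall>v w. dist (?\<Phi> v) (?\<Phi> w) \<le> 1 / 2 * dist v w"
    proof (intro allI)
      fix v w :: h1
      define s where "s = h\<^sup>2 / 6 * F * (S * norm (v - w))"
      have eq: "?\<Phi> v - ?\<Phi> w = L_inv h (M_op h f u (w - v))"
      proof -
        have "(\<lambda>x. (g x - M_op h f u v x) - (g x - M_op h f u w x)) = M_op h f u (w - v)"
          by (rule ext) (simp flip: M_op_diff)
        then show ?thesis unfolding L_inv_diff[OF h_nonzero L2 L2] by simp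
      qed
      have "norm_H1h h (L_inv h (M_op h f u (w - v))) \<le> s"
      proof (rule norm_H1h_L_inv[OF h_nonzero M_op_continuous[OF cont(2)] M_op_periodic])
        fix x
        have "h\<^sup>2 / 6 * F * \<bar>h1_fun (w - v) x\<bar> \<le> h\<^sup>2 / 6 * F * (S * norm (w - v))"
          using F_nonneg by (intro mult_left_mono h1_sup_bound) auto
        then show "\<bar>M_op h f u (w - v) x\<bar> \<le> s"
          using M_op_le[OF u, of "w - v" x] by (simp add: s_def norm_minus_commute)
      qed
      then have "h * norm (?\<Phi> v - ?\<Phi> w) \<le> 3 * s"
        using norm_le_norm_H1h[OF h_pos h_le_1, of "?\<Phi> v - ?\<Phi> w"] unfolding eq by simp
      also have "3 * s = h * ((h * F * S) * (norm (v - w) / 2))"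
        by (simp add: s_def power2_eq_square)
      also have "\<dots> \<le> h * (1 * (norm (v - w) / 2))"
        using h_pos by (intro mult_left_mono mult_right_mono h_small) auto
      finally show "dist (?\<Phi> v) (?\<Phi> w) \<le> 1 / 2 * dist v w"
        using h_pos by (simp add: dist_norm)
    qed
  qed auto
  then show ?thesis
    unfolding K_graph_iff[OF h_pos cont(2) g] by metis
qed

lemma K_invertible: "norm u \<le> R \<Longrightarrow> K_invertible h f u"
  unfolding K_invertible_def using ex1_K_graph by blast

lemma K_inv_eq:
  assumes "norm u \<le> R" "g \<in> L2_circle"
  shows "K_inv h f u g = L_inv h (\<lambda>x. g x - M_op h f u (K_inv h f u g) x)"
  using theI'[OF ex1_K_graph[OF assms]]
  unfolding K_graph_iff[OF h_pos cont(2) assms(2)] K_inv_def .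

text \<open>In \<open>K(u)\<^sup>-\<^sup>1 g = L\<^sup>-\<^sup>1 (g - M(u) K(u)\<^sup>-\<^sup>1 g)\<close> the term with \<open>M(u)\<close> has at most half the norm of the left
  hand side and is absorbed there.\<close>

lemma norm_K_inv:
  assumes u: "norm u \<le> R" and g: "continuous_on UNIV g" "periodic g" "\<And>x. \<bar>g x\<bar> \<le> \<gamma>"
  shows "norm_H1h h (K_inv h f u g) \<le> 2 * \<gamma>"
proof -
  let ?v = "K_inv h f u g"
  have "norm_H1h h ?v \<le> \<gamma> + norm_H1h h ?v / 2"
  proof (subst (1) K_inv_eq[OF u continuous_L2_circle[OF g(1,2)]], rule norm_H1h_L_inv[OF h_nonzero])
    show "continuous_on UNIV (\<lambda>x. g x - M_op h f u ?v x)"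
      by (intro continuous_on_diff g M_op_continuous cont)
    show "periodic (\<lambda>x. g x - M_op h f u ?v x)"
      using g(2) M_op_periodic[of h f u ?v] by (simp add: periodic_def)
    show "\<bar>g x - M_op h f u ?v x\<bar> \<le> \<gamma> + norm_H1h h ?v / 2" for x
      using g(3)[of x] M_op_le_half[OF u, of ?v x] by linarith
  qed
  then show ?thesis by simp
qed

text \<open>The difference of \<open>v = K(u)\<^sup>-\<^sup>1 g\<close> and \<open>v' = K(u')\<^sup>-\<^sup>1 g'\<close> satisfies
  \<open>K(u) (v - v') = (g - g') - (M(u) - M(u')) v'\<close>, so absorption works again.\<close>

lemma K_inv_lipschitz:
  assumes u: "norm u \<le> R" "norm u' \<le> R"
    and g: "continuous_on UNIV g" "periodic g" and g': "continuous_on UNIV g'" "periodic g'"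
    and \<gamma>: "\<And>x. \<bar>g' x\<bar> \<le> \<gamma>" and \<delta>: "\<And>x. \<bar>g x - g' x\<bar> \<le> \<delta>"
  shows "norm_H1h h (K_inv h f u g - K_inv h f u' g') \<le> 2 * (\<delta> + S * \<gamma> * norm (u - u'))"
proof -
  define v where "v = K_inv h f u g"
  define v' where "v' = K_inv h f u' g'"
  have v: "v = L_inv h (\<lambda>x. g x - M_op h f u v x)"
    unfolding v_def by (rule K_inv_eq[OF u(1) continuous_L2_circle[OF g]])
  have v': "v' = L_inv h (\<lambda>x. g' x - M_op h f u' v' x)"
    unfolding v'_def by (rule K_inv_eq[OF u(2) continuous_L2_circle[OF g']])
  note L2 = L2_circle_diff[OF continuous_L2_circle[OF g] M_op_L2[OF cont(2)]]
  note L2' = L2_circle_diff[OF continuous_L2_circle[OF g'] M_op_L2[OF cont(2)]]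
  let ?G = "\<lambda>x. (g x - M_op h f u v x) - (g' x - M_op h f u' v' x)"
  have eq: "v - v' = L_inv h ?G"
    unfolding L_inv_diff[OF h_nonzero L2 L2', symmetric] using v v' by (rule arg_cong2)
  have "norm_H1h h (v - v') \<le> \<delta> + norm_H1h h (v - v') / 2 + S * \<gamma> * norm (u - u')"
  proof (subst (1) eq, rule norm_H1h_L_inv[OF h_nonzero])
    show "continuous_on UNIV ?G"
      by (intro continuous_on_diff g g' M_op_continuous cont)
    show "periodic ?G"
      using g(2) g'(2) M_op_periodic[of h f u v] M_op_periodic[of h f u' v'] by (simp add: periodic_def)
    fix x
    have split: "?G x = (g x - g' x) - M_op h f u (v - v') x - (M_op h f u v' x - M_op h f u' v' x)"
      by (simp flip: M_op_diff)
    have "\<bar>M_op h f u v' x - M_op h f u' v' x\<bar>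
        = h\<^sup>2 / 6 * (\<bar>deriv f (h1_fun u x) - deriv f (h1_fun u' x)\<bar> * \<bar>h1_fun v' x\<bar>)"
    proof -
      have "M_op h f u v' x - M_op h f u' v' x
          = - (h\<^sup>2 / 6 * ((deriv f (h1_fun u x) - deriv f (h1_fun u' x)) * h1_fun v' x))"
        by (simp add: M_op_def algebra_simps)
      then show ?thesis by (simp add: abs_mult)
    qed
    also have "\<dots> \<le> h\<^sup>2 / 6 * ((F * (S * norm (u - u'))) * \<bar>h1_fun v' x\<bar>)"
      by (intro mult_left_mono mult_right_mono lip_compose u) auto
    also have "\<dots> = S * norm (u - u') * (h\<^sup>2 / 6 * F * \<bar>h1_fun v' x\<bar>)" by (simp add: mult_ac)
    also have "\<dots> \<le> S * norm (u - u') * (norm_H1h h v' / 2)"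
      using sobolev_const_nonneg
      by (intro mult_left_mono half_bound H1h_sup_bound h_pos h_le_1 norm_H1h_nonneg) auto
    also have "\<dots> \<le> S * norm (u - u') * \<gamma>"
      using norm_K_inv[OF u(2) g' \<gamma>] sobolev_const_nonneg
      by (intro mult_left_mono) (auto simp: v'_def)
    finally have "\<bar>M_op h f u v' x - M_op h f u' v' x\<bar> \<le> S * \<gamma> * norm (u - u')" by (simp add: mult_ac)
    then show "\<bar>?G x\<bar> \<le> \<delta> + norm_H1h h (v - v') / 2 + S * \<gamma> * norm (u - u')"
      using \<delta>[of x] M_op_le_half[OF u(1), of "v - v'" x] unfolding split by linarith
  qed
  then show ?thesis by (simp add: v_def v'_def)
qed

section \<open>The nonlinearity\<close>

text \<open>The function to which \<open>K(u)\<^sup>-\<^sup>1\<close> is applied in the second component of \<open>B\<close>.\<close>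

definition rhs :: "h1 \<times> h1 \<Rightarrow> real \<Rightarrow> real" where
  "rhs U x = - M_op h f (fst U) (Linv_dxx h (fst U)) x + f (h1_fun (fst U) x)
    + h\<^sup>2 / 12 * deriv (deriv f) (h1_fun (fst U) x) * (h1_fun (snd U) x)\<^sup>2"

lemma B_op_eq: "B_op h f U = (0, K_inv h f (fst U) (rhs U))"
  by (simp add: B_op_def rhs_def[abs_def] Let_def)

lemma rhs_continuous: "continuous_on UNIV (rhs U)"
  unfolding rhs_def[abs_def]
  by (intro continuous_intros M_op_continuous continuous_compose_h1 cont h1_continuous)

lemma rhs_periodic: "periodic (rhs U)"
  using M_op_periodic[of h f "fst U" "Linv_dxx h (fst U)"]
  by (simp add: periodic_def rhs_def h1_fun_periodic)

text \<open>In terms of \<open>a = (h\<^sup>2/6) L\<^sup>-\<^sup>1 \<partial>\<^sub>x\<^sub>x u\<close> and \<open>q = h p\<close>, which are bounded uniformly in \<open>h\<close>, the right hand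
  side no longer contains \<open>h\<close>.\<close>

lemma rhs_rescaled:
  "rhs U x = deriv f (h1_fun (fst U) x) * (h\<^sup>2 / 6 * h1_fun (Linv_dxx h (fst U)) x) + f (h1_fun (fst U) x)
    + deriv (deriv f) (h1_fun (fst U) x) * (h * h1_fun (snd U) x)\<^sup>2 / 12"
  by (simp add: rhs_def M_op_def power_mult_distrib mult_ac)

lemma Linv_dxx_sup: "\<bar>h\<^sup>2 / 6 * h1_fun (Linv_dxx h u) x\<bar> \<le> S * norm u"
proof -
  have "h\<^sup>2 / 6 * \<bar>h1_fun (Linv_dxx h u) x\<bar> \<le> h\<^sup>2 / 6 * (S * (6 / h\<^sup>2 * norm u))"
    using h1_sup_bound[of "Linv_dxx h u" x] mult_left_mono[OF norm_Linv_dxx[OF h_nonzero, of u] sobolev_const_nonneg]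
    by (intro mult_left_mono) auto
  then show ?thesis using h_nonzero by (simp add: abs_mult)
qed

lemma Linv_dxx_sup_diff:
  "\<bar>h\<^sup>2 / 6 * h1_fun (Linv_dxx h u) x - h\<^sup>2 / 6 * h1_fun (Linv_dxx h w) x\<bar> \<le> S * norm (u - w)"
  using Linv_dxx_sup[of "u - w" x]
  by (simp add: linear_diff[OF bounded_linear.linear[OF bounded_linear_Linv_dxx[OF h_nonzero]]]
      h1_fun_diff right_diff_distrib)

lemma p_sup: "\<bar>h * h1_fun p x\<bar> \<le> 3 * S * norm_H1h h p"
  using H1h_sup_bound[OF h_pos h_le_1, of p x] h_pos by (simp add: abs_mult)

lemma p_sup_diff: "\<bar>h * h1_fun p x - h * h1_fun q x\<bar> \<le> 3 * S * norm_H1h h (p - q)"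
  using p_sup[of "p - q" x] by (simp add: h1_fun_diff right_diff_distrib)

lemma rhs_le:
  assumes U: "norm_H1_H1h h U \<le> R"
  shows "\<bar>rhs U x\<bar> \<le> F * (1 + S * R)\<^sup>2"
proof -
  let ?u = "fst U" and ?p = "snd U"
  let ?a = "h\<^sup>2 / 6 * h1_fun (Linv_dxx h ?u) x" and ?q = "h * h1_fun ?p x"
  have u: "norm ?u \<le> R" and p: "norm_H1h h ?p \<le> R"
    using norm_H1_H1h_components(1)[of U h] norm_H1_H1h_components(2)[of h U] U by linarith+
  have a: "\<bar>?a\<bar> \<le> S * R"
    using Linv_dxx_sup[of ?u x] mult_left_mono[OF u sobolev_const_nonneg] by linarith
  have q: "\<bar>?q\<bar> \<le> 3 * (S * R)"
    using p_sup[of ?p x] mult_left_mono[OF p, of "3 * S"] sobolev_const_nonneg by linarith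
  have SR: "S * R \<ge> 0" using sobolev_const_nonneg R_nonneg by simp
  have 1: "\<bar>deriv f (h1_fun ?u x) * ?a\<bar> \<le> F * (S * R)"
    unfolding abs_mult[of _ ?a] by (intro mult_mono bound(2) sup_le u a F_nonneg) auto
  have 2: "\<bar>f (h1_fun ?u x)\<bar> \<le> F" by (intro bound(1) sup_le u)
  have "?q\<^sup>2 \<le> (3 * (S * R))\<^sup>2" using power_mono[OF q, of 2] by simp
  then have 3: "\<bar>deriv (deriv f) (h1_fun ?u x) * ?q\<^sup>2\<bar> \<le> F * (3 * (S * R))\<^sup>2"
    unfolding abs_mult[of _ "?q\<^sup>2"] abs_power2
    by (intro mult_mono bound(3) sup_le u F_nonneg) auto
  have "\<bar>rhs U x\<bar> \<le> F * (S * R) + F + F * (3 * (S * R))\<^sup>2 / 12"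
    unfolding rhs_rescaled using 1 2 3 by linarith
  also have "\<dots> = F * (1 + S * R + 3 / 4 * (S * R)\<^sup>2)"
    by (simp add: field_simps power2_eq_square)
  also have "\<dots> \<le> F * (1 + S * R)\<^sup>2"
  proof (rule mult_left_mono[OF _ F_nonneg])
    have "(1 + S * R)\<^sup>2 = 1 + 2 * (S * R) + (S * R)\<^sup>2" by (simp add: power2_sum)
    then show "1 + S * R + 3 / 4 * (S * R)\<^sup>2 \<le> (1 + S * R)\<^sup>2"
      using SR zero_le_power2[of "S * R"] by linarith
  qed
  finally show ?thesis .
qed

lemma rhs_lipschitz:
  assumes U: "norm_H1_H1h h U \<le> R" and W: "norm_H1_H1h h W \<le> R"
  shows "\<bar>rhs U x - rhs W x\<bar> \<le> 2 * F * S * (1 + S * R)\<^sup>2 * norm_H1_H1h h (U - W)"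
proof -
  let ?d = "norm_H1_H1h h (U - W)"
  let ?u = "fst U" and ?p = "snd U" and ?w = "fst W" and ?r = "snd W"
  let ?a = "\<lambda>u. h\<^sup>2 / 6 * h1_fun (Linv_dxx h u) x" and ?q = "\<lambda>p. h * h1_fun p x"
  have u: "norm ?u \<le> R" and w: "norm ?w \<le> R" and p: "norm_H1h h ?p \<le> R" and r: "norm_H1h h ?r \<le> R"
    and uw: "norm (?u - ?w) \<le> ?d" and pr: "norm_H1h h (?p - ?r) \<le> ?d"
    using norm_H1_H1h_components(1)[of U h] norm_H1_H1h_components(1)[of W h]
      norm_H1_H1h_components(1)[of "U - W" h] norm_H1_H1h_components(2)[of h U]
      norm_H1_H1h_components(2)[of h W] norm_H1_H1h_components(2)[of h "U - W"] U W
    by simp_all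
  have d: "?d \<ge> 0" using uw norm_ge_zero[of "?u - ?w"] by linarith
  have SR: "S * R \<ge> 0" using sobolev_const_nonneg R_nonneg by simp
  have Sd: "S * norm (?u - ?w) \<le> S * ?d" by (intro mult_left_mono uw sobolev_const_nonneg)
  have lipd: "\<bar>\<phi> (h1_fun ?u x) - \<phi> (h1_fun ?w x)\<bar> \<le> F * (S * ?d)" if "\<phi> \<in> {f, deriv f, deriv (deriv f)}" for \<phi>
    using lip_compose[OF u w that, of x] mult_left_mono[OF Sd F_nonneg] by linarith
  have a: "\<bar>?a ?u\<bar> \<le> S * R"
    using Linv_dxx_sup[of ?u x] mult_left_mono[OF u sobolev_const_nonneg] by linarith
  have da: "\<bar>?a ?u - ?a ?w\<bar> \<le> S * ?d" using Linv_dxx_sup_diff[of ?u x ?w] Sd by linarith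
  have q: "\<bar>?q ?p\<bar> \<le> 3 * (S * R)"
    using p_sup[of ?p x] mult_left_mono[OF p, of "3 * S"] sobolev_const_nonneg by linarith
  have q': "\<bar>?q ?r\<bar> \<le> 3 * (S * R)"
    using p_sup[of ?r x] mult_left_mono[OF r, of "3 * S"] sobolev_const_nonneg by linarith
  have dq: "\<bar>?q ?p - ?q ?r\<bar> \<le> 3 * (S * ?d)"
    using p_sup_diff[of ?p x ?r] mult_left_mono[OF pr, of "3 * S"] sobolev_const_nonneg by linarith
  have q2: "\<bar>(?q ?p)\<^sup>2\<bar> \<le> (3 * (S * R))\<^sup>2" using power_mono[OF q, of 2] by simp
  have dq2: "\<bar>(?q ?p)\<^sup>2 - (?q ?r)\<^sup>2\<bar> \<le> 3 * (S * ?d) * (3 * (S * R)) + 3 * (S * R) * (3 * (S * ?d))"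
    unfolding power2_eq_square by (rule mult_diff_le[OF dq q q' dq])
  have 1: "\<bar>deriv f (h1_fun ?u x) * ?a ?u - deriv f (h1_fun ?w x) * ?a ?w\<bar> \<le> F * (S * ?d) * (S * R) + F * (S * ?d)"
    by (rule mult_diff_le[OF lipd[of "deriv f"] a bound(2)[OF sup_le[OF w]] da]) simp
  have 2: "\<bar>f (h1_fun ?u x) - f (h1_fun ?w x)\<bar> \<le> F * (S * ?d)"
    by (rule lipd) simp
  have 3: "\<bar>deriv (deriv f) (h1_fun ?u x) * (?q ?p)\<^sup>2 - deriv (deriv f) (h1_fun ?w x) * (?q ?r)\<^sup>2\<bar>
      \<le> F * (S * ?d) * (3 * (S * R))\<^sup>2 + F * (3 * (S * ?d) * (3 * (S * R)) + 3 * (S * R) * (3 * (S * ?d)))"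
    by (rule mult_diff_le[OF lipd[of "deriv (deriv f)"] q2 bound(3)[OF sup_le[OF w]] dq2]) simp
  have "\<bar>rhs U x - rhs W x\<bar> \<le> (F * (S * ?d) * (S * R) + F * (S * ?d)) + F * (S * ?d)
      + (F * (S * ?d) * (3 * (S * R))\<^sup>2 + F * (3 * (S * ?d) * (3 * (S * R)) + 3 * (S * R) * (3 * (S * ?d)))) / 12"
  proof -
    have "\<bar>(a + b + c / 12) - (a' + b' + c' / 12)\<bar> \<le> A + B + C / 12"
      if "\<bar>a - a'\<bar> \<le> A" "\<bar>b - b'\<bar> \<le> B" "\<bar>c - c'\<bar> \<le> C" for a b c a' b' c' A B C :: real
      using that by linarith
    from this[OF 1 2 3] show ?thesis unfolding rhs_rescaled .
  qed
  also have "\<dots> = F * S * ?d * (2 + 5 / 2 * (S * R) + 3 / 4 * (S * R)\<^sup>2)"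
    by (simp add: field_simps power2_eq_square)
  also have "\<dots> \<le> F * S * ?d * (2 * (1 + S * R)\<^sup>2)"
  proof (rule mult_left_mono)
    have "2 * (1 + S * R)\<^sup>2 = 2 + 4 * (S * R) + 2 * (S * R)\<^sup>2" by (simp add: power2_sum)
    then show "2 + 5 / 2 * (S * R) + 3 / 4 * (S * R)\<^sup>2 \<le> 2 * (1 + S * R)\<^sup>2"
      using SR zero_le_power2[of "S * R"] by linarith
    show "0 \<le> F * S * ?d" using sobolev_const_nonneg F_nonneg d by simp
  qed
  finally show ?thesis by (simp add: mult_ac)
qed

lemma norm_B_op:
  assumes U: "norm_H1_H1h h U \<le> R"
  shows "norm_H1_H1h h (B_op h f U) \<le> 2 * (F * (1 + S * R)\<^sup>2)"
  unfolding B_op_eq norm_H1_H1h_snd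
  by (rule norm_K_inv[OF _ rhs_continuous rhs_periodic rhs_le[OF U]])
    (use norm_H1_H1h_components(1)[of U h] U in linarith)

lemma B_op_lipschitz:
  assumes U: "norm_H1_H1h h U \<le> R" and W: "norm_H1_H1h h W \<le> R"
  shows "norm_H1_H1h h (B_op h f U - B_op h f W) \<le> 6 * F * S * (1 + S * R)\<^sup>2 * norm_H1_H1h h (U - W)"
proof -
  let ?d = "norm_H1_H1h h (U - W)" and ?c = "F * (1 + S * R)\<^sup>2"
  have u: "norm (fst U) \<le> R" and w: "norm (fst W) \<le> R" and uw: "norm (fst U - fst W) \<le> ?d"
    using norm_H1_H1h_components(1)[of U h] norm_H1_H1h_components(1)[of W h]
      norm_H1_H1h_components(1)[of "U - W" h] U W by simp_all
  have "norm_H1_H1h h (B_op h f U - B_op h f W) \<le> 2 * (2 * F * S * (1 + S * R)\<^sup>2 * ?d + S * ?c * norm (fst U - fst W))"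
    unfolding B_op_eq diff_Pair diff_self norm_H1_H1h_snd
    by (rule K_inv_lipschitz[OF u w rhs_continuous rhs_periodic rhs_continuous rhs_periodic rhs_le[OF W] rhs_lipschitz[OF U W]])
  also have "\<dots> \<le> 2 * (2 * F * S * (1 + S * R)\<^sup>2 * ?d + S * ?c * ?d)"
    using sobolev_const_nonneg F_nonneg by (intro mult_left_mono add_left_mono uw) auto
  finally show ?thesis by (simp add: algebra_simps)
qed

end

section \<open>Mild solutions\<close>

text \<open>The triangle inequality for integrals holds in any equivalent norm with its own constant, since it
  holds for Riemann sums.\<close>

lemma (in equivalent_norm) has_integral_bound:
  fixes g :: "real \<Rightarrow> 'a"
  assumes g: "(g has_integral y) {a..b}" and ab: "a \<le> b" and \<beta>: "\<And>s. s \<in> {a..b} \<Longrightarrow> N (g s) \<le> \<beta>"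
  shows "N y \<le> \<beta> * (b - a)"
proof (rule field_le_epsilon)
  fix e :: real assume "e > 0"
  then have "e / (c + 1) > 0" using c_nonneg by simp
  moreover have "(g has_integral y) (cbox a b)" using g by simp
  ultimately obtain \<gamma> where \<gamma>: "gauge \<gamma>"
    and fine: "\<And>D. D tagged_division_of (cbox a b) \<Longrightarrow> \<gamma> fine D \<Longrightarrow> norm ((\<Sum>(x,k)\<in>D. measure lborel k *\<^sub>R g x) - y) < e / (c + 1)"
    unfolding has_integral by meson
  obtain D where D: "D tagged_division_of (cbox a b)" "\<gamma> fine D"
    using fine_division_exists[OF \<gamma>] .
  let ?S = "\<Sum>(x,k)\<in>D. measure lborel k *\<^sub>R g x"
  have "N ?S \<le> (\<Sum>z\<in>D. N (case z of (x, k) \<Rightarrow> measure lborel k *\<^sub>R g x))" by (rule sum_le)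
  also have "\<dots> \<le> (\<Sum>z\<in>D. (case z of (x, k) \<Rightarrow> measure lborel k) * \<beta>)"
  proof (rule sum_mono)
    fix z assume "z \<in> D"
    then obtain x k where z: "z = (x, k)" "(x, k) \<in> D" by (cases z) auto
    then have "x \<in> {a..b}" using tag_in_interval[OF D(1)] by auto
    then show "N (case z of (x, k) \<Rightarrow> measure lborel k *\<^sub>R g x) \<le> (case z of (x, k) \<Rightarrow> measure lborel k) * \<beta>"
      using mult_left_mono[OF \<beta>, of x "measure lborel k"] by (simp add: z scaleR)
  qed
  also have "\<dots> = measure lborel (cbox a b) * \<beta>"
    by (simp only: sum_distrib_right[symmetric] additive_content_tagged_division[OF D(1)])
  finally have S: "N ?S \<le> \<beta> * (b - a)" using ab by (simp add: mult.commute)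
  have "N (y - ?S) \<le> c * norm (?S - y)" using upper[of "y - ?S"] by (simp add: norm_minus_commute)
  also have "\<dots> \<le> c * (e / (c + 1))" using fine[OF D] c_nonneg by (intro mult_left_mono) auto
  also have "\<dots> \<le> e" using \<open>e > 0\<close> c_nonneg by (simp add: field_simps)
  finally show "N y \<le> \<beta> * (b - a) + e" using triangle[of "y - ?S" ?S] S by simp
qed

text \<open>The life span. The factors \<open>2\<close> in front of \<open>\<beta>\<close>, the bound for \<open>B\<close>, and \<open>\<Lambda>\<close>, its Lipschitz constant,
  stand for \<open>e\<^bsup>1/2\<^esup> \<le> 2\<close>, the growth of the linear evolution over a time \<open>T \<le> 1\<close>; this is also why \<open>R\<close> has to
  exceed \<open>2 C\<close>.\<close>

locale picard = small_step +
  fixes C T \<beta> \<Lambda> :: real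
  assumes T_pos: "T > 0" and T_le_1: "T \<le> 1" and C_nonneg: "C \<ge> 0" and R_def: "R = 2 * C + 2"
    and \<beta>_def: "\<beta> = 2 * (F * (1 + sobolev_const * R)\<^sup>2)"
    and \<Lambda>_def: "\<Lambda> = 6 * F * sobolev_const * (1 + sobolev_const * R)\<^sup>2"
    and T_\<beta>: "2 * \<beta> * T \<le> 1" and T_\<Lambda>: "2 * \<Lambda> * T \<le> 1 / 2"
begin

abbreviation "N \<equiv> norm_H1_H1h h"
abbreviation "E \<equiv> exp_A h"
abbreviation "B \<equiv> B_op h f"

sublocale equivalent_norm N "sqrt (1 + h\<^sup>2 / 6)" "sqrt (1 + 6 / h\<^sup>2)"
  by (rule equivalent_norm_H1_H1h[OF h_pos])

lemma \<beta>_nonneg: "\<beta> \<ge> 0" and \<Lambda>_nonneg: "\<Lambda> \<ge> 0"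
  using F_nonneg sobolev_const_nonneg by (simp_all add: \<beta>_def \<Lambda>_def)

lemma N_B_le: "N U \<le> R \<Longrightarrow> N (B U) \<le> \<beta>"
  unfolding \<beta>_def by (rule norm_B_op)

lemma N_B_lipschitz: "N U \<le> R \<Longrightarrow> N W \<le> R \<Longrightarrow> N (B U - B W) \<le> \<Lambda> * N (U - W)"
  unfolding \<Lambda>_def by (rule B_op_lipschitz)

lemma N_E_le:
  assumes "0 \<le> t" "t \<le> T"
  shows "N (E t U) \<le> 2 * N U"
proof -
  have "exp (t / 2) \<le> exp (1 / 2)" using assms T_le_1 by simp
  also have "\<dots> \<le> (2 :: real)" by (rule exp_half_le2)
  finally have "exp (t / 2) * N U \<le> 2 * N U" by (rule mult_right_mono) (rule nonneg)
  then show ?thesis using norm_exp_A_le[OF h_pos assms(1), of U] by linarith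
qed

lemma N_convolution_le:
  assumes "((\<lambda>s. E (t - s) (G s)) has_integral y) {0..t}" "0 \<le> t" "t \<le> T"
    and "\<And>s. s \<in> {0..t} \<Longrightarrow> N (G s) \<le> b"
  shows "N y \<le> 2 * b * T"
proof -
  have b: "b \<ge> 0" using assms(4)[of 0] nonneg[of "G 0"] assms(2) by simp
  have "N y \<le> (2 * b) * (t - 0)"
  proof (rule has_integral_bound[OF assms(1,2)])
    fix s assume s: "s \<in> {0..t}"
    then have "N (E (t - s) (G s)) \<le> 2 * N (G s)" using assms(3) by (intro N_E_le) auto
    then show "N (E (t - s) (G s)) \<le> 2 * b" using assms(4)[OF s] by linarith
  qed
  also have "\<dots> \<le> 2 * b * T" using b assms(3) by (simp add: mult_left_mono)
  finally show ?thesis .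
qed

text \<open>The two estimates behind the contraction argument. As long as a function stays in the ball of radius
  \<open>R = 2 C + 2\<close>, the Duhamel formula puts it into the smaller ball of radius \<open>2 C + 1\<close>, and its
  dependence on the function halves distances.\<close>

lemma Duhamel_bound:
  assumes "((\<lambda>s. E (t - s) (B (U s))) has_integral y) {0..t}" "0 \<le> t" "t \<le> T"
    and "\<And>s. s \<in> {0..t} \<Longrightarrow> N (U s) \<le> R" and "N U0 \<le> C"
  shows "N (E t U0 + y) \<le> 2 * C + 1"
proof -
  have "N y \<le> 2 * \<beta> * T"
    by (rule N_convolution_le[OF assms(1-3) N_B_le[OF assms(4)]])
  moreover have "N (E t U0) \<le> 2 * N U0" by (rule N_E_le[OF assms(2,3)])
  ultimately show ?thesis using triangle[of "E t U0" y] assms(5) T_\<beta> by linarith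
qed

lemma Duhamel_contraction:
  assumes y: "((\<lambda>s. E (t - s) (B (U s))) has_integral y) {0..t}"
    and z: "((\<lambda>s. E (t - s) (B (W s))) has_integral z) {0..t}" and t: "0 \<le> t" "t \<le> T"
    and U: "\<And>s. s \<in> {0..t} \<Longrightarrow> N (U s) \<le> R" and W: "\<And>s. s \<in> {0..t} \<Longrightarrow> N (W s) \<le> R"
    and d: "\<And>s. s \<in> {0..t} \<Longrightarrow> N (U s - W s) \<le> d"
  shows "N (y - z) \<le> d / 2"
proof -
  have "((\<lambda>s. E (t - s) (B (U s) - B (W s))) has_integral (y - z)) {0..t}"
    unfolding exp_A_diff[OF h_nonzero] by (rule has_integral_diff[OF y z])
  then have "N (y - z) \<le> 2 * (\<Lambda> * d) * T"
  proof (rule N_convolution_le[OF _ t])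
    fix s assume s: "s \<in> {0..t}"
    show "N (B (U s) - B (W s)) \<le> \<Lambda> * d"
      using N_B_lipschitz[OF U[OF s] W[OF s]] mult_left_mono[OF d[OF s] \<Lambda>_nonneg] by linarith
  qed
  also have "\<dots> = (2 * \<Lambda> * T) * d" by simp
  also have "\<dots> \<le> 1 / 2 * d"
    using d[of 0] nonneg[of "U 0 - W 0"] t by (intro mult_right_mono T_\<Lambda>) auto
  finally show ?thesis by simp
qed

definition paths :: "(real \<Rightarrow> h1 \<times> h1) set" where
  "paths = {U. continuous_on {0..T} U \<and> (\<forall>t\<in>{0..T}. N (U t) \<le> R)}"

lemma continuous_on_B: "continuous_on {U. N U \<le> R} B"
proof (rule lipschitz_on_continuous_on)
  let ?c = "sqrt (1 + h\<^sup>2 / 6)" and ?c' = "sqrt (1 + 6 / h\<^sup>2)"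
  show "(?c' * (\<Lambda> * ?c))-lipschitz_on {U. N U \<le> R} B"
  proof (rule lipschitz_onI)
    fix U W assume UW: "U \<in> {U. N U \<le> R}" "W \<in> {U. N U \<le> R}"
    have "norm (B U - B W) \<le> ?c' * N (B U - B W)" by (rule lower)
    also have "\<dots> \<le> ?c' * (\<Lambda> * N (U - W))"
      using UW by (intro mult_left_mono N_B_lipschitz c'_nonneg) auto
    also have "\<dots> \<le> ?c' * (\<Lambda> * (?c * norm (U - W)))"
      by (intro mult_left_mono upper c'_nonneg \<Lambda>_nonneg)
    finally show "dist (B U) (B W) \<le> ?c' * (\<Lambda> * ?c) * dist U W" by (simp add: dist_norm mult.assoc)
  qed (intro mult_nonneg_nonneg c_nonneg c'_nonneg \<Lambda>_nonneg)
qed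

lemma continuous_on_B_path: "U \<in> paths \<Longrightarrow> continuous_on {0..T} (\<lambda>s. B (U s))"
  by (rule continuous_on_compose2[OF continuous_on_B]) (auto simp: paths_def)

definition Duhamel :: "h1 \<times> h1 \<Rightarrow> (real \<Rightarrow> h1 \<times> h1) \<Rightarrow> real \<Rightarrow> h1 \<times> h1" where
  "Duhamel U0 U t = E t U0 + integral {0..t} (\<lambda>s. E (t - s) (B (U s)))"

lemma Duhamel_integral:
  assumes "U \<in> paths" "t \<in> {0..T}"
  shows "((\<lambda>s. E (t - s) (B (U s))) has_integral (Duhamel U0 U t - E t U0)) {0..t}"
proof -
  have "continuous_on {0..t} (\<lambda>s. E (t - s) (B (U s)))"
    using assms(2)
    by (intro continuous_on_exp_A h_nonzero continuous_intros continuous_on_subset[OF continuous_on_B_path[OF assms(1)]]) auto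
  then show ?thesis by (simp add: Duhamel_def integrable_continuous_real integrable_integral)
qed

text \<open>Extending \<open>e\<^bsup>(t - s)A\<^esup>\<close> by the identity to \<open>s > t\<close> moves the variable \<open>t\<close> out of the upper limit of
  the integral.\<close>

lemma continuous_on_Duhamel:
  assumes U: "U \<in> paths"
  shows "continuous_on {0..T} (Duhamel U0 U)"
proof -
  define g where "g s = B (U s)" for s
  define H where "H t s = E (max 0 (t - s)) (g s) - g s" for t s
  have g: "continuous_on {0..T} g" using continuous_on_B_path[OF U] by (simp add: g_def[abs_def])
  have H2: "continuous_on ({0..T} \<times> cbox 0 T) (\<lambda>(t, s). H t s)"
  proof -
    have g2: "continuous_on ({0..T} \<times> cbox 0 T) (\<lambda>z. g (snd z))"
      by (rule continuous_on_compose2[OF g]) (auto intro!: continuous_intros)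
    have "continuous_on ({0..T} \<times> cbox 0 T) (\<lambda>z. E (max 0 (fst z - snd z)) (g (snd z)) - g (snd z))"
      by (intro continuous_on_diff continuous_on_exp_A g2 h_nonzero compact_Times compact_Icc compact_cbox
          continuous_on_max continuous_intros)
    then show ?thesis by (simp add: H_def case_prod_unfold)
  qed
  have H1: "continuous_on {0..T} (H t)" if t: "t \<in> {0..T}" for t
  proof -
    have "continuous_on {0..T} (\<lambda>s. (\<lambda>(t, s). H t s) (t, s))"
      by (rule continuous_on_compose2[OF H2]) (use t in \<open>auto intro!: continuous_intros\<close>)
    then show ?thesis by simp
  qed
  have eq: "Duhamel U0 U t = E t U0 + (integral {0..T} (H t) + integral {0..t} g)" if t: "t \<in> {0..T}" for t
  proof -
    have gt: "g integrable_on {0..t}"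
      by (rule integrable_continuous_real, rule continuous_on_subset[OF g]) (use t in auto)
    have "integral {0..T} (H t) = integral {0..t} (H t) + integral {t..T} (H t)"
      using t by (intro Henstock_Kurzweil_Integration.integral_combine[symmetric] integrable_continuous_real H1) auto
    also have "integral {t..T} (H t) = integral {t..T} (\<lambda>s. 0)"
      by (rule integral_cong) (simp add: H_def)
    also have "integral {0..t} (H t) = integral {0..t} (\<lambda>s. E (t - s) (B (U s)) - g s)"
      by (rule integral_cong) (simp add: H_def g_def)
    also have "\<dots> = integral {0..t} (\<lambda>s. E (t - s) (B (U s))) - integral {0..t} g"
      by (intro integral_diff gt has_integral_integrable[OF Duhamel_integral[OF U t]])
    finally show ?thesis by (simp add: Duhamel_def)
  qed
  have "continuous_on {0..T} (\<lambda>t. E t U0 + (integral (cbox 0 T) (H t) + integral {0..t} g))"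
    by (intro continuous_on_add continuous_on_exp_A h_nonzero compact_Icc continuous_on_id continuous_on_const
        integral_continuous_on_param H2 indefinite_integral_continuous_1 integrable_continuous_real g)
  then show ?thesis by (rule continuous_on_eq) (simp add: eq)
qed

lemma Duhamel_paths:
  assumes U: "U \<in> paths" and U0: "N U0 \<le> C"
  shows "Duhamel U0 U \<in> paths"
proof -
  have "N (Duhamel U0 U t) \<le> R" if t: "t \<in> {0..T}" for t
  proof -
    have "N (E t U0 + (Duhamel U0 U t - E t U0)) \<le> 2 * C + 1"
      by (rule Duhamel_bound[OF Duhamel_integral[OF U t] _ _ _ U0]) (use U t in \<open>auto simp: paths_def\<close>)
    then show ?thesis by (simp add: R_def)
  qed
  then show ?thesis by (simp add: paths_def continuous_on_Duhamel[OF U])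
qed

lemma Duhamel_lipschitz:
  assumes U: "U \<in> paths" and W: "W \<in> paths" and d: "\<And>s. s \<in> {0..T} \<Longrightarrow> N (U s - W s) \<le> d" and t: "t \<in> {0..T}"
  shows "N (Duhamel U0 U t - Duhamel U0 W t) \<le> d / 2"
proof -
  have "N ((Duhamel U0 U t - E t U0) - (Duhamel U0 W t - E t U0)) \<le> d / 2"
    by (rule Duhamel_contraction[OF Duhamel_integral[OF U t] Duhamel_integral[OF W t]])
      (use U W t d in \<open>auto simp: paths_def\<close>)
  then show ?thesis by simp
qed

text \<open>Picard iteration. The Duhamel map contracts distances measured by \<open>N\<close>; hence the increments of the
  iterates decay geometrically and their sum converges uniformly in time. The equivalence of the norms
  provides the limit; its \<open>h\<close>-dependent constants do not affect \<open>T\<close>.\<close>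

lemma ex_Duhamel_fixed_point:
  assumes U0: "N U0 \<le> C"
  shows "\<exists>U\<in>paths. \<forall>t\<in>{0..T}. Duhamel U0 U t = U t"
proof -
  let ?c = "sqrt (1 + h\<^sup>2 / 6)" and ?c' = "sqrt (1 + 6 / h\<^sup>2)"
  define X where "X n = (Duhamel U0 ^^ n) (\<lambda>_. U0)" for n
  have X_Suc: "X (Suc n) = Duhamel U0 (X n)" for n by (simp add: X_def)
  have X: "X n \<in> paths" for n
  proof (induction n)
    case 0
    have "N U0 \<le> R" using U0 C_nonneg by (simp add: R_def)
    then show ?case by (simp add: X_def paths_def)
  next
    case (Suc n)
    then show ?case unfolding X_Suc by (rule Duhamel_paths[OF _ U0])
  qed
  have step: "N (X (Suc n) t - X n t) \<le> (1 / 2) ^ n * (2 * R)" if "t \<in> {0..T}" for n t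
    using that
  proof (induction n arbitrary: t)
    case 0
    have "N (X (Suc 0) t) \<le> R" "N (X 0 t) \<le> R" using X 0 by (auto simp: paths_def)
    then show ?case using triangle_diff[of "X (Suc 0) t" "X 0 t"] by simp
  next
    case (Suc n)
    have "N (X (Suc (Suc n)) t - X (Suc n) t) \<le> (1 / 2) ^ n * (2 * R) / 2"
      unfolding X_Suc[of "Suc n"] using Suc.IH Suc.prems
      by (subst (2) X_Suc) (rule Duhamel_lipschitz[OF X X])
    then show ?case by simp
  qed
  define U where "U t = U0 + (\<Sum>n. X (Suc n) t - X n t)" for t
  have "uniform_limit {0..T} (\<lambda>n t. \<Sum>i<n. X (Suc i) t - X i t) (\<lambda>t. \<Sum>n. X (Suc n) t - X n t) sequentially"
  proof (rule Weierstrass_m_test)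
    show "summable (\<lambda>n. ?c' * ((1 / 2) ^ n * (2 * R)))"
      by (intro summable_mult summable_mult2 summable_geometric) simp
    show "norm (X (Suc n) t - X n t) \<le> ?c' * ((1 / 2) ^ n * (2 * R))" if "t \<in> {0..T}" for n t
      using lower[of "X (Suc n) t - X n t"] mult_left_mono[OF step[OF that, of n] c'_nonneg] by linarith
  qed
  then have "uniform_limit {0..T} (\<lambda>n t. U0 + (\<Sum>i<n. X (Suc i) t - X i t)) U sequentially"
    unfolding U_def[abs_def] by (intro uniform_limit_add uniform_limit_const)
  moreover have "U0 + (\<Sum>i<n. X (Suc i) t - X i t) = X n t" for n t
    by (simp add: sum_lessThan_telescope[of "\<lambda>i. X i t"]) (simp add: X_def)
  ultimately have lim: "uniform_limit {0..T} X U sequentially" by simp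
  have cU: "continuous_on {0..T} U"
    by (rule uniform_limit_theorem[OF _ lim]) (use X in \<open>auto simp: paths_def\<close>)
  have "N (U t) \<le> R" if t: "t \<in> {0..T}" for t
  proof -
    have closed: "closed {x. N x \<le> R}"
      by (intro closed_Collect_le continuous_on continuous_on_id continuous_on_const)
    have "X n t \<in> {x. N x \<le> R}" for n using X[of n] t by (simp add: paths_def)
    from closed_sequentially[OF closed this tendsto_uniform_limitI[OF lim t]] show ?thesis by simp
  qed
  with cU have U: "U \<in> paths" by (simp add: paths_def)
  have "Duhamel U0 U t = U t" if t: "t \<in> {0..T}" for t
  proof -
    have "N (Duhamel U0 U t - U t) \<le> 0 + e" if e: "e > 0" for e
    proof -
      define r where "r = e / (2 * (?c + 1))"
      have c: "?c \<ge> 0" by (rule c_nonneg)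
      have pos: "2 * (?c + 1) > 0"
        by (rule mult_pos_pos[OF zero_less_numeral add_nonneg_pos[OF c zero_less_one]])
      then have "r > 0" using e unfolding r_def by (rule divide_pos_pos[rotated])
      have re: "r * (2 * (?c + 1)) = e"
        by (rule iffD1[OF nonzero_eq_divide_eq[OF less_imp_neq[OF pos, symmetric]] r_def])
      obtain n where n: "\<And>m s. m \<ge> n \<Longrightarrow> s \<in> {0..T} \<Longrightarrow> dist (X m s) (U s) < r"
        using uniform_limitD[OF lim \<open>r > 0\<close>] unfolding eventually_sequentially by blast
      have close: "N (X m s - U s) \<le> ?c * r" if "m \<ge> n" "s \<in> {0..T}" for m s
        using upper[of "X m s - U s"] mult_left_mono[of "norm (X m s - U s)" r ?c] n[OF that] c
        by (simp add: dist_norm)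
      have cr: "?c * r \<ge> 0" using c \<open>r > 0\<close> by simp
      have "N (Duhamel U0 (X n) t - Duhamel U0 U t) \<le> ?c * r / 2"
        by (rule Duhamel_lipschitz[OF X U close t]) auto
      moreover have "N (Duhamel U0 (X n) t - U t) \<le> ?c * r"
        using close[of "Suc n" t] t unfolding X_Suc by simp
      ultimately have "N (Duhamel U0 U t - U t) \<le> 2 * (?c * r)"
        using triangle_diff[of "Duhamel U0 (X n) t - U t" "Duhamel U0 (X n) t - Duhamel U0 U t"] cr by simp
      also have "\<dots> = r * (2 * (?c + 1)) - 2 * r" by (simp only: algebra_simps)
      finally show ?thesis using re \<open>r > 0\<close> by linarith
    qed
    then have "N (Duhamel U0 U t - U t) \<le> 0" by (rule field_le_epsilon)
    then have "norm (Duhamel U0 U t - U t) \<le> 0"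
      using lower[of "Duhamel U0 U t - U t"] mult_left_mono[of "N (Duhamel U0 U t - U t)" 0 ?c'] c'_nonneg by linarith
    then show ?thesis by simp
  qed
  with U show ?thesis by blast
qed

lemma mild_solution_initial:
  assumes "mild_solution h f T U0 U"
  shows "U 0 = U0"
proof -
  have "\<forall>t\<in>{0..T}. ((\<lambda>s. E (t - s) (B (U s))) has_integral (U t - E t U0)) {0..t}"
    using assms unfolding mild_solution_def by blast
  then have "((\<lambda>s. E (0 - s) (B (U s))) has_integral (U 0 - E 0 U0)) {0..0}"
    by (rule bspec) (use T_pos in simp)
  moreover have "((\<lambda>s. E (0 - s) (B (U s))) has_integral 0) {0..0}"
    using has_integral_refl(1)[of "\<lambda>s. E (0 - s) (B (U s))" 0] unfolding cbox_interval .
  ultimately have "U 0 - E 0 U0 = 0" by (rule has_integral_unique)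
  then show ?thesis by simp
qed

text \<open>A competing solution need not lie in the ball of radius \<open>R\<close> a priori. At the first time at which its
  norm reaches \<open>R\<close>, its norm would have to be at most \<open>2 C + 1 < R\<close>.\<close>

lemma mild_solution_bound:
  assumes W: "mild_solution h f T U0 W" and U0: "N U0 \<le> C" and t: "t \<in> {0..T}"
  shows "N (W t) \<le> 2 * C + 1"
proof -
  have cW: "continuous_on {0..T} W" using W by (simp add: mild_solution_def)
  have W_int: "((\<lambda>s. E (t - s) (B (W s))) has_integral (W t - E t U0)) {0..t}" if "t \<in> {0..T}" for t
    using W that by (simp add: mild_solution_def)
  have improve: "N (W t) \<le> 2 * C + 1" if t: "t \<in> {0..T}" and "\<And>s. s \<in> {0..t} \<Longrightarrow> N (W s) \<le> R" for t
    using Duhamel_bound[OF W_int[OF t] _ _ that(2) U0] t by simp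
  have cN: "continuous_on {0..T} (\<lambda>t. N (W t))" by (rule continuous_on[OF cW])
  have "N (W s) < R" if s: "s \<in> {0..T}" for s
  proof (rule ccontr)
    assume "\<not> N (W s) < R"
    define Z where "Z = {s \<in> {0..T}. R \<le> N (W s)}"
    have "s \<in> Z" using s \<open>\<not> N (W s) < R\<close> by (simp add: Z_def)
    have "closed Z"
      unfolding Z_def by (rule continuous_on_closed_Collect_le[OF continuous_on_const cN closed_atLeastAtMost])
    moreover have "bounded Z" by (rule bounded_subset[OF bounded_closed_interval[of 0 T]]) (auto simp: Z_def)
    ultimately have "compact Z" by (simp add: compact_eq_bounded_closed)
    then obtain t1 where t1: "t1 \<in> Z" and first: "\<And>r. r \<in> Z \<Longrightarrow> t1 \<le> r"
      using compact_attains_inf[of Z] \<open>s \<in> Z\<close> by blast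
    have t1T: "t1 \<in> {0..T}" and RW: "R \<le> N (W t1)" using t1 by (auto simp: Z_def)
    have "N (W 0) \<le> R" using mild_solution_initial[OF W] U0 C_nonneg by (simp add: R_def)
    moreover have "continuous_on {0..t1} (\<lambda>t. N (W t))"
      by (rule continuous_on_subset[OF cN]) (use t1T in auto)
    ultimately obtain r where r: "0 \<le> r" "r \<le> t1" "N (W r) = R"
      using IVT'[of "\<lambda>t. N (W t)" 0 R t1] RW t1T by auto
    then have "r \<in> Z" using t1T by (simp add: Z_def)
    then have "r = t1" using first r by force
    have "N (W q) \<le> R" if "q \<in> {0..t1}" for q
    proof (cases "q = t1")
      case True
      then show ?thesis using r \<open>r = t1\<close> by simp
    next
      case False
      then have "q \<notin> Z" using first[of q] that by auto
      then show ?thesis using that t1T by (auto simp: Z_def)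
    qed
    then have "N (W t1) \<le> 2 * C + 1" by (rule improve[OF t1T])
    then show False using RW by (simp add: R_def)
  qed
  then have "\<And>s. s \<in> {0..t} \<Longrightarrow> N (W s) \<le> R" using t by (auto intro: less_imp_le)
  then show ?thesis by (rule improve[OF t])
qed

lemma mild_solution_unique:
  assumes U: "mild_solution h f T U0 U" and W: "mild_solution h f T U0 W" and U0: "N U0 \<le> C" and t: "t \<in> {0..T}"
  shows "W t = U t"
proof -
  have "continuous_on {0..T} (\<lambda>t. N (W t - U t))"
    using U W by (intro continuous_on continuous_on_diff) (simp_all add: mild_solution_def)
  then obtain m where m: "m \<in> {0..T}" and sup: "\<And>s. s \<in> {0..T} \<Longrightarrow> N (W s - U s) \<le> N (W m - U m)"
    using continuous_attains_sup[OF compact_Icc, of 0 T "\<lambda>t. N (W t - U t)"] T_pos by auto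
  have int: "((\<lambda>s. E (m - s) (B (Y s))) has_integral (Y m - E m U0)) {0..m}" if "mild_solution h f T U0 Y" for Y
    using that m by (simp add: mild_solution_def)
  have ball: "N (Y s) \<le> R" if "mild_solution h f T U0 Y" "s \<in> {0..m}" for Y s
    using mild_solution_bound[OF that(1) U0, of s] that(2) m by (simp add: R_def)
  have "N ((W m - E m U0) - (U m - E m U0)) \<le> N (W m - U m) / 2"
    by (rule Duhamel_contraction[OF int[OF W] int[OF U] _ _ ball[OF W] ball[OF U]])
      (use m in \<open>auto intro: sup\<close>)
  then have "N (W m - U m) \<le> 0" by simp
  then have "N (W t - U t) \<le> 0" using sup[OF t] by linarith
  then have "norm (W t - U t) \<le> 0"
    using lower[of "W t - U t"] mult_left_mono[of "N (W t - U t)" 0 "sqrt (1 + 6 / h\<^sup>2)"] c'_nonneg by linarith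
  then show ?thesis by simp
qed

lemma ex_mild_solution:
  assumes U0: "N U0 \<le> C"
  shows "\<exists>U. mild_solution h f T U0 U"
proof -
  obtain U where U: "U \<in> paths" and fix_U: "\<And>t. t \<in> {0..T} \<Longrightarrow> Duhamel U0 U t = U t"
    using ex_Duhamel_fixed_point[OF U0] by blast
  have "K_invertible h f (fst (U t))" if "t \<in> {0..T}" for t
  proof (rule K_invertible)
    have "N (U t) \<le> R" using U that by (simp add: paths_def)
    then show "norm (fst (U t)) \<le> R" using norm_H1_H1h_components(1)[of "U t" h] by linarith
  qed
  moreover have "((\<lambda>s. E (t - s) (B (U s))) has_integral (U t - E t U0)) {0..t}" if "t \<in> {0..T}" for t
    using Duhamel_integral[OF U that, of U0] fix_U[OF that] by simp
  ultimately show ?thesis using U by (auto simp: mild_solution_def paths_def)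
qed

end

section \<open>The constants\<close>

text \<open>The constant \<open>F\<close> dominates the derivatives of \<open>V\<close> of order one to four on a compact interval; the fourth
  one bounds the Lipschitz constant of \<open>f''\<close>.\<close>

lemma smooth_imp_C2_bounds:
  assumes "smooth V" "f = deriv V"
  shows "continuous_on UNIV f" "continuous_on UNIV (deriv f)" "continuous_on UNIV (deriv (deriv f))"
    and "\<exists>F\<ge>0. \<forall>\<phi>\<in>{f, deriv f, deriv (deriv f)}. (\<forall>x. \<bar>x\<bar> \<le> r \<longrightarrow> \<bar>\<phi> x\<bar> \<le> F)
      \<and> (\<forall>x y. \<bar>x\<bar> \<le> r \<longrightarrow> \<bar>y\<bar> \<le> r \<longrightarrow> \<bar>\<phi> x - \<phi> y\<bar> \<le> F * \<bar>x - y\<bar>)"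
proof -
  define g where "g n = (deriv ^^ n) V" for n
  have d: "(g n has_field_derivative g (Suc n) x) (at x)" for n x
    using assms(1) by (simp add: g_def smooth_def DERIV_deriv_iff_field_differentiable)
  have g: "f = g 1" "deriv f = g 2" "deriv (deriv f) = g 3"
    by (simp_all add: g_def assms(2) numeral_2_eq_2 numeral_3_eq_3)
  have c: "continuous_on S (g n)" for n S
    by (rule continuous_at_imp_continuous_on) (use DERIV_isCont[OF d] in blast)
  show "continuous_on UNIV f" "continuous_on UNIV (deriv f)" "continuous_on UNIV (deriv (deriv f))"
    using c[of UNIV 1] c[of UNIV 2] c[of UNIV 3] by (simp_all only: g[symmetric])
  have "\<exists>b. \<forall>x. \<bar>x\<bar> \<le> r \<longrightarrow> \<bar>g n x\<bar> \<le> b" for n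
  proof -
    have "bounded (g n ` {- r..r})" by (intro compact_imp_bounded compact_continuous_image c compact_Icc)
    then obtain a where a: "\<forall>x\<in>{- r..r}. \<bar>g n x\<bar> \<le> a" by (auto simp: bounded_iff)
    have "\<bar>g n x\<bar> \<le> a" if "\<bar>x\<bar> \<le> r" for x by (rule bspec[OF a]) (use that in auto)
    then show ?thesis by blast
  qed
  then obtain b where b: "\<And>n x. \<bar>x\<bar> \<le> r \<Longrightarrow> \<bar>g n x\<bar> \<le> b n" by metis
  define F where "F = \<bar>b 1\<bar> + \<bar>b 2\<bar> + \<bar>b 3\<bar> + \<bar>b 4\<bar>"
  have F: "\<bar>g n x\<bar> \<le> F" if "\<bar>x\<bar> \<le> r" "n \<in> {1, 2, 3, 4}" for n x
    using b[OF that(1), of n] that(2) by (auto simp: F_def)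
  have l: "\<bar>g n x - g n y\<bar> \<le> F * \<bar>x - y\<bar>" if "\<bar>x\<bar> \<le> r" "\<bar>y\<bar> \<le> r" "n \<in> {1, 2, 3}" for n x y
  proof -
    have n: "Suc n \<in> {1, 2, 3, 4}" using that(3) by auto
    have "norm (g n x - g n y) \<le> F * norm (x - y)"
    proof (rule field_differentiable_bound[of "{- r..r}"])
      show "norm (g (Suc n) z) \<le> F" if "z \<in> {- r..r}" for z
        using F[OF _ n, of z] that by (simp add: abs_le_iff)
    qed (use that d in \<open>auto intro: has_field_derivative_at_within simp: abs_le_iff\<close>)
    then show ?thesis by simp
  qed
  have range: "{f, deriv f, deriv (deriv f)} = g ` {1, 2, 3}"
    by (simp only: image_insert image_empty g[symmetric])
  have "F \<ge> 0" by (simp add: F_def)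
  then show "\<exists>F\<ge>0. \<forall>\<phi>\<in>{f, deriv f, deriv (deriv f)}. (\<forall>x. \<bar>x\<bar> \<le> r \<longrightarrow> \<bar>\<phi> x\<bar> \<le> F)
      \<and> (\<forall>x y. \<bar>x\<bar> \<le> r \<longrightarrow> \<bar>y\<bar> \<le> r \<longrightarrow> \<bar>\<phi> x - \<phi> y\<bar> \<le> F * \<bar>x - y\<bar>)"
    unfolding range by (intro exI[of _ F]) (auto intro: F l)
qed

theorem theorem2:
  fixes V f :: "real \<Rightarrow> real"
  assumes "smooth V" and "f = deriv V"
  shows "\<forall>C>0. \<exists>T>0. \<exists>hs>0. \<exists>C'. \<forall>h\<in>{0<..hs}. \<forall>U0. norm_H1_H1h h U0 \<le> C \<longrightarrow>
    (\<exists>U. mild_solution h f T U0 U \<and> U 0 = U0 \<and>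
      (\<forall>W. mild_solution h f T U0 W \<longrightarrow> (\<forall>t\<in>{0..T}. W t = U t)) \<and>
      (\<forall>t\<in>{0..T}. norm_H1_H1h h (U t) \<le> C'))"
proof (intro allI impI)
  fix C :: real assume C: "C > 0"
  define R where "R = 2 * C + 2"
  obtain F where F: "F \<ge> 0"
    and bound: "\<And>\<phi> x. \<phi> \<in> {f, deriv f, deriv (deriv f)} \<Longrightarrow> \<bar>x\<bar> \<le> sobolev_const * R \<Longrightarrow> \<bar>\<phi> x\<bar> \<le> F"
    and lip: "\<And>\<phi> x y. \<phi> \<in> {f, deriv f, deriv (deriv f)} \<Longrightarrow> \<bar>x\<bar> \<le> sobolev_const * R \<Longrightarrow> \<bar>y\<bar> \<le> sobolev_const * R
      \<Longrightarrow> \<bar>\<phi> x - \<phi> y\<bar> \<le> F * \<bar>x - y\<bar>"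
    using smooth_imp_C2_bounds(4)[OF assms, of "sobolev_const * R"] by blast
  define \<beta> where "\<beta> = 2 * (F * (1 + sobolev_const * R)\<^sup>2)"
  define \<Lambda> where "\<Lambda> = 6 * F * sobolev_const * (1 + sobolev_const * R)\<^sup>2"
  \<comment> \<open>The summands \<open>1\<close> in both denominators only avoid a division by zero.\<close>
  define T where "T = min 1 (1 / (4 * (\<beta> + \<Lambda> + 1)))"
  define hs where "hs = min 1 (1 / (F * sobolev_const + 1))"
  have nonneg: "\<beta> \<ge> 0" "\<Lambda> \<ge> 0" "F * sobolev_const \<ge> 0"
    using F sobolev_const_nonneg by (simp_all add: \<beta>_def \<Lambda>_def)
  have T: "T > 0" "T \<le> 1" using nonneg by (simp_all add: T_def)
  have hs: "hs > 0" using nonneg by (simp add: hs_def)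
  have "T * (4 * (\<beta> + \<Lambda> + 1)) \<le> 1"
    using nonneg by (subst pos_le_divide_eq[symmetric]) (simp_all add: T_def)
  then have "4 * (\<beta> * T) + 4 * (\<Lambda> * T) + 4 * T \<le> 1" by (simp add: algebra_simps)
  moreover have "\<beta> * T \<ge> 0" "\<Lambda> * T \<ge> 0" using nonneg T by simp_all
  ultimately have T\<beta>: "2 * \<beta> * T \<le> 1" and T\<Lambda>: "2 * \<Lambda> * T \<le> 1 / 2" using T by simp_all
  have "\<exists>U. mild_solution h f T U0 U \<and> U 0 = U0 \<and>
      (\<forall>W. mild_solution h f T U0 W \<longrightarrow> (\<forall>t\<in>{0..T}. W t = U t)) \<and>
      (\<forall>t\<in>{0..T}. norm_H1_H1h h (U t) \<le> 2 * C + 1)"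
    if h: "h \<in> {0<..hs}" and U0: "norm_H1_H1h h U0 \<le> C" for h U0
  proof -
    have "h * (F * sobolev_const + 1) \<le> 1"
      using h nonneg by (subst pos_le_divide_eq[symmetric]) (simp_all add: hs_def)
    then have "h * F * sobolev_const \<le> 1" using h by (simp add: algebra_simps)
    then interpret picard h F R f C T \<beta> \<Lambda>
      using h F C T T\<beta> T\<Lambda> smooth_imp_C2_bounds(1-3)[OF assms]
      by unfold_locales (auto simp: hs_def R_def \<beta>_def \<Lambda>_def bound lip)
    obtain U where U: "mild_solution h f T U0 U" using ex_mild_solution[OF U0] by blast
    show ?thesis
      using U mild_solution_initial[OF U] mild_solution_unique[OF U _ U0] mild_solution_bound[OF U U0] by blast
  qed
  then show "\<exists>T>0. \<exists>hs>0. \<exists>C'. \<forall>h\<in>{0<..hs}. \<forall>U0. norm_H1_H1h h U0 \<le> C \<longrightarrow>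
    (\<exists>U. mild_solution h f T U0 U \<and> U 0 = U0 \<and>
      (\<forall>W. mild_solution h f T U0 W \<longrightarrow> (\<forall>t\<in>{0..T}. W t = U t)) \<and>
      (\<forall>t\<in>{0..T}. norm_H1_H1h h (U t) \<le> C'))"
    using T(1) hs by blast
qed

end
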